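(* Let $\mathscr{T}$ be a $\mathscr{J}$-theory, let $\mathscr{C}$ be a $\mathscr{V}$-category with $\mathscr{J}$-powers, and suppose that $\mathscr{C}$ admits limits of $\mathscr{T}$-algebras weighted by $\mathscr{T}$-algebras. Let $S:\mathscr{C}^{\mathrm{op}}\to\mathscr{T}\text{-}\mathrm{Alg}$ be a $\mathscr{V}$-functor. (1) $S$ is representable if and only if $S$ has a left adjoint. (2) If $S$ has a left adjoint $L:\mathscr{T}\text{-}\mathrm{Alg}\to\mathscr{C}^{\mathrm{op}}$, then the composite $$\mathscr{T}\xrightarrow{Y^{\mathrm{op}}}\mathscr{T}\text{-}\mathrm{Alg}^{\mathrm{op}}\xrightarrow{L^{\mathrm{op}}}\mathscr{C}$$ is a $\mathscr{T}$-algebra in $\mathscr{C}$, and $S\cong\llbracket -,L^{\mathrm{op}}Y^{\mathrm{op}}\rrbracket$.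
   Context: Setting. $\mathscr{V}=(\mathscr{V},\otimes,I)$ is a symmetric monoidal closed category whose underlying ordinary category has finite limits. All $\mathscr{V}$-enriched notions are those of Kelly's book; $\mathscr{V}$-categories may be large. Systems of arities and theories. $\mathscr{J}\hookrightarrow\mathscr{V}$ is a system of arities, i.e. a full sub-$\mathscr{V}$-category closed under $\otimes$ and containing $I$. A power $C^X$ in a $\mathscr{V}$-category $\mathscr{C}$ ($X\in\mathscr{V}$, $C\in\mathscr{C}$) is an object with $\mathscr{V}$-natural isomorphisms $\mathscr{C}(B,C^X)\cong\mathscr{V}(X,\mathscr{C}(B,C))$; $\mathscr{C}$ has $\mathscr{J}$-powers if it is equipped with a designated power $C^J$ for all $J\in\mathscr{J}$, $C\in\mathscr{C}$ (with $C^I=C$, and with counit $I\to\mathscr{C}(C,C)$ the identity). A $\mathscr{J}$-theory is a $\mathscr{V}$-category $\mathscr{T}$ with $\mathrm{ob}\,\mathscr{T}=\mathrm{ob}\,\mathscr{J}$, equipped with an identity-on-objects $\mathscr{V}$-functor $\mathscr{J}^{\mathrm{op}}\to\mathscr{T}$ that preserves $\mathscr{J}$-powers. Algebras. A $\mathscr{T}$-algebra in a $\mathscr{V}$-category $\mathscr{C}$ with $\mathscr{J}$-powers is a $\mathscr{V}$-functor $\mathscr{T}\to\mathscr{C}$ that preserves $\mathscr{J}$-powers. $\mathscr{T}\text{-}\mathrm{Alg}$ denotes the full subcategory of $[\mathscr{T},\mathscr{V}]$ on the $\mathscr{T}$-algebras in $\mathscr{V}$, and $G^{\mathscr{T}}:\mathscr{T}\text{-}\mathrm{Alg}\to\mathscr{V}$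 is evaluation at $I$. Throughout, $\mathscr{J}$ is amenable: for every $\mathscr{J}$-theory $\mathscr{T}$, $\mathscr{T}\text{-}\mathrm{Alg}$ exists as a $\mathscr{V}$-category (the ends defining its homs exist in $\mathscr{V}$) and $G^{\mathscr{T}}$ has a left adjoint. Notation for this statement. $Y:\mathscr{T}^{\mathrm{op}}\to\mathscr{T}\text{-}\mathrm{Alg}$ is the fully faithful $\mathscr{V}$-functor $YJ=\mathscr{T}(J,-)$. For a $\mathscr{T}$-algebra $E:\mathscr{T}\to\mathscr{C}$, $\llbracket -,E\rrbracket:\mathscr{C}^{\mathrm{op}}\to\mathscr{T}\text{-}\mathrm{Alg}$ is the $\mathscr{V}$-functor $\llbracket C,E\rrbracket=\mathscr{C}(C,E-):\mathscr{T}\to\mathscr{V}$. A $\mathscr{V}$-functor $S:\mathscr{C}^{\mathrm{op}}\to\mathscr{T}\text{-}\mathrm{Alg}$ is representable if $S\cong\llbracket -,E\rrbracket$ for some $\mathscr{T}$-algebra $E:\mathscr{T}\to\mathscr{C}$. $\mathscr{C}$ admits limits of $\mathscr{T}$-algebras weighted by $\mathscr{T}$-algebras if the weighted limit $\{A,E\}$ exists in $\mathscr{C}$ for all $\mathscr{T}$-algebras $A:\mathscr{T}\to\mathscr{V}$ and $E:\mathscr{T}\to\mathscr{C}$. *)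

theory Defs
  imports "HOL-Library.FuncSet"
begin

section \<open>Ordinary categories and finite limits\<close>

record ('o, 'm) cat =
  Ob :: "'o set"
  Ar :: "'m set"
  Dom :: "'m \<Rightarrow> 'o"
  Cod :: "'m \<Rightarrow> 'o"
  Id :: "'o \<Rightarrow> 'm"
  Cmp :: "'m \<Rightarrow> 'm \<Rightarrow> 'm" (infixl "\<cdot>\<index>" 65)

definition hom :: "('o, 'm, 'z) cat_scheme \<Rightarrow> 'o \<Rightarrow> 'o \<Rightarrow> 'm set" where
  "hom C a b = {f \<in> Ar C. Dom C f = a \<and> Cod C f = b}"

locale category =
  fixes C :: "('o, 'm, 'z) cat_scheme" (structure)
  assumes Dom_Ob: "f \<in> Ar C \<Longrightarrow> Dom C f \<in> Ob C"
    and Cod_Ob: "f \<in> Ar C \<Longrightarrow> Cod C f \<in> Ob C"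
    and Id_hom: "a \<in> Ob C \<Longrightarrow> Id C a \<in> hom C a a"
    and Cmp_hom: "g \<in> hom C b c \<Longrightarrow> f \<in> hom C a b \<Longrightarrow> g \<cdot> f \<in> hom C a c"
    and Id_left: "f \<in> hom C a b \<Longrightarrow> Id C b \<cdot> f = f"
    and Id_right: "f \<in> hom C a b \<Longrightarrow> f \<cdot> Id C a = f"
    and Cmp_assoc: "h \<in> hom C c d \<Longrightarrow> g \<in> hom C b c \<Longrightarrow> f \<in> hom C a b \<Longrightarrow>
      (h \<cdot> g) \<cdot> f = h \<cdot> (g \<cdot> f)"

definition inverse_arrows :: "('o, 'm, 'z) cat_scheme \<Rightarrow> 'm \<Rightarrow> 'm \<Rightarrow> bool" where
  "inverse_arrows C f g \<longleftrightarrow> f \<in> Ar C \<and> g \<in> hom C (Cod C f) (Dom C f) \<and>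
     g \<cdot>\<^bsub>C\<^esub> f = Id C (Dom C f) \<and> f \<cdot>\<^bsub>C\<^esub> g = Id C (Cod C f)"

definition iso :: "('o, 'm, 'z) cat_scheme \<Rightarrow> 'm \<Rightarrow> bool" where
  "iso C f \<longleftrightarrow> (\<exists>g. inverse_arrows C f g)"

definition inv_arrow :: "('o, 'm, 'z) cat_scheme \<Rightarrow> 'm \<Rightarrow> 'm" where
  "inv_arrow C f = (THE g. inverse_arrows C f g)"

definition is_diagram :: "('i, 'j, 'y) cat_scheme \<Rightarrow> ('o, 'm, 'z) cat_scheme \<Rightarrow>
    ('i \<Rightarrow> 'o) \<Rightarrow> ('j \<Rightarrow> 'm) \<Rightarrow> bool" where
  "is_diagram D C Fo Fa \<longleftrightarrow>
     (\<forall>i\<in>Ob D. Fo i \<in> Ob C \<and> Fa (Id D i) = Id C (Fo i)) \<and>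
     (\<forall>u\<in>Ar D. Fa u \<in> hom C (Fo (Dom D u)) (Fo (Cod D u))) \<and>
     (\<forall>u\<in>Ar D. \<forall>v\<in>Ar D. Cod D u = Dom D v \<longrightarrow> Fa (v \<cdot>\<^bsub>D\<^esub> u) = Fa v \<cdot>\<^bsub>C\<^esub> Fa u)"

definition is_cone :: "('i, 'j, 'y) cat_scheme \<Rightarrow> ('o, 'm, 'z) cat_scheme \<Rightarrow>
    ('i \<Rightarrow> 'o) \<Rightarrow> ('j \<Rightarrow> 'm) \<Rightarrow> 'o \<Rightarrow> ('i \<Rightarrow> 'm) \<Rightarrow> bool" where
  "is_cone D C Fo Fa x p \<longleftrightarrow> x \<in> Ob C \<and> (\<forall>i\<in>Ob D. p i \<in> hom C x (Fo i)) \<and>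
     (\<forall>u\<in>Ar D. Fa u \<cdot>\<^bsub>C\<^esub> p (Dom D u) = p (Cod D u))"

definition is_limit :: "('i, 'j, 'y) cat_scheme \<Rightarrow> ('o, 'm, 'z) cat_scheme \<Rightarrow>
    ('i \<Rightarrow> 'o) \<Rightarrow> ('j \<Rightarrow> 'm) \<Rightarrow> 'o \<Rightarrow> ('i \<Rightarrow> 'm) \<Rightarrow> bool" where
  "is_limit D C Fo Fa l p \<longleftrightarrow> is_cone D C Fo Fa l p \<and>
     (\<forall>x q. is_cone D C Fo Fa x q \<longrightarrow> (\<exists>!f. f \<in> hom C x l \<and> (\<forall>i\<in>Ob D. p i \<cdot>\<^bsub>C\<^esub> f = q i)))"

(* Every finite category is isomorphic to one whose objects and arrows are natural numbers,
   so it suffices to quantify over index categories of type (nat, nat) cat. *)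
definition has_finite_limits :: "('o, 'm, 'z) cat_scheme \<Rightarrow> bool" where
  "has_finite_limits C \<longleftrightarrow>
     (\<forall>(D :: (nat, nat) cat) Fo Fa.
        category D \<and> finite (Ob D) \<and> finite (Ar D) \<and> is_diagram D C Fo Fa \<longrightarrow>
        (\<exists>l p. is_limit D C Fo Fa l p))"


section \<open>Symmetric monoidal closed categories\<close>

record ('o, 'm) smc = "('o, 'm) cat" +
  tens :: "'o \<Rightarrow> 'o \<Rightarrow> 'o" (infixr "\<otimes>\<index>" 75)
  tens_ar :: "'m \<Rightarrow> 'm \<Rightarrow> 'm" (infixr "\<boxtimes>\<index>" 75)
  unit :: 'o
  assoc :: "'o \<Rightarrow> 'o \<Rightarrow> 'o \<Rightarrow> 'm"
  lunit :: "'o \<Rightarrow> 'm"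
  runit :: "'o \<Rightarrow> 'm"
  sym :: "'o \<Rightarrow> 'o \<Rightarrow> 'm"
  ihom :: "'o \<Rightarrow> 'o \<Rightarrow> 'o"
  ev :: "'o \<Rightarrow> 'o \<Rightarrow> 'm"

locale symmetric_monoidal_closed = category V
  for V :: "('o, 'm) smc" (structure) +
  assumes unit_Ob: "unit V \<in> Ob V"
    and tens_Ob: "a \<in> Ob V \<Longrightarrow> b \<in> Ob V \<Longrightarrow> a \<otimes> b \<in> Ob V"
    and tens_hom: "f \<in> hom V a b \<Longrightarrow> g \<in> hom V c d \<Longrightarrow> f \<boxtimes> g \<in> hom V (a \<otimes> c) (b \<otimes> d)"
    and tens_Id: "a \<in> Ob V \<Longrightarrow> b \<in> Ob V \<Longrightarrow> Id V a \<boxtimes> Id V b = Id V (a \<otimes> b)"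
    and tens_Cmp: "g \<in> hom V b c \<Longrightarrow> f \<in> hom V a b \<Longrightarrow> g' \<in> hom V b' c' \<Longrightarrow> f' \<in> hom V a' b' \<Longrightarrow>
      (g \<cdot> f) \<boxtimes> (g' \<cdot> f') = (g \<boxtimes> g') \<cdot> (f \<boxtimes> f')"
    and assoc_hom: "a \<in> Ob V \<Longrightarrow> b \<in> Ob V \<Longrightarrow> c \<in> Ob V \<Longrightarrow>
      assoc V a b c \<in> hom V ((a \<otimes> b) \<otimes> c) (a \<otimes> (b \<otimes> c)) \<and> iso V (assoc V a b c)"
    and lunit_hom: "a \<in> Ob V \<Longrightarrow> lunit V a \<in> hom V (unit V \<otimes> a) a \<and> iso V (lunit V a)"
    and runit_hom: "a \<in> Ob V \<Longrightarrow> runit V a \<in> hom V (a \<otimes> unit V) a \<and> iso V (runit V a)"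
    and sym_hom: "a \<in> Ob V \<Longrightarrow> b \<in> Ob V \<Longrightarrow> sym V a b \<in> hom V (a \<otimes> b) (b \<otimes> a)"
    and assoc_nat: "f \<in> hom V a a' \<Longrightarrow> g \<in> hom V b b' \<Longrightarrow> h \<in> hom V c c' \<Longrightarrow>
      assoc V a' b' c' \<cdot> ((f \<boxtimes> g) \<boxtimes> h) = (f \<boxtimes> (g \<boxtimes> h)) \<cdot> assoc V a b c"
    and lunit_nat: "f \<in> hom V a a' \<Longrightarrow> lunit V a' \<cdot> (Id V (unit V) \<boxtimes> f) = f \<cdot> lunit V a"
    and runit_nat: "f \<in> hom V a a' \<Longrightarrow> runit V a' \<cdot> (f \<boxtimes> Id V (unit V)) = f \<cdot> runit V a"
    and sym_nat: "f \<in> hom V a a' \<Longrightarrow> g \<in> hom V b b' \<Longrightarrow>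
      sym V a' b' \<cdot> (f \<boxtimes> g) = (g \<boxtimes> f) \<cdot> sym V a b"
    and pentagon: "a \<in> Ob V \<Longrightarrow> b \<in> Ob V \<Longrightarrow> c \<in> Ob V \<Longrightarrow> d \<in> Ob V \<Longrightarrow>
      assoc V a b (c \<otimes> d) \<cdot> assoc V (a \<otimes> b) c d =
      (Id V a \<boxtimes> assoc V b c d) \<cdot> assoc V a (b \<otimes> c) d \<cdot> (assoc V a b c \<boxtimes> Id V d)"
    and triangle: "a \<in> Ob V \<Longrightarrow> b \<in> Ob V \<Longrightarrow>
      (Id V a \<boxtimes> lunit V b) \<cdot> assoc V a (unit V) b = runit V a \<boxtimes> Id V b"
    and sym_sym: "a \<in> Ob V \<Longrightarrow> b \<in> Ob V \<Longrightarrow> sym V b a \<cdot> sym V a b = Id V (a \<otimes> b)"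
    and hexagon: "a \<in> Ob V \<Longrightarrow> b \<in> Ob V \<Longrightarrow> c \<in> Ob V \<Longrightarrow>
      assoc V b c a \<cdot> sym V a (b \<otimes> c) \<cdot> assoc V a b c =
      (Id V b \<boxtimes> sym V a c) \<cdot> assoc V b a c \<cdot> (sym V a b \<boxtimes> Id V c)"
    and ihom_Ob: "y \<in> Ob V \<Longrightarrow> z \<in> Ob V \<Longrightarrow> ihom V y z \<in> Ob V"
    and ev_hom: "y \<in> Ob V \<Longrightarrow> z \<in> Ob V \<Longrightarrow> ev V y z \<in> hom V (ihom V y z \<otimes> y) z"
    and closed: "x \<in> Ob V \<Longrightarrow> y \<in> Ob V \<Longrightarrow> z \<in> Ob V \<Longrightarrow> f \<in> hom V (x \<otimes> y) z \<Longrightarrow>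
      \<exists>!g. g \<in> hom V x (ihom V y z) \<and> ev V y z \<cdot> (g \<boxtimes> Id V y) = f"

text \<open>The transpose \<open>x \<rightarrow> [y, z]\<close> of \<open>f : x \<otimes> y \<rightarrow> z\<close>, and the arrow \<open>y \<rightarrow> z\<close> named by
  \<open>f : I \<rightarrow> [y, z]\<close>.\<close>

definition curry_ar :: "('o, 'm) smc \<Rightarrow> 'o \<Rightarrow> 'o \<Rightarrow> 'o \<Rightarrow> 'm \<Rightarrow> 'm" where
  "curry_ar V x y z f = (THE g. g \<in> hom V x (ihom V y z) \<and> ev V y z \<cdot>\<^bsub>V\<^esub> (g \<boxtimes>\<^bsub>V\<^esub> Id V y) = f)"

definition unname :: "('o, 'm) smc \<Rightarrow> 'o \<Rightarrow> 'o \<Rightarrow> 'm \<Rightarrow> 'm" where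
  "unname V y z f = ev V y z \<cdot>\<^bsub>V\<^esub> (f \<boxtimes>\<^bsub>V\<^esub> Id V y) \<cdot>\<^bsub>V\<^esub> inv_arrow V (lunit V y)"


section \<open>Enriched categories, functors and natural transformations\<close>

text \<open>As in Kelly's book, composition is an arrow
  \<open>vcomp C a b c : C(b, c) \<otimes> C(a, b) \<rightarrow> C(a, c)\<close>.\<close>

record ('o, 'm, 'a) vcat =
  vobj :: "'a set"
  vhom :: "'a \<Rightarrow> 'a \<Rightarrow> 'o"
  vid :: "'a \<Rightarrow> 'm"
  vcomp :: "'a \<Rightarrow> 'a \<Rightarrow> 'a \<Rightarrow> 'm"

definition vcategory :: "('o, 'm) smc \<Rightarrow> ('o, 'm, 'a) vcat \<Rightarrow> bool" where
  "vcategory V C \<longleftrightarrow>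
     (\<forall>a\<in>vobj C. \<forall>b\<in>vobj C. vhom C a b \<in> Ob V) \<and>
     (\<forall>a\<in>vobj C. vid C a \<in> hom V (unit V) (vhom C a a)) \<and>
     (\<forall>a\<in>vobj C. \<forall>b\<in>vobj C. \<forall>c\<in>vobj C.
        vcomp C a b c \<in> hom V (vhom C b c \<otimes>\<^bsub>V\<^esub> vhom C a b) (vhom C a c)) \<and>
     (\<forall>a\<in>vobj C. \<forall>b\<in>vobj C. \<forall>c\<in>vobj C. \<forall>d\<in>vobj C.
        vcomp C a b d \<cdot>\<^bsub>V\<^esub> (vcomp C b c d \<boxtimes>\<^bsub>V\<^esub> Id V (vhom C a b)) =
        vcomp C a c d \<cdot>\<^bsub>V\<^esub> (Id V (vhom C c d) \<boxtimes>\<^bsub>V\<^esub> vcomp C a b c)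
          \<cdot>\<^bsub>V\<^esub> assoc V (vhom C c d) (vhom C b c) (vhom C a b)) \<and>
     (\<forall>a\<in>vobj C. \<forall>b\<in>vobj C.
        vcomp C a b b \<cdot>\<^bsub>V\<^esub> (vid C b \<boxtimes>\<^bsub>V\<^esub> Id V (vhom C a b)) = lunit V (vhom C a b) \<and>
        vcomp C a a b \<cdot>\<^bsub>V\<^esub> (Id V (vhom C a b) \<boxtimes>\<^bsub>V\<^esub> vid C a) = runit V (vhom C a b))"

definition vself :: "('o, 'm) smc \<Rightarrow> ('o, 'm, 'o) vcat" where
  "vself V =
     \<lparr>vobj = Ob V,
      vhom = ihom V,
      vid = (\<lambda>a. curry_ar V (unit V) a a (lunit V a)),
      vcomp = (\<lambda>a b c. curry_ar V (ihom V b c \<otimes>\<^bsub>V\<^esub> ihom V a b) a c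
         (ev V b c \<cdot>\<^bsub>V\<^esub> (Id V (ihom V b c) \<boxtimes>\<^bsub>V\<^esub> ev V a b)
            \<cdot>\<^bsub>V\<^esub> assoc V (ihom V b c) (ihom V a b) a))\<rparr>"

definition vop :: "('o, 'm) smc \<Rightarrow> ('o, 'm, 'a) vcat \<Rightarrow> ('o, 'm, 'a) vcat" where
  "vop V C =
     \<lparr>vobj = vobj C,
      vhom = (\<lambda>a b. vhom C b a),
      vid = vid C,
      vcomp = (\<lambda>a b c. vcomp C c b a \<cdot>\<^bsub>V\<^esub> sym V (vhom C c b) (vhom C b a))\<rparr>"

definition full_sub :: "('o, 'm, 'a) vcat \<Rightarrow> 'a set \<Rightarrow> ('o, 'm, 'a) vcat" where
  "full_sub C A = C\<lparr>vobj := A\<rparr>"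

definition ucomp :: "('o, 'm) smc \<Rightarrow> ('o, 'm, 'a) vcat \<Rightarrow> 'a \<Rightarrow> 'a \<Rightarrow> 'a \<Rightarrow> 'm \<Rightarrow> 'm \<Rightarrow> 'm" where
  \<comment> \<open>composition of \<open>g : b \<rightarrow> c\<close> and \<open>f : a \<rightarrow> b\<close> in the underlying ordinary category\<close>
  "ucomp V C a b c g f =
     vcomp C a b c \<cdot>\<^bsub>V\<^esub> (g \<boxtimes>\<^bsub>V\<^esub> f) \<cdot>\<^bsub>V\<^esub> inv_arrow V (lunit V (unit V))"

record ('m, 'a, 'b) vfun =
  fobj :: "'a \<Rightarrow> 'b"
  fmap :: "'a \<Rightarrow> 'a \<Rightarrow> 'm"

text \<open>Functors take the value \<^term>\<open>undefined\<close> outside the objects of their domain, so that two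
  functors are equal as terms exactly when they are equal as functors.\<close>

definition vfunctor :: "('o, 'm) smc \<Rightarrow> ('o, 'm, 'a) vcat \<Rightarrow> ('o, 'm, 'b) vcat \<Rightarrow>
    ('m, 'a, 'b) vfun \<Rightarrow> bool" where
  "vfunctor V C D F \<longleftrightarrow>
     fobj F \<in> vobj C \<rightarrow>\<^sub>E vobj D \<and>
     (\<forall>a b. \<not> (a \<in> vobj C \<and> b \<in> vobj C) \<longrightarrow> fmap F a b = undefined) \<and>
     (\<forall>a\<in>vobj C. \<forall>b\<in>vobj C. fmap F a b \<in> hom V (vhom C a b) (vhom D (fobj F a) (fobj F b))) \<and>
     (\<forall>a\<in>vobj C. fmap F a a \<cdot>\<^bsub>V\<^esub> vid C a = vid D (fobj F a)) \<and>
     (\<forall>a\<in>vobj C. \<forall>b\<in>vobj C. \<forall>c\<in>vobj C.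
        fmap F a c \<cdot>\<^bsub>V\<^esub> vcomp C a b c =
        vcomp D (fobj F a) (fobj F b) (fobj F c) \<cdot>\<^bsub>V\<^esub> (fmap F b c \<boxtimes>\<^bsub>V\<^esub> fmap F a b))"

definition mk_vfun :: "'a set \<Rightarrow> ('a \<Rightarrow> 'b) \<Rightarrow> ('a \<Rightarrow> 'a \<Rightarrow> 'm) \<Rightarrow> ('m, 'a, 'b) vfun" where
  "mk_vfun A f g =
     \<lparr>fobj = restrict f A,
      fmap = (\<lambda>a b. if a \<in> A \<and> b \<in> A then g a b else undefined)\<rparr>"

definition vfid :: "('o, 'm) smc \<Rightarrow> ('o, 'm, 'a) vcat \<Rightarrow> ('m, 'a, 'a) vfun" where
  "vfid V C = mk_vfun (vobj C) (\<lambda>a. a) (\<lambda>a b. Id V (vhom C a b))"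

definition vfcomp :: "('o, 'm) smc \<Rightarrow> ('o, 'm, 'a) vcat \<Rightarrow> ('m, 'b, 'c) vfun \<Rightarrow> ('m, 'a, 'b) vfun \<Rightarrow>
    ('m, 'a, 'c) vfun" where
  \<comment> \<open>\<open>G \<circ> F\<close>, where \<open>C\<close> is the domain of \<open>F\<close>\<close>
  "vfcomp V C G F = mk_vfun (vobj C) (\<lambda>a. fobj G (fobj F a))
     (\<lambda>a b. fmap G (fobj F a) (fobj F b) \<cdot>\<^bsub>V\<^esub> fmap F a b)"

definition vfop :: "('m, 'a, 'b) vfun \<Rightarrow> ('m, 'a, 'b) vfun" where
  "vfop F = \<lparr>fobj = fobj F, fmap = (\<lambda>a b. fmap F b a)\<rparr>"

definition vnat :: "('o, 'm) smc \<Rightarrow> ('o, 'm, 'a) vcat \<Rightarrow> ('o, 'm, 'b) vcat \<Rightarrow>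
    ('m, 'a, 'b) vfun \<Rightarrow> ('m, 'a, 'b) vfun \<Rightarrow> ('a \<Rightarrow> 'm) \<Rightarrow> bool" where
  "vnat V C D F G \<alpha> \<longleftrightarrow>
     (\<forall>a\<in>vobj C. \<alpha> a \<in> hom V (unit V) (vhom D (fobj F a) (fobj G a))) \<and>
     (\<forall>a\<in>vobj C. \<forall>b\<in>vobj C.
        vcomp D (fobj F a) (fobj F b) (fobj G b) \<cdot>\<^bsub>V\<^esub> (\<alpha> b \<boxtimes>\<^bsub>V\<^esub> fmap F a b)
          \<cdot>\<^bsub>V\<^esub> inv_arrow V (lunit V (vhom C a b)) =
        vcomp D (fobj F a) (fobj G a) (fobj G b) \<cdot>\<^bsub>V\<^esub> (fmap G a b \<boxtimes>\<^bsub>V\<^esub> \<alpha> a)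
          \<cdot>\<^bsub>V\<^esub> inv_arrow V (runit V (vhom C a b)))"

definition vnat_iso :: "('o, 'm) smc \<Rightarrow> ('o, 'm, 'a) vcat \<Rightarrow> ('o, 'm, 'b) vcat \<Rightarrow>
    ('m, 'a, 'b) vfun \<Rightarrow> ('m, 'a, 'b) vfun \<Rightarrow> ('a \<Rightarrow> 'm) \<Rightarrow> bool" where
  "vnat_iso V C D F G \<alpha> \<longleftrightarrow> vnat V C D F G \<alpha> \<and>
     (\<forall>a\<in>vobj C. \<exists>\<beta> \<in> hom V (unit V) (vhom D (fobj G a) (fobj F a)).
        ucomp V D (fobj F a) (fobj G a) (fobj F a) \<beta> (\<alpha> a) = vid D (fobj F a) \<and>
        ucomp V D (fobj G a) (fobj F a) (fobj G a) (\<alpha> a) \<beta> = vid D (fobj G a))"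

definition viso :: "('o, 'm) smc \<Rightarrow> ('o, 'm, 'a) vcat \<Rightarrow> ('o, 'm, 'b) vcat \<Rightarrow>
    ('m, 'a, 'b) vfun \<Rightarrow> ('m, 'a, 'b) vfun \<Rightarrow> bool" where
  "viso V C D F G \<longleftrightarrow> (\<exists>\<alpha>. vnat_iso V C D F G \<alpha>)"

text \<open>\<open>L\<close> is left adjoint to \<open>R\<close>: there are a unit \<open>1 \<rightarrow> R L\<close> and a counit \<open>L R \<rightarrow> 1\<close>
  satisfying the triangle equations.\<close>

definition left_adjoint :: "('o, 'm) smc \<Rightarrow> ('o, 'm, 'a) vcat \<Rightarrow> ('o, 'm, 'b) vcat \<Rightarrow>
    ('m, 'a, 'b) vfun \<Rightarrow> ('m, 'b, 'a) vfun \<Rightarrow> bool" where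
  "left_adjoint V A B L R \<longleftrightarrow> vfunctor V A B L \<and> vfunctor V B A R \<and>
     (\<exists>\<eta> \<epsilon>.
        vnat V A A (vfid V A) (vfcomp V A R L) \<eta> \<and>
        vnat V B B (vfcomp V B L R) (vfid V B) \<epsilon> \<and>
        (\<forall>a\<in>vobj A. let La = fobj L a; RLa = fobj R La in
           ucomp V B La (fobj L RLa) La (\<epsilon> La) (fmap L a RLa \<cdot>\<^bsub>V\<^esub> \<eta> a) = vid B La) \<and>
        (\<forall>b\<in>vobj B. let Rb = fobj R b; LRb = fobj L Rb in
           ucomp V A Rb (fobj R LRb) Rb (fmap R LRb b \<cdot>\<^bsub>V\<^esub> \<epsilon> b) (\<eta> Rb) = vid A Rb))"

text \<open>The representable \<open>C(a, -) : C \<rightarrow> V\<close>.  The contravariant one, \<open>C(-, a) : C\<^sup>o\<^sup>p \<rightarrow> V\<close>, is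
  \<open>hom_fun V (vop V C) a\<close>.\<close>

definition hom_fun :: "('o, 'm) smc \<Rightarrow> ('o, 'm, 'a) vcat \<Rightarrow> 'a \<Rightarrow> ('m, 'a, 'o) vfun" where
  "hom_fun V C a = mk_vfun (vobj C) (\<lambda>b. vhom C a b)
     (\<lambda>b c. curry_ar V (vhom C b c) (vhom C a b) (vhom C a c) (vcomp C a b c))"


section \<open>Objects of natural transformations and weighted limits\<close>

text \<open>A wedge from \<open>x\<close> to \<open>[F -, G -]\<close> is a family \<open>e k : x \<rightarrow> [F k, G k]\<close> that is
  extraordinarily natural in \<open>k\<close>; the condition below is the usual square into
  \<open>[K(k, l), [F k, G l]]\<close>, transposed to arrows \<open>x \<otimes> K(k, l) \<rightarrow> [F k, G l]\<close>.
  The end of \<open>[F -, G -]\<close> is the hom-object \<open>[K, V](F, G)\<close>.\<close>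

definition is_wedge :: "('o, 'm) smc \<Rightarrow> ('o, 'm, 'k) vcat \<Rightarrow> ('m, 'k, 'o) vfun \<Rightarrow> ('m, 'k, 'o) vfun \<Rightarrow>
    'o \<Rightarrow> ('k \<Rightarrow> 'm) \<Rightarrow> bool" where
  "is_wedge V K F G x e \<longleftrightarrow> x \<in> Ob V \<and>
     (\<forall>k\<in>vobj K. e k \<in> hom V x (ihom V (fobj F k) (fobj G k))) \<and>
     (\<forall>k\<in>vobj K. \<forall>l\<in>vobj K.
        vcomp (vself V) (fobj F k) (fobj G k) (fobj G l) \<cdot>\<^bsub>V\<^esub> (fmap G k l \<boxtimes>\<^bsub>V\<^esub> e k)
          \<cdot>\<^bsub>V\<^esub> sym V x (vhom K k l) =
        vcomp (vself V) (fobj F k) (fobj F l) (fobj G l) \<cdot>\<^bsub>V\<^esub> (e l \<boxtimes>\<^bsub>V\<^esub> fmap F k l))"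

definition is_end :: "('o, 'm) smc \<Rightarrow> ('o, 'm, 'k) vcat \<Rightarrow> ('m, 'k, 'o) vfun \<Rightarrow> ('m, 'k, 'o) vfun \<Rightarrow>
    'o \<Rightarrow> ('k \<Rightarrow> 'm) \<Rightarrow> bool" where
  "is_end V K F G h e \<longleftrightarrow> is_wedge V K F G h e \<and>
     (\<forall>x d. is_wedge V K F G x d \<longrightarrow>
        (\<exists>!f. f \<in> hom V x h \<and> (\<forall>k\<in>vobj K. e k \<cdot>\<^bsub>V\<^esub> f = d k)))"

definition has_end :: "('o, 'm) smc \<Rightarrow> ('o, 'm, 'k) vcat \<Rightarrow> ('m, 'k, 'o) vfun \<Rightarrow> ('m, 'k, 'o) vfun \<Rightarrow>
    bool" where
  "has_end V K F G \<longleftrightarrow> (\<exists>h e. is_end V K F G h e)"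

text \<open>A chosen end \<open>[K, V](F, G)\<close>, its projections, and the factorization of a wedge through it;
  meaningful only if \<open>has_end V K F G\<close>.\<close>

definition chosen_end :: "('o, 'm) smc \<Rightarrow> ('o, 'm, 'k) vcat \<Rightarrow> ('m, 'k, 'o) vfun \<Rightarrow>
    ('m, 'k, 'o) vfun \<Rightarrow> 'o \<times> ('k \<Rightarrow> 'm)" where
  "chosen_end V K F G = (SOME (h, e). is_end V K F G h e)"

definition nat_ob :: "('o, 'm) smc \<Rightarrow> ('o, 'm, 'k) vcat \<Rightarrow> ('m, 'k, 'o) vfun \<Rightarrow> ('m, 'k, 'o) vfun \<Rightarrow>
    'o" where
  "nat_ob V K F G = fst (chosen_end V K F G)"

definition nat_proj :: "('o, 'm) smc \<Rightarrow> ('o, 'm, 'k) vcat \<Rightarrow> ('m, 'k, 'o) vfun \<Rightarrow> ('m, 'k, 'o) vfun \<Rightarrow>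
    'k \<Rightarrow> 'm" where
  "nat_proj V K F G = snd (chosen_end V K F G)"

definition end_lift :: "('o, 'm) smc \<Rightarrow> ('o, 'm, 'k) vcat \<Rightarrow> ('m, 'k, 'o) vfun \<Rightarrow> ('m, 'k, 'o) vfun \<Rightarrow>
    'o \<Rightarrow> ('k \<Rightarrow> 'm) \<Rightarrow> 'm" where
  "end_lift V K F G x d =
     (THE f. f \<in> hom V x (nat_ob V K F G) \<and> (\<forall>k\<in>vobj K. nat_proj V K F G k \<cdot>\<^bsub>V\<^esub> f = d k))"

text \<open>The data of \<open>[K, V]\<close>.  Nothing guarantees that all the ends exist, so in general this is
  not a \<open>V\<close>-category; a full subcategory is one as soon as the ends between its objects exist.\<close>

definition fun_cat :: "('o, 'm) smc \<Rightarrow> ('o, 'm, 'k) vcat \<Rightarrow> ('o, 'm, ('m, 'k, 'o) vfun) vcat" where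
  "fun_cat V K =
     \<lparr>vobj = {F. vfunctor V K (vself V) F},
      vhom = nat_ob V K,
      vid = (\<lambda>F. end_lift V K F F (unit V) (\<lambda>k. vid (vself V) (fobj F k))),
      vcomp = (\<lambda>F G H. end_lift V K F H (nat_ob V K G H \<otimes>\<^bsub>V\<^esub> nat_ob V K F G)
         (\<lambda>k. vcomp (vself V) (fobj F k) (fobj G k) (fobj H k)
            \<cdot>\<^bsub>V\<^esub> (nat_proj V K G H k \<boxtimes>\<^bsub>V\<^esub> nat_proj V K F G k)))\<rparr>"

text \<open>For \<open>F : K \<rightarrow> V\<close> and \<open>G : K \<rightarrow> C\<close>, the functor \<open>C\<^sup>o\<^sup>p \<rightarrow> V\<close> sending \<open>b\<close> to
  \<open>W b = [K, V](F, C(b, G -))\<close>.  Its action \<open>C(b', b) \<rightarrow> [W b, W b']\<close> is the transpose of the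
  arrow \<open>C(b', b) \<otimes> W b \<rightarrow> W b'\<close> whose \<open>k\<close>-component composes
  \<open>C(b', b) \<rightarrow> [C(b, G k), C(b', G k)]\<close> with \<open>W b \<rightarrow> [F k, C(b, G k)]\<close>.\<close>

definition weighted_presheaf :: "('o, 'm) smc \<Rightarrow> ('o, 'm, 'k) vcat \<Rightarrow> ('o, 'm, 'c) vcat \<Rightarrow>
    ('m, 'k, 'o) vfun \<Rightarrow> ('m, 'k, 'c) vfun \<Rightarrow> ('m, 'c, 'o) vfun" where
  "weighted_presheaf V K C F G =
     (let CG = (\<lambda>b. vfcomp V K (hom_fun V C b) G);
          W = (\<lambda>b. nat_ob V K F (CG b))
      in mk_vfun (vobj C) W
        (\<lambda>b b'. curry_ar V (vhom C b' b) (W b) (W b')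
           (end_lift V K F (CG b') (vhom C b' b \<otimes>\<^bsub>V\<^esub> W b)
              (\<lambda>k. vcomp (vself V) (fobj F k) (fobj (CG b) k) (fobj (CG b') k)
                 \<cdot>\<^bsub>V\<^esub> (fmap (hom_fun V (vop V C) (fobj G k)) b b' \<boxtimes>\<^bsub>V\<^esub> nat_proj V K F (CG b) k)))))"

definition is_weighted_limit :: "('o, 'm) smc \<Rightarrow> ('o, 'm, 'k) vcat \<Rightarrow> ('o, 'm, 'c) vcat \<Rightarrow>
    ('m, 'k, 'o) vfun \<Rightarrow> ('m, 'k, 'c) vfun \<Rightarrow> 'c \<Rightarrow> bool" where
  "is_weighted_limit V K C F G l \<longleftrightarrow> l \<in> vobj C \<and>
     (\<forall>b\<in>vobj C. has_end V K F (vfcomp V K (hom_fun V C b) G)) \<and>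
     viso V (vop V C) (vself V) (hom_fun V (vop V C) l) (weighted_presheaf V K C F G)"


section \<open>Powers, theories and algebras\<close>

text \<open>\<open>p\<close> is a power of \<open>c\<close> by \<open>x\<close>: there are isomorphisms \<open>\<phi> b : C(b, p) \<rightarrow> [x, C(b, c)]\<close>,
  natural in \<open>b\<close>, with counit \<open>\<kappa> : x \<rightarrow> C(p, c)\<close>, the transpose of
  \<open>\<phi> p \<circ> vid C p : I \<rightarrow> [x, C(p, c)]\<close>.\<close>

definition is_power :: "('o, 'm) smc \<Rightarrow> ('o, 'm, 'c) vcat \<Rightarrow> 'o \<Rightarrow> 'c \<Rightarrow> 'c \<Rightarrow> 'm \<Rightarrow> bool" where
  "is_power V C x c p \<kappa> \<longleftrightarrow> x \<in> Ob V \<and> c \<in> vobj C \<and> p \<in> vobj C \<and>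
     (\<exists>\<phi>. vnat_iso V (vop V C) (vself V)
            (hom_fun V (vop V C) p)
            (vfcomp V (vop V C) (hom_fun V (vself V) x) (hom_fun V (vop V C) c)) \<phi> \<and>
          \<kappa> = unname V x (vhom C p c)
                (unname V (vhom C p p) (ihom V x (vhom C p c)) (\<phi> p) \<cdot>\<^bsub>V\<^esub> vid C p))"

definition has_powers :: "('o, 'm) smc \<Rightarrow> 'o set \<Rightarrow> ('o, 'm, 'c) vcat \<Rightarrow>
    ('o \<Rightarrow> 'c \<Rightarrow> 'c) \<Rightarrow> ('o \<Rightarrow> 'c \<Rightarrow> 'm) \<Rightarrow> bool" where
  "has_powers V J C pow counit \<longleftrightarrow>
     (\<forall>x\<in>J. \<forall>c\<in>vobj C. is_power V C x c (pow x c) (counit x c)) \<and>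
     (\<forall>c\<in>vobj C. pow (unit V) c = c \<and> counit (unit V) c = vid C c)"

text \<open>Preservation is in the usual (not strict) sense: the image of a power is a power.\<close>

definition preserves_powers :: "('o, 'm) smc \<Rightarrow> 'o set \<Rightarrow> ('o, 'm, 'a) vcat \<Rightarrow> ('o, 'm, 'b) vcat \<Rightarrow>
    ('m, 'a, 'b) vfun \<Rightarrow> bool" where
  "preserves_powers V J C D F \<longleftrightarrow>
     (\<forall>x\<in>J. \<forall>c p \<kappa>. is_power V C x c p \<kappa> \<longrightarrow>
        is_power V D x (fobj F c) (fobj F p) (fmap F p c \<cdot>\<^bsub>V\<^esub> \<kappa>))"

definition system_of_arities :: "('o, 'm) smc \<Rightarrow> 'o set \<Rightarrow> bool" where
  "system_of_arities V J \<longleftrightarrow> J \<subseteq> Ob V \<and> unit V \<in> J \<and> (\<forall>a\<in>J. \<forall>b\<in>J. a \<otimes>\<^bsub>V\<^esub> b \<in> J)"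

definition is_theory :: "('o, 'm) smc \<Rightarrow> 'o set \<Rightarrow> ('o, 'm, 'o) vcat \<Rightarrow> ('m, 'o, 'o) vfun \<Rightarrow> bool" where
  "is_theory V J T \<tau> \<longleftrightarrow>
     vcategory V T \<and> vobj T = J \<and>
     vfunctor V (vop V (full_sub (vself V) J)) T \<tau> \<and>
     (\<forall>a\<in>J. fobj \<tau> a = a) \<and>
     preserves_powers V J (vop V (full_sub (vself V) J)) T \<tau>"

definition is_algebra :: "('o, 'm) smc \<Rightarrow> 'o set \<Rightarrow> ('o, 'm, 'o) vcat \<Rightarrow> ('o, 'm, 'c) vcat \<Rightarrow>
    ('m, 'o, 'c) vfun \<Rightarrow> bool" where
  "is_algebra V J T C E \<longleftrightarrow> vfunctor V T C E \<and> preserves_powers V J T C E"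

definition alg_cat :: "('o, 'm) smc \<Rightarrow> 'o set \<Rightarrow> ('o, 'm, 'o) vcat \<Rightarrow>
    ('o, 'm, ('m, 'o, 'o) vfun) vcat" where
  "alg_cat V J T = full_sub (fun_cat V T) {A. is_algebra V J T (vself V) A}"

definition forgetful :: "('o, 'm) smc \<Rightarrow> 'o set \<Rightarrow> ('o, 'm, 'o) vcat \<Rightarrow>
    ('m, ('m, 'o, 'o) vfun, 'o) vfun" where
  "forgetful V J T = mk_vfun (vobj (alg_cat V J T)) (\<lambda>A. fobj A (unit V))
     (\<lambda>A B. nat_proj V T A B (unit V))"

definition amenable :: "('o, 'm) smc \<Rightarrow> 'o set \<Rightarrow> bool" where
  "amenable V J \<longleftrightarrow>
     (\<forall>(T :: ('o, 'm, 'o) vcat) \<tau>. is_theory V J T \<tau> \<longrightarrow>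
        (\<forall>A B. is_algebra V J T (vself V) A \<and> is_algebra V J T (vself V) B \<longrightarrow> has_end V T A B) \<and>
        (\<exists>F. left_adjoint V (vself V) (alg_cat V J T) F (forgetful V J T)))"

definition yoneda :: "('o, 'm) smc \<Rightarrow> ('o, 'm, 'o) vcat \<Rightarrow> ('m, 'o, ('m, 'o, 'o) vfun) vfun" where
  "yoneda V T = mk_vfun (vobj T) (\<lambda>j. hom_fun V T j)
     (\<lambda>i j. end_lift V T (hom_fun V T i) (hom_fun V T j) (vhom T j i)
        (\<lambda>k. fmap (hom_fun V (vop V T) k) i j))"

text \<open>The functor \<open>C\<^sup>o\<^sup>p \<rightarrow> T-Alg\<close> sending \<open>c\<close> to \<open>C(c, E -)\<close>.\<close>

definition bracket :: "('o, 'm) smc \<Rightarrow> ('o, 'm, 'o) vcat \<Rightarrow> ('o, 'm, 'c) vcat \<Rightarrow> ('m, 'o, 'c) vfun \<Rightarrow>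
    ('m, 'c, ('m, 'o, 'o) vfun) vfun" where
  "bracket V T C E =
     (let CE = (\<lambda>c. vfcomp V T (hom_fun V C c) E)
      in mk_vfun (vobj C) CE
        (\<lambda>c d. end_lift V T (CE c) (CE d) (vhom C d c)
           (\<lambda>k. fmap (hom_fun V (vop V C) (fobj E k)) c d)))"

definition representable :: "('o, 'm) smc \<Rightarrow> 'o set \<Rightarrow> ('o, 'm, 'o) vcat \<Rightarrow> ('o, 'm, 'c) vcat \<Rightarrow>
    ('m, 'c, ('m, 'o, 'o) vfun) vfun \<Rightarrow> bool" where
  "representable V J T C S \<longleftrightarrow>
     (\<exists>E. is_algebra V J T C E \<and> viso V (vop V C) (alg_cat V J T) S (bracket V T C E))"

definition admits_algebra_limits :: "('o, 'm) smc \<Rightarrow> 'o set \<Rightarrow> ('o, 'm, 'o) vcat \<Rightarrow>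
    ('o, 'm, 'c) vcat \<Rightarrow> bool" where
  "admits_algebra_limits V J T C \<longleftrightarrow>
     (\<forall>A E. is_algebra V J T (vself V) A \<and> is_algebra V J T C E \<longrightarrow>
        (\<exists>l. is_weighted_limit V T C A E l))"

end

(* A V-functor S into T-Alg is a family of presheaves b |-> (S b) j on C, contravariant in b and
   covariant in j.  If S has a left adjoint L and E j = L (T(j, -)), then
     C(b, E j) = T-Alg(T(j, -), S b) = (S b) j
   by adjointness and Yoneda.  Hence S is isomorphic to C(-, E -), and E preserves powers because
   each S b does and the hom-functors C(b, -) jointly detect powers.
   Conversely, if S = C(-, E -), then the weighted limit {A, E} represents
   b |-> [T, V](A, C(b, E -)) = T-Alg(A, S b), which gives a universal arrow from A to S, and universal
   arrows for all algebras A assemble to a left adjoint. *)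

theory Submission
  imports Defs
begin

text \<open>The overview computes as if \<open>V\<close> were the category of sets, whereas every
  identity here is a diagram in an arbitrary symmetric monoidal closed \<open>V\<close>, with
  associators, symmetries and transposes. The right to compute with elements has to be earned: an
  element of X is an arrow into X from a tensor product of finitely many named variables, and an
  arrow is determined by its value on a generic element. Enriched notions are then restated as
  equations between elements. Two further points shape the argument. The end defining [T, V](F, G)
  is known to exist only between algebras, so every functor fed into a hom-object must be shown to
  be an algebra. And powers are turned into an invertibility condition: by Yoneda the isomorphisms
  in \<open>is_power\<close> are determined by the counit, and in \<open>V\<close> a single
  comparison arrow p \<rightarrow> [x, a] decides. This makes the joint detection of powers by the
  functors C(b, -) a statement about each b separately: at b, the comparison arrow for E is that of
  the algebra S b up to isomorphism.\<close>

type_synonym ('o, 'm) elt = "(nat \<rightharpoonup> 'o) \<times> 'm"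

section \<open>Arrows, isomorphisms and coherence\<close>

context category
begin

lemma Id_ar [simp]:
  assumes "a \<in> Ob C"
  shows "Id C a \<in> Ar C" "Dom C (Id C a) = a" "Cod C (Id C a) = a"
  using Id_hom[OF assms] by (auto simp: hom_def)

lemma Cmp_ar [simp]:
  assumes "f \<in> Ar C" "g \<in> Ar C" "Dom C g = Cod C f"
  shows "g \<cdot> f \<in> Ar C" "Dom C (g \<cdot> f) = Dom C f" "Cod C (g \<cdot> f) = Cod C g"
  using Cmp_hom[of g "Cod C f" "Cod C g" f "Dom C f"] assms by (auto simp: hom_def)

lemma Ob_ar [simp]: "f \<in> Ar C \<Longrightarrow> Dom C f \<in> Ob C" "f \<in> Ar C \<Longrightarrow> Cod C f \<in> Ob C"
  by (fact Dom_Ob Cod_Ob)+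

lemma hom_Ob: "f \<in> hom C a b \<Longrightarrow> a \<in> Ob C \<and> b \<in> Ob C"
  using Dom_Ob Cod_Ob by (auto simp: hom_def)

lemma Id_cmp [simp]:
  "f \<in> Ar C \<Longrightarrow> Cod C f = b \<Longrightarrow> Id C b \<cdot> f = f"
  "f \<in> Ar C \<Longrightarrow> Dom C f = a \<Longrightarrow> f \<cdot> Id C a = f"
  using Id_left[of f "Dom C f" "Cod C f"] Id_right[of f "Dom C f" "Cod C f"]
  by (auto simp: hom_def)

lemma cmp_assoc [simp]:
  assumes "f \<in> Ar C" "g \<in> Ar C" "h \<in> Ar C" "Dom C g = Cod C f" "Dom C h = Cod C g"
  shows "(h \<cdot> g) \<cdot> f = h \<cdot> (g \<cdot> f)"
  using Cmp_assoc[of h "Cod C g" "Cod C h" g "Cod C f" f "Dom C f"] assms by (auto simp: hom_def)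

text \<open>Since \<open>cmp_assoc\<close> nests composites to the right, an equation for
  \<open>g \<cdot> f\<close> no longer matches inside a longer chain. This restates it with a tail
  \<open>r\<close>; \<open>inv_cmp2\<close> and \<open>interchange2\<close> are such versions of
  other simp rules.\<close>

lemma cmp_extend:
  assumes "g \<cdot> f = k" "f \<in> Ar C" "g \<in> Ar C" "Dom C g = Cod C f" "r \<in> Ar C" "Dom C f = Cod C r"
  shows "g \<cdot> (f \<cdot> r) = k \<cdot> r"
  using cmp_assoc[of r f g] assms by simp

lemma inverse_arrows_unique:
  assumes "inverse_arrows C f g" "inverse_arrows C f h"
  shows "g = h"
proof -
  from assms have [simp]: "f \<in> Ar C" "g \<in> Ar C" "h \<in> Ar C" "Dom C g = Cod C f" "Cod C g = Dom C f"
    "Dom C h = Cod C f" "Cod C h = Dom C f" "f \<cdot> g = Id C (Cod C f)" "h \<cdot> f = Id C (Dom C f)"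
    by (auto simp: inverse_arrows_def hom_def)
  have "g = (h \<cdot> f) \<cdot> g" by simp
  also have "\<dots> = h \<cdot> (f \<cdot> g)" by (rule cmp_assoc) auto
  finally show ?thesis by simp
qed

lemma inv_arrow_inverse: "iso C f \<Longrightarrow> inverse_arrows C f (inv_arrow C f)"
  unfolding iso_def inv_arrow_def by (rule theI') (blast intro: inverse_arrows_unique)

lemma inv_ar [simp]:
  assumes "iso C f"
  shows "inv_arrow C f \<in> Ar C" "Dom C (inv_arrow C f) = Cod C f" "Cod C (inv_arrow C f) = Dom C f"
  using inv_arrow_inverse[OF assms] by (auto simp: inverse_arrows_def hom_def)

lemma iso_Ar: "iso C f \<Longrightarrow> f \<in> Ar C"
  by (auto simp: inverse_arrows_def iso_def)

lemma inv_cmp [simp]: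
  assumes "iso C f"
  shows "inv_arrow C f \<cdot> f = Id C (Dom C f)" "f \<cdot> inv_arrow C f = Id C (Cod C f)"
  using inv_arrow_inverse[OF assms] by (auto simp: inverse_arrows_def)

lemma inv_cmp2 [simp]:
  assumes "iso C f" "r \<in> Ar C"
  shows "Cod C r = Dom C f \<Longrightarrow> inv_arrow C f \<cdot> (f \<cdot> r) = r"
    "Cod C r = Cod C f \<Longrightarrow> f \<cdot> (inv_arrow C f \<cdot> r) = r"
  using assms cmp_extend[OF inv_cmp(1)[OF assms(1)], of r] cmp_extend[OF inv_cmp(2)[OF assms(1)], of r]
  by (auto simp: iso_Ar)

lemma isoI:
  assumes "f \<in> hom C a b" "g \<in> hom C b a" "g \<cdot> f = Id C a" "f \<cdot> g = Id C b"
  shows "iso C f" "inv_arrow C f = g"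
proof -
  have i: "inverse_arrows C f g" using assms by (auto simp: inverse_arrows_def hom_def)
  then show "iso C f" by (auto simp: iso_def)
  then show "inv_arrow C f = g" using i inv_arrow_inverse inverse_arrows_unique by blast
qed

lemma iso_inv [simp]: "iso C f \<Longrightarrow> iso C (inv_arrow C f)"
  and inv_inv [simp]: "iso C f \<Longrightarrow> inv_arrow C (inv_arrow C f) = f"
  using isoI[of "inv_arrow C f" "Cod C f" "Dom C f" f] by (auto simp: hom_def iso_Ar)

lemma iso_Id [simp]: "a \<in> Ob C \<Longrightarrow> iso C (Id C a)"
  using isoI[of "Id C a" a a "Id C a"] by (auto simp: hom_def)

lemma iso_cmp [simp]:
  assumes "iso C f" "iso C g" "Dom C g = Cod C f"
  shows "iso C (g \<cdot> f)"
proof -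
  have [simp]: "f \<in> Ar C" "g \<in> Ar C" using assms by (auto simp: iso_Ar)
  show ?thesis
    by (rule isoI[of _ "Dom C f" "Cod C g" "inv_arrow C f \<cdot> inv_arrow C g"])
      (simp_all add: hom_def assms)
qed

lemma iso_cancel_left:
  assumes "h \<cdot> f = h \<cdot> g" "iso C h" "f \<in> Ar C" "g \<in> Ar C" "Cod C f = Dom C h" "Cod C g = Dom C h"
  shows "f = g"
proof -
  have "f = inv_arrow C h \<cdot> (h \<cdot> f)" using assms(2-) by simp
  also have "\<dots> = g" unfolding assms(1) using assms(2-) by simp
  finally show ?thesis .
qed

lemma iso_cancel_right:
  assumes "f \<cdot> h = g \<cdot> h" "iso C h" "f \<in> Ar C" "g \<in> Ar C" "Dom C f = Cod C h" "Dom C g = Cod C h"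
  shows "f = g"
proof -
  have [simp]: "h \<in> Ar C" using assms by (simp add: iso_Ar)
  have "f = (f \<cdot> h) \<cdot> inv_arrow C h" using assms(2-) by simp
  also have "\<dots> = g" unfolding assms(1) using assms(2-) by simp
  finally show ?thesis .
qed

lemma iso_move_left:
  assumes "h \<cdot> f = g" "iso C h" "f \<in> Ar C" "Cod C f = Dom C h"
  shows "f = inv_arrow C h \<cdot> g"
  using assms by (auto simp: iso_Ar)

lemma iso_move_right:
  assumes "f \<cdot> h = g" "iso C h" "f \<in> Ar C" "Dom C f = Cod C h"
  shows "f = g \<cdot> inv_arrow C h"
  using assms by (auto simp: iso_Ar)

end

section \<open>The tensor product and the coherence identities\<close>

context symmetric_monoidal_closed
begin

abbreviation inv where "inv f \<equiv> inv_arrow V f"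
abbreviation U where "U \<equiv> unit V"

lemmas [simp] = unit_Ob tens_Ob ihom_Ob

lemma tens_ar [simp]:
  assumes "f \<in> Ar V" "g \<in> Ar V"
  shows "f \<boxtimes> g \<in> Ar V" "Dom V (f \<boxtimes> g) = Dom V f \<otimes> Dom V g" "Cod V (f \<boxtimes> g) = Cod V f \<otimes> Cod V g"
  using tens_hom[of f "Dom V f" "Cod V f" g "Dom V g" "Cod V g"] assms by (auto simp: hom_def)

lemma tens_Id' [simp]: "a \<in> Ob V \<Longrightarrow> b \<in> Ob V \<Longrightarrow> Id V a \<boxtimes> Id V b = Id V (a \<otimes> b)"
  by (rule tens_Id)

lemma interchange [simp]:
  assumes "f \<in> Ar V" "g \<in> Ar V" "f' \<in> Ar V" "g' \<in> Ar V" "Dom V g = Cod V f" "Dom V g' = Cod V f'"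
  shows "(g \<boxtimes> g') \<cdot> (f \<boxtimes> f') = (g \<cdot> f) \<boxtimes> (g' \<cdot> f')"
  using tens_Cmp[of g "Cod V f" "Cod V g" f "Dom V f" g' "Cod V f'" "Cod V g'" f' "Dom V f'"] assms
  by (auto simp: hom_def)

lemma interchange2 [simp]:
  assumes "f \<in> Ar V" "g \<in> Ar V" "f' \<in> Ar V" "g' \<in> Ar V" "Dom V g = Cod V f" "Dom V g' = Cod V f'"
    "r \<in> Ar V" "Cod V r = Dom V f \<otimes> Dom V f'"
  shows "(g \<boxtimes> g') \<cdot> ((f \<boxtimes> f') \<cdot> r) = ((g \<cdot> f) \<boxtimes> (g' \<cdot> f')) \<cdot> r"
  using cmp_extend[OF interchange, of f g f' g' r] assms by simp

lemma constraint_ar [simp]: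
  "a \<in> Ob V \<Longrightarrow> b \<in> Ob V \<Longrightarrow> c \<in> Ob V \<Longrightarrow> assoc V a b c \<in> Ar V"
  "a \<in> Ob V \<Longrightarrow> b \<in> Ob V \<Longrightarrow> c \<in> Ob V \<Longrightarrow> Dom V (assoc V a b c) = (a \<otimes> b) \<otimes> c"
  "a \<in> Ob V \<Longrightarrow> b \<in> Ob V \<Longrightarrow> c \<in> Ob V \<Longrightarrow> Cod V (assoc V a b c) = a \<otimes> b \<otimes> c"
  "a \<in> Ob V \<Longrightarrow> b \<in> Ob V \<Longrightarrow> c \<in> Ob V \<Longrightarrow> iso V (assoc V a b c)"
  "a \<in> Ob V \<Longrightarrow> lunit V a \<in> Ar V"
  "a \<in> Ob V \<Longrightarrow> Dom V (lunit V a) = U \<otimes> a"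
  "a \<in> Ob V \<Longrightarrow> Cod V (lunit V a) = a"
  "a \<in> Ob V \<Longrightarrow> iso V (lunit V a)"
  "a \<in> Ob V \<Longrightarrow> runit V a \<in> Ar V"
  "a \<in> Ob V \<Longrightarrow> Dom V (runit V a) = a \<otimes> U"
  "a \<in> Ob V \<Longrightarrow> Cod V (runit V a) = a"
  "a \<in> Ob V \<Longrightarrow> iso V (runit V a)"
  "a \<in> Ob V \<Longrightarrow> b \<in> Ob V \<Longrightarrow> sym V a b \<in> Ar V"
  "a \<in> Ob V \<Longrightarrow> b \<in> Ob V \<Longrightarrow> Dom V (sym V a b) = a \<otimes> b"
  "a \<in> Ob V \<Longrightarrow> b \<in> Ob V \<Longrightarrow> Cod V (sym V a b) = b \<otimes> a"
  "a \<in> Ob V \<Longrightarrow> b \<in> Ob V \<Longrightarrow> ev V a b \<in> Ar V"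
  "a \<in> Ob V \<Longrightarrow> b \<in> Ob V \<Longrightarrow> Dom V (ev V a b) = ihom V a b \<otimes> a"
  "a \<in> Ob V \<Longrightarrow> b \<in> Ob V \<Longrightarrow> Cod V (ev V a b) = b"
  using assoc_hom[of a b c] lunit_hom[of a] runit_hom[of a] sym_hom[of a b] ev_hom[of a b]
  by (auto simp: hom_def)

lemma sym_iso [simp]:
  assumes "a \<in> Ob V" "b \<in> Ob V"
  shows "iso V (sym V a b)" "inv (sym V a b) = sym V b a"
  using isoI[of "sym V a b" "a \<otimes> b" "b \<otimes> a" "sym V b a"] assms sym_sym by (auto simp: hom_def)

lemma iso_tens [simp]:
  assumes "iso V f" "iso V g"
  shows "iso V (f \<boxtimes> g)" "inv (f \<boxtimes> g) = inv f \<boxtimes> inv g"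
proof -
  have [simp]: "f \<in> Ar V" "g \<in> Ar V" using assms by (auto simp: iso_Ar)
  have "iso V (f \<boxtimes> g) \<and> inv (f \<boxtimes> g) = inv f \<boxtimes> inv g"
    by (intro conjI; rule isoI[of _ "Dom V f \<otimes> Dom V g" "Cod V f \<otimes> Cod V g" "inv f \<boxtimes> inv g"])
      (simp_all add: hom_def assms)
  then show "iso V (f \<boxtimes> g)" "inv (f \<boxtimes> g) = inv f \<boxtimes> inv g" by auto
qed

text \<open>The natural isomorphism \<open>runit\<close> identifies tensoring with \<open>U\<close>
  with the identity functor. Coherence identities may therefore be checked after tensoring with the
  unit, where pentagon and triangle have room to apply.\<close>

lemma runit_faithful:
  assumes "f \<boxtimes> Id V U = g \<boxtimes> Id V U" "f \<in> Ar V" "g \<in> Ar V" "Dom V f = Dom V g" "Cod V f = Cod V g"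
  shows "f = g"
proof -
  have "f \<cdot> runit V (Dom V f) = g \<cdot> runit V (Dom V g)"
    using runit_nat[of f "Dom V f" "Cod V f"] runit_nat[of g "Dom V g" "Cod V g"] assms
    by (auto simp: hom_def)
  then show ?thesis using assms by (auto intro: iso_cancel_right[of _ "runit V (Dom V f)"])
qed

lemma lunit_faithful:
  assumes "Id V U \<boxtimes> f = Id V U \<boxtimes> g" "f \<in> Ar V" "g \<in> Ar V" "Dom V f = Dom V g" "Cod V f = Cod V g"
  shows "f = g"
proof -
  have "f \<cdot> lunit V (Dom V f) = g \<cdot> lunit V (Dom V g)"
    using lunit_nat[of f "Dom V f" "Cod V f"] lunit_nat[of g "Dom V g" "Cod V g"] assms
    by (auto simp: hom_def)
  then show ?thesis using assms by (auto intro: iso_cancel_right[of _ "lunit V (Dom V f)"])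
qed

lemma assoc_natural:
  assumes "f \<in> Ar V" "g \<in> Ar V" "h \<in> Ar V" "Dom V f = a" "Dom V g = b" "Dom V h = c"
    "Cod V f = a'" "Cod V g = b'" "Cod V h = c'"
  shows "assoc V a' b' c' \<cdot> ((f \<boxtimes> g) \<boxtimes> h) = (f \<boxtimes> (g \<boxtimes> h)) \<cdot> assoc V a b c"
  using assoc_nat[of f a a' g b b' h c c'] assms by (auto simp: hom_def)

lemma pentagon':
  assumes "a \<in> Ob V" "b \<in> Ob V" "c \<in> Ob V" "d \<in> Ob V"
  shows "(Id V a \<boxtimes> assoc V b c d) \<cdot> (assoc V a (b \<otimes> c) d \<cdot> (assoc V a b c \<boxtimes> Id V d)) =
    assoc V a b (c \<otimes> d) \<cdot> assoc V (a \<otimes> b) c d"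
  using pentagon[of a b c d] assms by simp

text \<open>After tensoring with \<open>U\<close> and composing with an associator, the claim is the
  pentagon for a, b, U, U, with the triangle applied at (b, U) and at (a \<otimes> b, U).\<close>

lemma runit_tens:
  assumes "a \<in> Ob V" "b \<in> Ob V"
  shows "runit V (a \<otimes> b) = (Id V a \<boxtimes> runit V b) \<cdot> assoc V a b U"
proof (rule sym, rule runit_faithful, rule iso_cancel_left[where h = "assoc V a b U"])
  let ?A = "assoc V"
  have "?A a b U \<cdot> (((Id V a \<boxtimes> runit V b) \<cdot> ?A a b U) \<boxtimes> Id V U) =
      (?A a b U \<cdot> ((Id V a \<boxtimes> runit V b) \<boxtimes> Id V U)) \<cdot> (?A a b U \<boxtimes> Id V U)"
    using assms by simp
  also have "\<dots> = (Id V a \<boxtimes> (runit V b \<boxtimes> Id V U)) \<cdot> (?A a (b \<otimes> U) U \<cdot> (?A a b U \<boxtimes> Id V U))"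
    using assms by (subst assoc_natural[where a = a and b = "b \<otimes> U" and c = U]) simp_all
  also have "\<dots> = (Id V a \<boxtimes> (Id V b \<boxtimes> lunit V U)) \<cdot>
      ((Id V a \<boxtimes> ?A b U U) \<cdot> (?A a (b \<otimes> U) U \<cdot> (?A a b U \<boxtimes> Id V U)))"
    unfolding triangle[OF assms(2) unit_Ob, THEN sym] using assms by simp
  also have "\<dots> = (Id V a \<boxtimes> (Id V b \<boxtimes> lunit V U)) \<cdot> (?A a b (U \<otimes> U) \<cdot> ?A (a \<otimes> b) U U)"
    using assms by (subst pentagon') simp_all
  also have "\<dots> = (?A a b U \<cdot> ((Id V a \<boxtimes> Id V b) \<boxtimes> lunit V U)) \<cdot> ?A (a \<otimes> b) U U"
    using assms by (subst assoc_natural[where a = a and b = "b" and c = "U \<otimes> U"]) simp_all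
  also have "\<dots> = ?A a b U \<cdot> ((Id V (a \<otimes> b) \<boxtimes> lunit V U) \<cdot> ?A (a \<otimes> b) U U)"
    using assms by simp
  also have "\<dots> = ?A a b U \<cdot> (runit V (a \<otimes> b) \<boxtimes> Id V U)"
    using assms by (subst triangle) simp_all
  finally show "?A a b U \<cdot> (((Id V a \<boxtimes> runit V b) \<cdot> ?A a b U) \<boxtimes> Id V U) =
    ?A a b U \<cdot> (runit V (a \<otimes> b) \<boxtimes> Id V U)" .
qed (use assms in simp_all)

text \<open>Mirror image of \<open>runit_tens\<close>: tensor with \<open>U\<close> on the left,
  precompose with two associators, and read off the pentagon for U, U, a, b.\<close>

lemma lunit_tens:
  assumes "a \<in> Ob V" "b \<in> Ob V"
  shows "lunit V (a \<otimes> b) \<cdot> assoc V U a b = lunit V a \<boxtimes> Id V b"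
proof (rule lunit_faithful)
  let ?A = "assoc V"
  show "Id V U \<boxtimes> (lunit V (a \<otimes> b) \<cdot> ?A U a b) = Id V U \<boxtimes> (lunit V a \<boxtimes> Id V b)"
  proof (rule iso_cancel_right[where h = "?A U (U \<otimes> a) b \<cdot> (?A U U a \<boxtimes> Id V b)"])
    have "(Id V U \<boxtimes> (lunit V (a \<otimes> b) \<cdot> ?A U a b)) \<cdot> (?A U (U \<otimes> a) b \<cdot> (?A U U a \<boxtimes> Id V b)) =
      (Id V U \<boxtimes> lunit V (a \<otimes> b)) \<cdot> ((Id V U \<boxtimes> ?A U a b) \<cdot> (?A U (U \<otimes> a) b \<cdot> (?A U U a \<boxtimes> Id V b)))"
      using assms by simp
    also have "\<dots> = ((Id V U \<boxtimes> lunit V (a \<otimes> b)) \<cdot> ?A U U (a \<otimes> b)) \<cdot> ?A (U \<otimes> U) a b"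
      using assms by (subst pentagon') simp_all
    also have "\<dots> = (runit V U \<boxtimes> (Id V a \<boxtimes> Id V b)) \<cdot> ?A (U \<otimes> U) a b"
      using assms by (subst triangle) simp_all
    also have "\<dots> = ?A U a b \<cdot> ((runit V U \<boxtimes> Id V a) \<boxtimes> Id V b)"
      using assms by (subst assoc_natural[where a = "U \<otimes> U" and b = a and c = b]) simp_all
    also have "\<dots> = ?A U a b \<cdot> ((Id V U \<boxtimes> lunit V a) \<boxtimes> Id V b) \<cdot> (?A U U a \<boxtimes> Id V b)"
      using assms by (subst triangle[symmetric]) simp_all
    also have "\<dots> = (Id V U \<boxtimes> (lunit V a \<boxtimes> Id V b)) \<cdot> (?A U (U \<otimes> a) b \<cdot> (?A U U a \<boxtimes> Id V b))"
      using assms by (subst assoc_natural[where a = U and b = "U \<otimes> a" and c = b]) simp_all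
    finally show "(Id V U \<boxtimes> (lunit V (a \<otimes> b) \<cdot> ?A U a b)) \<cdot> (?A U (U \<otimes> a) b \<cdot> (?A U U a \<boxtimes> Id V b)) =
      (Id V U \<boxtimes> (lunit V a \<boxtimes> Id V b)) \<cdot> (?A U (U \<otimes> a) b \<cdot> (?A U U a \<boxtimes> Id V b))" .
  qed (use assms in simp_all)
qed (use assms in simp_all)

text \<open>Naturality of \<open>runit\<close> along \<open>runit V U\<close> gives
  \<open>runit V (U \<otimes> U) = runit V U \<boxtimes> Id V U\<close>. Rewriting one side by
  \<open>runit_tens\<close> and the other by the triangle leaves \<open>lunit V U\<close> facing
  \<open>runit V U\<close>.\<close>

lemma lunit_runit_unit: "lunit V U = runit V U"
proof (rule lunit_faithful)
  have "runit V U \<cdot> runit V (U \<otimes> U) = runit V U \<cdot> (runit V U \<boxtimes> Id V U)"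
    using runit_nat[of "runit V U" "U \<otimes> U" U] by (simp add: hom_def)
  then have "runit V (U \<otimes> U) = runit V U \<boxtimes> Id V U"
    by (rule iso_cancel_left) simp_all
  then have "(Id V U \<boxtimes> lunit V U) \<cdot> assoc V U U U = (Id V U \<boxtimes> runit V U) \<cdot> assoc V U U U"
    using runit_tens[of U U] triangle[of U U] by simp
  then show "Id V U \<boxtimes> lunit V U = Id V U \<boxtimes> runit V U"
    by (rule iso_cancel_right) simp_all
qed simp_all

lemma hexagon':
  assumes "a \<in> Ob V" "b \<in> Ob V" "c \<in> Ob V"
  shows "assoc V b c a \<cdot> (sym V a (b \<otimes> c) \<cdot> assoc V a b c) =
      (Id V b \<boxtimes> sym V a c) \<cdot> (assoc V b a c \<cdot> (sym V a b \<boxtimes> Id V c))"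
  using hexagon[of a b c] assms by simp

lemma sym_natural:
  assumes "f \<in> Ar V" "g \<in> Ar V" "Dom V f = a" "Dom V g = b" "Cod V f = a'" "Cod V g = b'"
  shows "sym V a' b' \<cdot> (f \<boxtimes> g) = (g \<boxtimes> f) \<cdot> sym V a b"
  using sym_nat[of f a a' g b b'] assms by (auto simp: hom_def)

lemma lunit_natural:
  assumes "f \<in> Ar V" "Dom V f = a" "Cod V f = a'"
  shows "lunit V a' \<cdot> (Id V U \<boxtimes> f) = f \<cdot> lunit V a"
  using lunit_nat[of f a a'] assms by (auto simp: hom_def)

lemma runit_natural:
  assumes "f \<in> Ar V" "Dom V f = a" "Cod V f = a'"
  shows "runit V a' \<cdot> (f \<boxtimes> Id V U) = f \<cdot> runit V a"
  using runit_nat[of f a a'] assms by (auto simp: hom_def)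

text \<open>This is the hexagon for a, U, U: moving a past two units in two steps agrees with moving
  it past their product. The common factor \<open>lunit V a \<cdot> sym V a U\<close> is invertible
  and can be cancelled.\<close>

lemma lunit_sym:
  assumes "a \<in> Ob V"
  shows "lunit V a \<cdot> sym V a U = runit V a"
proof (rule runit_faithful, rule iso_cancel_left[where h = "lunit V a \<cdot> sym V a U"])
  let ?A = "assoc V" and ?s = "sym V a U"
  have "(lunit V a \<cdot> ?s) \<cdot> ((lunit V a \<cdot> ?s) \<boxtimes> Id V U) =
      lunit V a \<cdot> ?s \<cdot> (lunit V a \<boxtimes> Id V U) \<cdot> (?s \<boxtimes> Id V U)"
    using assms by simp
  also have "\<dots> = lunit V a \<cdot> ?s \<cdot> lunit V (a \<otimes> U) \<cdot> ?A U a U \<cdot> (?s \<boxtimes> Id V U)"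
    using assms by (subst lunit_tens[symmetric]) simp_all
  also have "\<dots> = lunit V a \<cdot> (?s \<cdot> lunit V (a \<otimes> U)) \<cdot> (?A U a U \<cdot> (?s \<boxtimes> Id V U))"
    using assms by simp
  also have "\<dots> = lunit V a \<cdot> (lunit V (U \<otimes> a) \<cdot> (Id V U \<boxtimes> ?s)) \<cdot> (?A U a U \<cdot> (?s \<boxtimes> Id V U))"
    using assms by (subst lunit_natural[where a = "a \<otimes> U"]) simp_all
  also have "\<dots> = (lunit V a \<cdot> lunit V (U \<otimes> a)) \<cdot> ((Id V U \<boxtimes> ?s) \<cdot> (?A U a U \<cdot> (?s \<boxtimes> Id V U)))"
    using assms by simp
  also have "\<dots> = (lunit V a \<cdot> (Id V U \<boxtimes> lunit V a)) \<cdot> (?A U U a \<cdot> (sym V a (U \<otimes> U) \<cdot> ?A a U U))"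
    unfolding hexagon'[OF assms unit_Ob unit_Ob, symmetric]
    using assms by (subst lunit_natural[of "lunit V a" "U \<otimes> a" a]) simp_all
  also have "\<dots> = lunit V a \<cdot> ((Id V U \<boxtimes> lunit V a) \<cdot> ?A U U a) \<cdot> (sym V a (U \<otimes> U) \<cdot> ?A a U U)"
    using assms by simp
  also have "\<dots> = lunit V a \<cdot> ((lunit V U \<boxtimes> Id V a) \<cdot> sym V a (U \<otimes> U)) \<cdot> ?A a U U"
    using assms by (subst triangle) (simp_all add: lunit_runit_unit)
  also have "\<dots> = lunit V a \<cdot> (?s \<cdot> (Id V a \<boxtimes> lunit V U)) \<cdot> ?A a U U"
    using assms by (subst sym_natural[where b = "U \<otimes> U" and a = a]) (simp_all)
  also have "\<dots> = lunit V a \<cdot> ?s \<cdot> ((Id V a \<boxtimes> lunit V U) \<cdot> ?A a U U)"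
    using assms by simp
  also have "\<dots> = (lunit V a \<cdot> ?s) \<cdot> (runit V a \<boxtimes> Id V U)"
    using assms by (subst triangle) (simp_all)
  finally show "(lunit V a \<cdot> ?s) \<cdot> ((lunit V a \<cdot> ?s) \<boxtimes> Id V U) =
     (lunit V a \<cdot> ?s) \<cdot> (runit V a \<boxtimes> Id V U)" .
qed (use assms in simp_all)

section \<open>Moving one tensor factor past another\<close>

definition swap :: "'o \<Rightarrow> 'o \<Rightarrow> 'o \<Rightarrow> 'm" where
  "swap x p q = assoc V p x q \<cdot> ((sym V x p \<boxtimes> Id V q) \<cdot> inv (assoc V x p q))"

lemma swap_ar [simp]:
  assumes "x \<in> Ob V" "p \<in> Ob V" "q \<in> Ob V"
  shows "swap x p q \<in> Ar V" "Dom V (swap x p q) = x \<otimes> p \<otimes> q" "Cod V (swap x p q) = p \<otimes> x \<otimes> q"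
    "iso V (swap x p q)"
  using assms by (simp_all add: swap_def)

lemma assoc_inv_natural:
  assumes "f \<in> Ar V" "g \<in> Ar V" "h \<in> Ar V" "Dom V f = a" "Dom V g = b" "Dom V h = c"
    "Cod V f = a'" "Cod V g = b'" "Cod V h = c'"
  shows "inv (assoc V a' b' c') \<cdot> (f \<boxtimes> (g \<boxtimes> h)) = ((f \<boxtimes> g) \<boxtimes> h) \<cdot> inv (assoc V a b c)"
proof -
  have "(inv (assoc V a' b' c') \<cdot> (f \<boxtimes> (g \<boxtimes> h))) \<cdot> assoc V a b c = (f \<boxtimes> g) \<boxtimes> h"
    using assms assoc_natural[OF assms, symmetric] by auto
  then show ?thesis by (rule iso_move_right) (use assms in auto)
qed

lemma swap_natural:
  assumes "f \<in> Ar V" "g \<in> Ar V" "h \<in> Ar V" "Dom V f = a" "Dom V g = b" "Dom V h = c"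
    "Cod V f = a'" "Cod V g = b'" "Cod V h = c'"
  shows "swap a' b' c' \<cdot> (f \<boxtimes> (g \<boxtimes> h)) = (g \<boxtimes> (f \<boxtimes> h)) \<cdot> swap a b c"
proof -
  have o: "a \<in> Ob V" "b \<in> Ob V" "c \<in> Ob V" "a' \<in> Ob V" "b' \<in> Ob V" "c' \<in> Ob V" using assms by auto
  have "swap a' b' c' \<cdot> (f \<boxtimes> (g \<boxtimes> h)) = assoc V b' a' c' \<cdot> (sym V a' b' \<boxtimes> Id V c') \<cdot>
      (inv (assoc V a' b' c') \<cdot> (f \<boxtimes> (g \<boxtimes> h)))"
    unfolding swap_def using assms o by simp
  also have "\<dots> = assoc V b' a' c' \<cdot> ((sym V a' b' \<cdot> (f \<boxtimes> g)) \<boxtimes> h) \<cdot> inv (assoc V a b c)"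
    unfolding assoc_inv_natural[OF assms] using assms o by simp
  also have "\<dots> = (assoc V b' a' c' \<cdot> ((g \<boxtimes> f) \<boxtimes> h)) \<cdot> (sym V a b \<boxtimes> Id V c) \<cdot> inv (assoc V a b c)"
    using assms o by (subst sym_natural[where a = a and b = b]) simp_all
  also have "\<dots> = (g \<boxtimes> (f \<boxtimes> h)) \<cdot> swap a b c"
    unfolding swap_def using assms o by (subst assoc_natural[where a = b and b = a and c = c]) simp_all
  finally show ?thesis .
qed

text \<open>The pentagon solved for the direction needed below, since \<open>swap\<close> starts
  with an inverted associator.\<close>

lemma pentagon_inv:
  assumes "a \<in> Ob V" "b \<in> Ob V" "c \<in> Ob V" "d \<in> Ob V"
  shows "inv (assoc V (a \<otimes> b) c d) \<cdot> (inv (assoc V a b (c \<otimes> d)) \<cdot> (Id V a \<boxtimes> assoc V b c d)) =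
    (inv (assoc V a b c) \<boxtimes> Id V d) \<cdot> inv (assoc V a (b \<otimes> c) d)"
proof -
  let ?k = "assoc V a (b \<otimes> c) d \<cdot> (assoc V a b c \<boxtimes> Id V d)"
  have "(inv (assoc V (a \<otimes> b) c d) \<cdot> (inv (assoc V a b (c \<otimes> d)) \<cdot> (Id V a \<boxtimes> assoc V b c d))) \<cdot> ?k = Id V (((a \<otimes> b) \<otimes> c) \<otimes> d)"
    using assms pentagon'[OF assms] by simp
  then have "inv (assoc V (a \<otimes> b) c d) \<cdot> (inv (assoc V a b (c \<otimes> d)) \<cdot> (Id V a \<boxtimes> assoc V b c d)) =
     Id V (((a \<otimes> b) \<otimes> c) \<otimes> d) \<cdot> inv ?k"
    by (rule iso_move_right) (use assms in simp_all)
  also have "inv ?k = (inv (assoc V a b c) \<boxtimes> Id V d) \<cdot> inv (assoc V a (b \<otimes> c) d)"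
    by (rule isoI[where a = "((a \<otimes> b) \<otimes> c) \<otimes> d" and b = "a \<otimes> (b \<otimes> c) \<otimes> d"])
      (use assms in \<open>simp_all add: hom_def\<close>)
  finally show ?thesis using assms by simp
qed


lemma inv_Id [simp]: "a \<in> Ob V \<Longrightarrow> inv (Id V a) = Id V a"
  by (rule isoI[of _ a a]) (simp_all add: hom_def)

text \<open>Moving x past p \<otimes> q amounts to moving it past p and then past q. This is the
  hexagon, with pentagons to carry along the spectator r.\<close>

lemma swap_assoc_right:
  assumes [simp]: "x \<in> Ob V" "p \<in> Ob V" "q \<in> Ob V" "r \<in> Ob V"
  shows "assoc V p q (x \<otimes> r) \<cdot> swap x (p \<otimes> q) r =
    (Id V p \<boxtimes> swap x q r) \<cdot> (swap x p (q \<otimes> r) \<cdot> (Id V x \<boxtimes> assoc V p q r))"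
proof -
  let ?A = "assoc V" and ?s = "sym V"
  have hex: "?A p q x \<cdot> ?s x (p \<otimes> q) =
      ((Id V p \<boxtimes> ?s x q) \<cdot> (?A p x q \<cdot> (?s x p \<boxtimes> Id V q))) \<cdot> inv (?A x p q)"
    by (rule iso_move_right) (simp_all add: hexagon')
  have pent: "?A p (x \<otimes> q) r \<cdot> (?A p x q \<boxtimes> Id V r) =
      inv (Id V p \<boxtimes> ?A x q r) \<cdot> (?A p x (q \<otimes> r) \<cdot> ?A (p \<otimes> x) q r)"
    by (rule iso_move_left) (simp_all add: pentagon'[simplified])
  have "?A p q (x \<otimes> r) \<cdot> swap x (p \<otimes> q) r =
      (?A p q (x \<otimes> r) \<cdot> ?A (p \<otimes> q) x r) \<cdot> ((?s x (p \<otimes> q) \<boxtimes> Id V r) \<cdot> inv (?A x (p \<otimes> q) r))"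
    by (simp add: swap_def)
  also have "\<dots> = (Id V p \<boxtimes> ?A q x r) \<cdot> ?A p (q \<otimes> x) r \<cdot>
      ((?A p q x \<cdot> ?s x (p \<otimes> q)) \<boxtimes> Id V r) \<cdot> inv (?A x (p \<otimes> q) r)"
    by (subst pentagon'[symmetric]) simp_all
  also have "\<dots> = (Id V p \<boxtimes> ?A q x r) \<cdot> (?A p (q \<otimes> x) r \<cdot> ((Id V p \<boxtimes> ?s x q) \<boxtimes> Id V r)) \<cdot>
      ((?A p x q \<boxtimes> Id V r) \<cdot> (((?s x p \<boxtimes> Id V q) \<boxtimes> Id V r) \<cdot>
        ((inv (?A x p q) \<boxtimes> Id V r) \<cdot> inv (?A x (p \<otimes> q) r))))"
    unfolding hex by simp
  also have "\<dots> = (Id V p \<boxtimes> ?A q x r) \<cdot> ((Id V p \<boxtimes> (?s x q \<boxtimes> Id V r)) \<cdot> ?A p (x \<otimes> q) r) \<cdot>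
      ((?A p x q \<boxtimes> Id V r) \<cdot> (((?s x p \<boxtimes> Id V q) \<boxtimes> Id V r) \<cdot>
        (inv (?A (x \<otimes> p) q r) \<cdot> (inv (?A x p (q \<otimes> r)) \<cdot> (Id V x \<boxtimes> ?A p q r)))))"
    by (subst pentagon_inv, simp, simp, simp, simp) (subst assoc_natural[where a = p and b = "x \<otimes> q" and c = r], simp_all)
  also have "\<dots> = (Id V p \<boxtimes> (?A q x r \<cdot> (?s x q \<boxtimes> Id V r))) \<cdot> (?A p (x \<otimes> q) r \<cdot>
      (?A p x q \<boxtimes> Id V r)) \<cdot> (((?s x p \<boxtimes> Id V q) \<boxtimes> Id V r) \<cdot>
        inv (?A (x \<otimes> p) q r)) \<cdot> (inv (?A x p (q \<otimes> r)) \<cdot> (Id V x \<boxtimes> ?A p q r))"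
    by simp
  also have "\<dots> = (Id V p \<boxtimes> (?A q x r \<cdot> (?s x q \<boxtimes> Id V r))) \<cdot> (?A p (x \<otimes> q) r \<cdot>
      (?A p x q \<boxtimes> Id V r)) \<cdot> (inv (?A (p \<otimes> x) q r) \<cdot> (?s x p \<boxtimes> (Id V q \<boxtimes> Id V r)))
      \<cdot> (inv (?A x p (q \<otimes> r)) \<cdot> (Id V x \<boxtimes> ?A p q r))"
    by (subst assoc_inv_natural[where a = "x \<otimes> p" and b = q and c = r]) simp_all
  also have "\<dots> = (Id V p \<boxtimes> (?A q x r \<cdot> (?s x q \<boxtimes> Id V r))) \<cdot> (Id V p \<boxtimes> inv (?A x q r)) \<cdot>
      (?A p x (q \<otimes> r) \<cdot> ((?s x p \<boxtimes> Id V (q \<otimes> r)) \<cdot> inv (?A x p (q \<otimes> r)))) \<cdot> (Id V x \<boxtimes> ?A p q r)"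
    unfolding pent by simp
  finally show ?thesis unfolding swap_def by simp
qed

text \<open>Here x stops between p and q, so the pentagon and naturality of the associator settle
  the matter.\<close>

lemma swap_assoc_mid:
  assumes [simp]: "x \<in> Ob V" "p \<in> Ob V" "q \<in> Ob V" "r \<in> Ob V"
  shows "assoc V p (x \<otimes> q) r \<cdot> ((swap x p q \<boxtimes> Id V r) \<cdot> inv (assoc V x (p \<otimes> q) r)) =
    (Id V p \<boxtimes> inv (assoc V x q r)) \<cdot> (swap x p (q \<otimes> r) \<cdot> (Id V x \<boxtimes> assoc V p q r))"
proof -
  let ?A = "assoc V" and ?s = "sym V"
  have pent: "?A p (x \<otimes> q) r \<cdot> (?A p x q \<boxtimes> Id V r) =
      inv (Id V p \<boxtimes> ?A x q r) \<cdot> (?A p x (q \<otimes> r) \<cdot> ?A (p \<otimes> x) q r)"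
    by (rule iso_move_left) (simp_all add: pentagon'[simplified])
  have "?A p (x \<otimes> q) r \<cdot> ((swap x p q \<boxtimes> Id V r) \<cdot> inv (?A x (p \<otimes> q) r)) =
      (?A p (x \<otimes> q) r \<cdot> (?A p x q \<boxtimes> Id V r)) \<cdot> (((?s x p \<boxtimes> Id V q) \<boxtimes> Id V r) \<cdot>
        ((inv (?A x p q) \<boxtimes> Id V r) \<cdot> inv (?A x (p \<otimes> q) r)))"
    unfolding swap_def by simp
  also have "\<dots> = (?A p (x \<otimes> q) r \<cdot> (?A p x q \<boxtimes> Id V r)) \<cdot> (((?s x p \<boxtimes> Id V q) \<boxtimes> Id V r) \<cdot>
        inv (?A (x \<otimes> p) q r)) \<cdot> (inv (?A x p (q \<otimes> r)) \<cdot> (Id V x \<boxtimes> ?A p q r))"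
    by (subst pentagon_inv[symmetric]) simp_all
  also have "\<dots> = (?A p (x \<otimes> q) r \<cdot> (?A p x q \<boxtimes> Id V r)) \<cdot>
      (inv (?A (p \<otimes> x) q r) \<cdot> (?s x p \<boxtimes> (Id V q \<boxtimes> Id V r)))
      \<cdot> (inv (?A x p (q \<otimes> r)) \<cdot> (Id V x \<boxtimes> ?A p q r))"
    by (subst assoc_inv_natural[where a = "x \<otimes> p" and b = q and c = r]) simp_all
  finally show ?thesis unfolding pent swap_def by simp
qed

text \<open>The axiom \<open>hexagon\<close> moves one object past a product. Inverting the
  symmetries gives this form, in which a product moves past one object.\<close>

lemma sym_tens_left:
  assumes [simp]: "x \<in> Ob V" "p \<in> Ob V" "q \<in> Ob V"
  shows "sym V (x \<otimes> p) q \<cdot> inv (assoc V x p q) = swap x q p \<cdot> (Id V x \<boxtimes> sym V p q)"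
proof (rule iso_cancel_right)
  let ?A = "assoc V" and ?s = "sym V"
  let ?k = "?A x p q \<cdot> (?s q (x \<otimes> p) \<cdot> ?A q x p)"
  have "(?s (x \<otimes> p) q \<cdot> inv (?A x p q)) \<cdot> ?k = ?A q x p"
    using inv_cmp2(1)[of "?s q (x \<otimes> p)" "?A q x p"] by simp
  also have "\<dots> = (swap x q p \<cdot> (Id V x \<boxtimes> ?s p q)) \<cdot> ?k"
    unfolding hexagon'[OF assms(3) assms(1,2)] swap_def
    using inv_cmp(1)[of "?s q p"] inv_cmp(1)[of "?s q x"] by simp
  finally show "(?s (x \<otimes> p) q \<cdot> inv (?A x p q)) \<cdot> ?k = (swap x q p \<cdot> (Id V x \<boxtimes> ?s p q)) \<cdot> ?k" .
qed simp_all

text \<open>Induction step for the associativity of context splitting. The arrows \<open>s\<close>,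
  \<open>s'\<close>, \<open>t\<close>, \<open>t'\<close> are the splittings already built, and
  \<open>x\<close> is a new leading variable that belongs to the first of three contexts; in the
  next two lemmas it belongs to the second or the third.\<close>

lemma split_step_left:
  assumes [simp]: "x \<in> Ob V" "p \<in> Ob V" "q \<in> Ob V" "r \<in> Ob V" "s \<in> Ar V" "s' \<in> Ar V" "t \<in> Ar V" "t' \<in> Ar V"
    "Dom V s = u" "Cod V s = p \<otimes> q" "Cod V s' = u \<otimes> r" "Dom V t = v" "Cod V t = q \<otimes> r"
    "Cod V t' = p \<otimes> v" "Dom V t' = Dom V s'"
    and IH: "assoc V p q r \<cdot> ((s \<boxtimes> Id V r) \<cdot> s') = (Id V p \<boxtimes> t) \<cdot> t'"
  shows "assoc V (x \<otimes> p) q r \<cdot>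
      (((inv (assoc V x p q) \<cdot> (Id V x \<boxtimes> s)) \<boxtimes> Id V r) \<cdot> (inv (assoc V x u r) \<cdot> (Id V x \<boxtimes> s'))) =
    (Id V (x \<otimes> p) \<boxtimes> t) \<cdot> (inv (assoc V x p v) \<cdot> (Id V x \<boxtimes> t'))" (is "?l = ?r")
proof -
  have [simp]: "u \<in> Ob V" "v \<in> Ob V" using Ob_ar(1)[of s] Ob_ar(1)[of t] by simp_all
  let ?A = "assoc V"
  have "?l = ?A (x \<otimes> p) q r \<cdot> (inv (?A x p q) \<boxtimes> Id V r) \<cdot>
      (((Id V x \<boxtimes> s) \<boxtimes> Id V r) \<cdot> inv (?A x u r)) \<cdot> (Id V x \<boxtimes> s')"
    by simp
  also have "\<dots> = ?A (x \<otimes> p) q r \<cdot> ((inv (?A x p q) \<boxtimes> Id V r) \<cdot> inv (?A x (p \<otimes> q) r)) \<cdot>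
       (Id V x \<boxtimes> ((s \<boxtimes> Id V r) \<cdot> s'))"
    by (subst assoc_inv_natural[where a' = x and b' = "p \<otimes> q" and c' = r, symmetric]) simp_all
  also have "\<dots> = inv (?A x p (q \<otimes> r)) \<cdot> (Id V x \<boxtimes> (?A p q r \<cdot> ((s \<boxtimes> Id V r) \<cdot> s')))"
    by (subst pentagon_inv[symmetric]) simp_all
  also have "\<dots> = (inv (?A x p (q \<otimes> r)) \<cdot> (Id V x \<boxtimes> (Id V p \<boxtimes> t))) \<cdot> (Id V x \<boxtimes> t')"
    unfolding IH by simp
  also have "\<dots> = ?r"
    by (subst assoc_inv_natural[where a = x and b = p and c = v]) simp_all
  finally show ?thesis .
qed

lemma split_step_mid:
  assumes [simp]: "x \<in> Ob V" "p \<in> Ob V" "q \<in> Ob V" "r \<in> Ob V" "s \<in> Ar V" "s' \<in> Ar V" "t \<in> Ar V" "t' \<in> Ar V"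
    "Dom V s = u" "Cod V s = p \<otimes> q" "Cod V s' = u \<otimes> r" "Dom V t = v" "Cod V t = q \<otimes> r"
    "Cod V t' = p \<otimes> v" "Dom V t' = Dom V s'"
    and IH: "assoc V p q r \<cdot> ((s \<boxtimes> Id V r) \<cdot> s') = (Id V p \<boxtimes> t) \<cdot> t'"
  shows "assoc V p (x \<otimes> q) r \<cdot>
      (((swap x p q \<cdot> (Id V x \<boxtimes> s)) \<boxtimes> Id V r) \<cdot> (inv (assoc V x u r) \<cdot> (Id V x \<boxtimes> s'))) =
    (Id V p \<boxtimes> (inv (assoc V x q r) \<cdot> (Id V x \<boxtimes> t))) \<cdot> (swap x p v \<cdot> (Id V x \<boxtimes> t'))" (is "?l = ?r")
proof -
  have [simp]: "u \<in> Ob V" "v \<in> Ob V" using Ob_ar(1)[of s] Ob_ar(1)[of t] by simp_all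
  let ?A = "assoc V"
  have "?l = ?A p (x \<otimes> q) r \<cdot> (swap x p q \<boxtimes> Id V r) \<cdot>
      (((Id V x \<boxtimes> s) \<boxtimes> Id V r) \<cdot> inv (?A x u r)) \<cdot> (Id V x \<boxtimes> s')"
    by simp
  also have "\<dots> = (?A p (x \<otimes> q) r \<cdot> ((swap x p q \<boxtimes> Id V r) \<cdot> inv (?A x (p \<otimes> q) r))) \<cdot>
       (Id V x \<boxtimes> ((s \<boxtimes> Id V r) \<cdot> s'))"
    by (subst assoc_inv_natural[where a' = x and b' = "p \<otimes> q" and c' = r, symmetric]) simp_all
  also have "\<dots> = (Id V p \<boxtimes> inv (?A x q r)) \<cdot> swap x p (q \<otimes> r) \<cdot>
      (Id V x \<boxtimes> (?A p q r \<cdot> ((s \<boxtimes> Id V r) \<cdot> s')))"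
    by (subst swap_assoc_mid) simp_all
  also have "\<dots> = (Id V p \<boxtimes> inv (?A x q r)) \<cdot> (swap x p (q \<otimes> r) \<cdot> (Id V x \<boxtimes> (Id V p \<boxtimes> t))) \<cdot> (Id V x \<boxtimes> t')"
    unfolding IH by simp
  also have "\<dots> = ?r"
    by (subst swap_natural[where a = x and b = p and c = v]) simp_all
  finally show ?thesis .
qed

lemma split_step_right:
  assumes [simp]: "x \<in> Ob V" "p \<in> Ob V" "q \<in> Ob V" "r \<in> Ob V" "s \<in> Ar V" "s' \<in> Ar V" "t \<in> Ar V" "t' \<in> Ar V"
    "Dom V s = u" "Cod V s = p \<otimes> q" "Cod V s' = u \<otimes> r" "Dom V t = v" "Cod V t = q \<otimes> r"
    "Cod V t' = p \<otimes> v" "Dom V t' = Dom V s'"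
    and IH: "assoc V p q r \<cdot> ((s \<boxtimes> Id V r) \<cdot> s') = (Id V p \<boxtimes> t) \<cdot> t'"
  shows "assoc V p q (x \<otimes> r) \<cdot>
      ((s \<boxtimes> Id V (x \<otimes> r)) \<cdot> (swap x u r \<cdot> (Id V x \<boxtimes> s'))) =
    (Id V p \<boxtimes> (swap x q r \<cdot> (Id V x \<boxtimes> t))) \<cdot> (swap x p v \<cdot> (Id V x \<boxtimes> t'))" (is "?l = ?r")
proof -
  have [simp]: "u \<in> Ob V" "v \<in> Ob V" using Ob_ar(1)[of s] Ob_ar(1)[of t] by simp_all
  let ?A = "assoc V"
  have "?l = ?A p q (x \<otimes> r) \<cdot> ((s \<boxtimes> (Id V x \<boxtimes> Id V r)) \<cdot> swap x u r) \<cdot> (Id V x \<boxtimes> s')"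
    by simp
  also have "\<dots> = (?A p q (x \<otimes> r) \<cdot> swap x (p \<otimes> q) r) \<cdot> (Id V x \<boxtimes> ((s \<boxtimes> Id V r) \<cdot> s'))"
    by (subst swap_natural[where a' = x and b' = "p \<otimes> q" and c' = r, symmetric]) simp_all
  also have "\<dots> = (Id V p \<boxtimes> swap x q r) \<cdot> swap x p (q \<otimes> r) \<cdot>
      (Id V x \<boxtimes> (?A p q r \<cdot> ((s \<boxtimes> Id V r) \<cdot> s')))"
    by (subst swap_assoc_right) simp_all
  also have "\<dots> = (Id V p \<boxtimes> swap x q r) \<cdot> (swap x p (q \<otimes> r) \<cdot> (Id V x \<boxtimes> (Id V p \<boxtimes> t))) \<cdot> (Id V x \<boxtimes> t')"
    unfolding IH by simp
  also have "\<dots> = ?r"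
    by (subst swap_natural[where a = x and b = p and c = v]) simp_all
  finally show ?thesis .
qed


section \<open>Generalized elements\<close>

text \<open>Enriched diagrams are checked on generalized elements that depend on named variables: a context
  maps finitely many variables (numbers) to objects, and is interpreted as the tensor product of these
  objects, the variable with the largest number coming first.  Contexts with disjoint domains can
  be joined in any order, and the associativity and symmetry of \<open>ctx_split\<close> below absorb all
  coherence isomorphisms, so that a term in which each variable occurs once may be manipulated as if
  \<open>V\<close> were the category of sets.\<close>

primrec ctx_tens :: "nat \<Rightarrow> (nat \<rightharpoonup> 'o) \<Rightarrow> 'o" where
  "ctx_tens 0 \<Gamma> = U"
| "ctx_tens (Suc n) \<Gamma> = (case \<Gamma> n of None \<Rightarrow> ctx_tens n \<Gamma> | Some x \<Rightarrow> x \<otimes> ctx_tens n \<Gamma>)"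

text \<open>A variable owned by the first context only needs rebracketing; one owned by the second
  is moved past the rest of the first context by \<open>swap\<close>. Ordering variables by number
  makes the union of disjoint contexts commutative on the nose.\<close>

primrec ctx_split :: "nat \<Rightarrow> (nat \<rightharpoonup> 'o) \<Rightarrow> (nat \<rightharpoonup> 'o) \<Rightarrow> 'm" where
  "ctx_split 0 \<Gamma> \<Delta> = inv (lunit V U)"
| "ctx_split (Suc n) \<Gamma> \<Delta> =
    (case \<Gamma> n of
       Some x \<Rightarrow> inv (assoc V x (ctx_tens n \<Gamma>) (ctx_tens n \<Delta>)) \<cdot> (Id V x \<boxtimes> ctx_split n \<Gamma> \<Delta>)
     | None \<Rightarrow> (case \<Delta> n of
         Some x \<Rightarrow> swap x (ctx_tens n \<Gamma>) (ctx_tens n \<Delta>) \<cdot> (Id V x \<boxtimes> ctx_split n \<Gamma> \<Delta>)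
       | None \<Rightarrow> ctx_split n \<Gamma> \<Delta>))"

lemma ctx_tens_Ob [simp]: "ran \<Gamma> \<subseteq> Ob V \<Longrightarrow> ctx_tens n \<Gamma> \<in> Ob V"
proof (induction n)
  case (Suc n)
  then show ?case by (cases "\<Gamma> n") (auto dest: ranI)
qed simp

lemma ctx_split_ar:
  assumes "ran \<Gamma> \<subseteq> Ob V" "ran \<Delta> \<subseteq> Ob V" "dom \<Gamma> \<inter> dom \<Delta> = {}"
  shows "ctx_split n \<Gamma> \<Delta> \<in> Ar V \<and> Dom V (ctx_split n \<Gamma> \<Delta>) = ctx_tens n (\<Gamma> ++ \<Delta>) \<and>
    Cod V (ctx_split n \<Gamma> \<Delta>) = ctx_tens n \<Gamma> \<otimes> ctx_tens n \<Delta> \<and> iso V (ctx_split n \<Gamma> \<Delta>)"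
proof (induction n)
  case (Suc n)
  have o: "ctx_tens n \<Gamma> \<in> Ob V" "ctx_tens n \<Delta> \<in> Ob V" using assms by auto
  consider (l) x where "\<Gamma> n = Some x" "\<Delta> n = None" "x \<in> Ob V"
    | (r) x where "\<Gamma> n = None" "\<Delta> n = Some x" "x \<in> Ob V" | (n) "\<Gamma> n = None" "\<Delta> n = None"
    using assms by (cases "\<Gamma> n"; cases "\<Delta> n") (auto dest: ranI)
  then show ?case using Suc o by cases (auto simp: map_add_def)
qed (simp add: lunit_runit_unit)

text \<open>Induction on the level n: the variable n lies in at most one of the three contexts, and
  the cases where it lies in one are the \<open>split_step\<close> lemmas. Level 0 is the triangle
  at U, U together with \<open>lunit_runit_unit\<close>.\<close>

lemma ctx_split_assoc:
  assumes "ran \<Gamma> \<subseteq> Ob V" "ran \<Delta> \<subseteq> Ob V" "ran \<Theta> \<subseteq> Ob V"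
    "dom \<Gamma> \<inter> dom \<Delta> = {}" "dom \<Gamma> \<inter> dom \<Theta> = {}" "dom \<Delta> \<inter> dom \<Theta> = {}"
  shows "assoc V (ctx_tens n \<Gamma>) (ctx_tens n \<Delta>) (ctx_tens n \<Theta>) \<cdot>
      ((ctx_split n \<Gamma> \<Delta> \<boxtimes> Id V (ctx_tens n \<Theta>)) \<cdot> ctx_split n (\<Gamma> ++ \<Delta>) \<Theta>) =
    (Id V (ctx_tens n \<Gamma>) \<boxtimes> ctx_split n \<Delta> \<Theta>) \<cdot> ctx_split n \<Gamma> (\<Delta> ++ \<Theta>)"
proof (induction n)
  case 0
  have "assoc V U U U \<cdot> (inv (lunit V U) \<boxtimes> Id V U) = Id V U \<boxtimes> inv (lunit V U)"
  proof (rule iso_cancel_left)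
    show "(Id V U \<boxtimes> lunit V U) \<cdot> (assoc V U U U \<cdot> (inv (lunit V U) \<boxtimes> Id V U)) =
        (Id V U \<boxtimes> lunit V U) \<cdot> (Id V U \<boxtimes> inv (lunit V U))"
      using cmp_extend[OF triangle[of U U], of "inv (lunit V U) \<boxtimes> Id V U"]
      by (simp add: lunit_runit_unit)
  qed simp_all
  then show ?case using cmp_extend[of "assoc V U U U" "inv (lunit V U) \<boxtimes> Id V U" _ "inv (lunit V U)"]
    by simp
next
  case (Suc n)
  have [simp]: "ctx_tens n \<Gamma> \<in> Ob V" "ctx_tens n \<Delta> \<in> Ob V" "ctx_tens n \<Theta> \<in> Ob V" using assms by auto
  have ran: "ran (\<Gamma> ++ \<Delta>) \<subseteq> Ob V" "ran (\<Delta> ++ \<Theta>) \<subseteq> Ob V"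
    using assms by (auto simp: ran_def map_add_def split: option.splits)
  have dom: "dom (\<Gamma> ++ \<Delta>) \<inter> dom \<Theta> = {}" "dom \<Gamma> \<inter> dom (\<Delta> ++ \<Theta>) = {}" using assms by auto
  note ar = ctx_split_ar[of \<Gamma> \<Delta> n] ctx_split_ar[of \<Delta> \<Theta> n] ctx_split_ar[of "\<Gamma> ++ \<Delta>" \<Theta> n]
    ctx_split_ar[of \<Gamma> "\<Delta> ++ \<Theta>" n]
  have [simp]: "ctx_split n \<Gamma> \<Delta> \<in> Ar V" "ctx_split n \<Delta> \<Theta> \<in> Ar V" "ctx_split n (\<Gamma> ++ \<Delta>) \<Theta> \<in> Ar V"
    "ctx_split n \<Gamma> (\<Delta> ++ \<Theta>) \<in> Ar V"
    "Dom V (ctx_split n \<Gamma> \<Delta>) = ctx_tens n (\<Gamma> ++ \<Delta>)"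
    "Dom V (ctx_split n \<Delta> \<Theta>) = ctx_tens n (\<Delta> ++ \<Theta>)"
    "Dom V (ctx_split n (\<Gamma> ++ \<Delta>) \<Theta>) = ctx_tens n (\<Gamma> ++ \<Delta> ++ \<Theta>)"
    "Dom V (ctx_split n \<Gamma> (\<Delta> ++ \<Theta>)) = ctx_tens n (\<Gamma> ++ \<Delta> ++ \<Theta>)"
    "Cod V (ctx_split n \<Gamma> \<Delta>) = ctx_tens n \<Gamma> \<otimes> ctx_tens n \<Delta>"
    "Cod V (ctx_split n \<Delta> \<Theta>) = ctx_tens n \<Delta> \<otimes> ctx_tens n \<Theta>"
    "Cod V (ctx_split n (\<Gamma> ++ \<Delta>) \<Theta>) = ctx_tens n (\<Gamma> ++ \<Delta>) \<otimes> ctx_tens n \<Theta>"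
    "Cod V (ctx_split n \<Gamma> (\<Delta> ++ \<Theta>)) = ctx_tens n \<Gamma> \<otimes> ctx_tens n (\<Delta> ++ \<Theta>)"
    using ar ran dom assms by (simp_all add: map_add_assoc)
  have map_add_at: "(\<Phi> ++ \<Psi>) n = (case \<Psi> n of None \<Rightarrow> \<Phi> n | Some y \<Rightarrow> Some y)" for \<Phi> \<Psi> :: "nat \<rightharpoonup> 'o"
    by (simp add: map_add_def)
  consider (l) x where "\<Gamma> n = Some x" "\<Delta> n = None" "\<Theta> n = None" "x \<in> Ob V"
    | (m) x where "\<Gamma> n = None" "\<Delta> n = Some x" "\<Theta> n = None" "x \<in> Ob V"
    | (r) x where "\<Gamma> n = None" "\<Delta> n = None" "\<Theta> n = Some x" "x \<in> Ob V"
    | (n) "\<Gamma> n = None" "\<Delta> n = None" "\<Theta> n = None"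
    using assms by (cases "\<Gamma> n"; cases "\<Delta> n"; cases "\<Theta> n") (auto dest: ranI)
  then show ?case
  proof cases
    case l
    \<comment> \<open>Associativity and interchange are switched off so that the goal keeps the
      exact shape of the step lemma.\<close>
    with Suc.IH show ?thesis
      by (simp add: map_add_at del: cmp_assoc interchange interchange2) (rule split_step_left, simp_all)
  next
    case m
    with Suc.IH show ?thesis
      by (simp add: map_add_at del: cmp_assoc interchange interchange2) (rule split_step_mid, simp_all)
  next
    case r
    with Suc.IH show ?thesis
      by (simp add: map_add_at del: cmp_assoc interchange interchange2) (rule split_step_right, simp_all)
  next
    case n
    with Suc.IH show ?thesis
      by (simp add: map_add_at del: cmp_assoc interchange interchange2)
  qed
qed

text \<open>A variable in the first context is handled by \<open>sym_tens_left\<close>; one in the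
  second by the same identity read backwards, since the two symmetries are mutually inverse.\<close>

lemma ctx_split_sym:
  assumes "ran \<Gamma> \<subseteq> Ob V" "ran \<Delta> \<subseteq> Ob V" "dom \<Gamma> \<inter> dom \<Delta> = {}"
  shows "sym V (ctx_tens n \<Gamma>) (ctx_tens n \<Delta>) \<cdot> ctx_split n \<Gamma> \<Delta> = ctx_split n \<Delta> \<Gamma>"
proof (induction n)
  case 0
  have "sym V U U \<cdot> inv (lunit V U) = inv (lunit V U)"
  proof (rule iso_cancel_left)
    show "lunit V U \<cdot> (sym V U U \<cdot> inv (lunit V U)) = lunit V U \<cdot> inv (lunit V U)"
      using cmp_extend[OF lunit_sym[of U], of "inv (lunit V U)"] by (simp add: lunit_runit_unit)
  qed simp_all
  then show ?case by simp
next
  case (Suc n)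
  have [simp]: "ctx_tens n \<Gamma> \<in> Ob V" "ctx_tens n \<Delta> \<in> Ob V" using assms by auto
  have [simp]: "ctx_split n \<Gamma> \<Delta> \<in> Ar V" "ctx_split n \<Delta> \<Gamma> \<in> Ar V"
    "Dom V (ctx_split n \<Gamma> \<Delta>) = ctx_tens n (\<Gamma> ++ \<Delta>)"
    "Dom V (ctx_split n \<Delta> \<Gamma>) = ctx_tens n (\<Gamma> ++ \<Delta>)"
    "Cod V (ctx_split n \<Gamma> \<Delta>) = ctx_tens n \<Gamma> \<otimes> ctx_tens n \<Delta>"
    "Cod V (ctx_split n \<Delta> \<Gamma>) = ctx_tens n \<Delta> \<otimes> ctx_tens n \<Gamma>"
    using ctx_split_ar[of \<Gamma> \<Delta> n] ctx_split_ar[of \<Delta> \<Gamma> n] assms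
    by (simp_all add: Int_commute map_add_comm)
  consider (l) x where "\<Gamma> n = Some x" "\<Delta> n = None" "x \<in> Ob V"
    | (r) x where "\<Gamma> n = None" "\<Delta> n = Some x" "x \<in> Ob V" | (n) "\<Gamma> n = None" "\<Delta> n = None"
    using assms by (cases "\<Gamma> n"; cases "\<Delta> n") (auto dest: ranI)
  then show ?case
  proof cases
    case l
    let ?p = "ctx_tens n \<Gamma>" and ?q = "ctx_tens n \<Delta>"
    have "sym V (x \<otimes> ?p) ?q \<cdot> (inv (assoc V x ?p ?q) \<cdot> (Id V x \<boxtimes> ctx_split n \<Gamma> \<Delta>)) =
        swap x ?q ?p \<cdot> (Id V x \<boxtimes> ctx_split n \<Delta> \<Gamma>)"
      using l Suc.IH cmp_extend[OF sym_tens_left[of x ?p ?q], of "Id V x \<boxtimes> ctx_split n \<Gamma> \<Delta>"] by simp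
    with l show ?thesis by simp
  next
    case r
    let ?p = "ctx_tens n \<Gamma>" and ?q = "ctx_tens n \<Delta>"
    have "ctx_split n \<Gamma> \<Delta> = sym V ?q ?p \<cdot> ctx_split n \<Delta> \<Gamma>"
      using iso_move_left[OF Suc.IH] by simp
    then have "sym V (x \<otimes> ?q) ?p \<cdot> (inv (assoc V x ?q ?p) \<cdot> (Id V x \<boxtimes> ctx_split n \<Delta> \<Gamma>)) =
        swap x ?p ?q \<cdot> (Id V x \<boxtimes> ctx_split n \<Gamma> \<Delta>)"
      using r cmp_extend[OF sym_tens_left[of x ?q ?p], of "Id V x \<boxtimes> ctx_split n \<Delta> \<Gamma>"] by simp
    from this[symmetric] r show ?thesis using inv_cmp2(1)[of "sym V (x \<otimes> ?q) ?p"] by simp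
  next
    case n
    with Suc.IH show ?thesis by simp
  qed
qed

text \<open>\<open>runit_tens\<close> carries the unit constraint past the leading variable, which
  reduces the claim to the tail.\<close>

lemma ctx_split_runit:
  assumes "ran \<Gamma> \<subseteq> Ob V"
  shows "runit V (ctx_tens n \<Gamma>) \<cdot> ctx_split n \<Gamma> Map.empty = Id V (ctx_tens n \<Gamma>)"
proof (induction n)
  case 0
  then show ?case by (simp add: lunit_runit_unit)
next
  case (Suc n)
  have e: "ctx_tens k Map.empty = U" for k by (induction k) auto
  let ?p = "ctx_tens n \<Gamma>"
  have [simp]: "?p \<in> Ob V" using assms by auto
  have [simp]: "ctx_split n \<Gamma> Map.empty \<in> Ar V" "Dom V (ctx_split n \<Gamma> Map.empty) = ?p"
    "Cod V (ctx_split n \<Gamma> Map.empty) = ?p \<otimes> U"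
    using ctx_split_ar[of \<Gamma> Map.empty n] assms e by simp_all
  show ?case
  proof (cases "\<Gamma> n")
    case None
    with Suc show ?thesis by simp
  next
    case (Some x)
    then have [simp]: "x \<in> Ob V" using assms by (auto dest: ranI)
    have "runit V (x \<otimes> ?p) \<cdot> (inv (assoc V x ?p U) \<cdot> (Id V x \<boxtimes> ctx_split n \<Gamma> Map.empty)) = Id V (x \<otimes> ?p)"
      using Suc.IH by (simp add: runit_tens)
    then show ?thesis using Some e by simp
  qed
qed

section \<open>Contexts freed from the level of the recursion\<close>

lemma ctx_tens_stable: "dom \<Gamma> \<subseteq> {..<n} \<Longrightarrow> n \<le> k \<Longrightarrow> ctx_tens k \<Gamma> = ctx_tens n \<Gamma>"
proof (induction k)
  case (Suc k)
  show ?case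
  proof (cases "n = Suc k")
    case False
    then have "\<Gamma> k = None" using Suc.prems by auto
    with False Suc show ?thesis by simp
  qed simp
qed simp

lemma ctx_split_stable: "dom \<Gamma> \<union> dom \<Delta> \<subseteq> {..<n} \<Longrightarrow> n \<le> k \<Longrightarrow> ctx_split k \<Gamma> \<Delta> = ctx_split n \<Gamma> \<Delta>"
proof (induction k)
  case (Suc k)
  show ?case
  proof (cases "n = Suc k")
    case False
    then have "\<Gamma> k = None" "\<Delta> k = None" using Suc.prems by auto
    with False Suc show ?thesis by simp
  qed simp
qed simp

text \<open>Beyond this level \<open>ctx_tens\<close> and \<open>ctx_split\<close> no longer change,
  so evaluating there gives a product that depends on the context alone.\<close>

definition bound :: "(nat \<rightharpoonup> 'o) \<Rightarrow> nat" where
  "bound \<Gamma> = (LEAST n. dom \<Gamma> \<subseteq> {..<n})"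

lemma dom_bound: "finite (dom \<Gamma>) \<Longrightarrow> dom \<Gamma> \<subseteq> {..<bound \<Gamma>}"
  unfolding bound_def by (rule LeastI_ex) (auto simp: finite_nat_set_iff_bounded)

lemma bound_le: "dom \<Gamma> \<subseteq> {..<n} \<Longrightarrow> bound \<Gamma> \<le> n"
  unfolding bound_def by (rule Least_le)

definition ten :: "(nat \<rightharpoonup> 'o) \<Rightarrow> 'o" where
  "ten \<Gamma> = ctx_tens (bound \<Gamma>) \<Gamma>"

text \<open>Both contexts have to be split at one common level, hence the bound of their
  union.\<close>

definition spl :: "(nat \<rightharpoonup> 'o) \<Rightarrow> (nat \<rightharpoonup> 'o) \<Rightarrow> 'm" where
  "spl \<Gamma> \<Delta> = ctx_split (bound (\<Gamma> ++ \<Delta>)) \<Gamma> \<Delta>"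

definition ctx :: "(nat \<rightharpoonup> 'o) \<Rightarrow> bool" where
  "ctx \<Gamma> \<longleftrightarrow> finite (dom \<Gamma>) \<and> ran \<Gamma> \<subseteq> Ob V"

lemma ten_eq: "finite (dom \<Gamma>) \<Longrightarrow> dom \<Gamma> \<subseteq> {..<n} \<Longrightarrow> ten \<Gamma> = ctx_tens n \<Gamma>"
  unfolding ten_def using ctx_tens_stable[OF dom_bound] bound_le by metis

lemma spl_eq:
  assumes "finite (dom \<Gamma>)" "finite (dom \<Delta>)" "dom \<Gamma> \<subseteq> {..<n}" "dom \<Delta> \<subseteq> {..<n}"
  shows "spl \<Gamma> \<Delta> = ctx_split n \<Gamma> \<Delta>"
proof -
  have "dom \<Gamma> \<union> dom \<Delta> \<subseteq> {..<bound (\<Gamma> ++ \<Delta>)}"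
    using dom_bound[of "\<Gamma> ++ \<Delta>"] assms by (simp add: Un_commute)
  moreover have "bound (\<Gamma> ++ \<Delta>) \<le> n" using assms by (intro bound_le) auto
  ultimately show ?thesis unfolding spl_def using ctx_split_stable by metis
qed

lemma ctx_add [simp]: "ctx \<Gamma> \<Longrightarrow> ctx \<Delta> \<Longrightarrow> ctx (\<Gamma> ++ \<Delta>)"
  by (simp add: ctx_def) (auto simp: ran_def map_add_def split: option.splits)

lemma ctx_empty [simp]: "ctx Map.empty"
  by (auto simp: ctx_def)

lemma ten_Ob [simp]: "ctx \<Gamma> \<Longrightarrow> ten \<Gamma> \<in> Ob V"
  by (auto simp: ctx_def ten_def)

lemma ten_empty [simp]: "ten Map.empty = U"
  using ten_eq[of Map.empty 0] by simp

lemma spl_ar [simp]: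
  assumes "ctx \<Gamma>" "ctx \<Delta>" "dom \<Gamma> \<inter> dom \<Delta> = {}"
  shows "spl \<Gamma> \<Delta> \<in> Ar V" "Dom V (spl \<Gamma> \<Delta>) = ten (\<Gamma> ++ \<Delta>)" "Cod V (spl \<Gamma> \<Delta>) = ten \<Gamma> \<otimes> ten \<Delta>"
    "iso V (spl \<Gamma> \<Delta>)"
proof -
  have f: "finite (dom \<Gamma>)" "finite (dom \<Delta>)" "finite (dom (\<Gamma> ++ \<Delta>))" and r: "ran \<Gamma> \<subseteq> Ob V" "ran \<Delta> \<subseteq> Ob V"
    using assms by (auto simp: ctx_def)
  let ?n = "bound (\<Gamma> ++ \<Delta>)"
  have b: "dom (\<Gamma> ++ \<Delta>) \<subseteq> {..<?n}" "dom \<Gamma> \<subseteq> {..<?n}" "dom \<Delta> \<subseteq> {..<?n}"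
    using dom_bound[OF f(3)] by auto
  show "spl \<Gamma> \<Delta> \<in> Ar V" "Dom V (spl \<Gamma> \<Delta>) = ten (\<Gamma> ++ \<Delta>)" "Cod V (spl \<Gamma> \<Delta>) = ten \<Gamma> \<otimes> ten \<Delta>"
    "iso V (spl \<Gamma> \<Delta>)"
    using ctx_split_ar[OF r assms(3), of ?n] ten_eq[OF f(1) b(2)] ten_eq[OF f(2) b(3)]
      ten_eq[OF f(3) b(1)] spl_eq[OF f(1,2) b(2,3)] by simp_all
qed

lemma spl_assoc:
  assumes "ctx \<Gamma>" "ctx \<Delta>" "ctx \<Theta>"
    "dom \<Gamma> \<inter> dom \<Delta> = {}" "dom \<Gamma> \<inter> dom \<Theta> = {}" "dom \<Delta> \<inter> dom \<Theta> = {}"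
  shows "assoc V (ten \<Gamma>) (ten \<Delta>) (ten \<Theta>) \<cdot> ((spl \<Gamma> \<Delta> \<boxtimes> Id V (ten \<Theta>)) \<cdot> spl (\<Gamma> ++ \<Delta>) \<Theta>) =
    (Id V (ten \<Gamma>) \<boxtimes> spl \<Delta> \<Theta>) \<cdot> spl \<Gamma> (\<Delta> ++ \<Theta>)"
proof -
  have f: "finite (dom \<Gamma>)" "finite (dom \<Delta>)" "finite (dom \<Theta>)" "finite (dom (\<Gamma> ++ \<Delta>))"
    "finite (dom (\<Delta> ++ \<Theta>))" "finite (dom (\<Gamma> ++ \<Delta> ++ \<Theta>))"
    and r: "ran \<Gamma> \<subseteq> Ob V" "ran \<Delta> \<subseteq> Ob V" "ran \<Theta> \<subseteq> Ob V"
    using assms by (auto simp: ctx_def)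
  let ?n = "bound (\<Gamma> ++ \<Delta> ++ \<Theta>)"
  have b: "dom (\<Gamma> ++ \<Delta>) \<subseteq> {..<?n}" "dom (\<Delta> ++ \<Theta>) \<subseteq> {..<?n}" "dom \<Gamma> \<subseteq> {..<?n}" "dom \<Delta> \<subseteq> {..<?n}"
     "dom \<Theta> \<subseteq> {..<?n}"
    using dom_bound[OF f(6)] by auto
  show ?thesis
    unfolding ten_eq[OF f(1) b(3)] ten_eq[OF f(2) b(4)] ten_eq[OF f(3) b(5)]
      spl_eq[OF f(1,2) b(3,4)] spl_eq[OF f(2,3) b(4,5)] spl_eq[OF f(1,5) b(3,2)] spl_eq[OF f(4,3) b(1,5)]
    by (rule ctx_split_assoc[OF r assms(4-)])
qed

lemma spl_sym:
  assumes "ctx \<Gamma>" "ctx \<Delta>" "dom \<Gamma> \<inter> dom \<Delta> = {}"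
  shows "sym V (ten \<Gamma>) (ten \<Delta>) \<cdot> spl \<Gamma> \<Delta> = spl \<Delta> \<Gamma>"
proof -
  have f: "finite (dom \<Gamma>)" "finite (dom \<Delta>)" "finite (dom (\<Gamma> ++ \<Delta>))" and r: "ran \<Gamma> \<subseteq> Ob V" "ran \<Delta> \<subseteq> Ob V"
    using assms by (auto simp: ctx_def)
  let ?n = "bound (\<Gamma> ++ \<Delta>)"
  have b: "dom \<Gamma> \<subseteq> {..<?n}" "dom \<Delta> \<subseteq> {..<?n}"
    using dom_bound[OF f(3)] by auto
  show ?thesis
    unfolding ten_eq[OF f(1) b(1)] ten_eq[OF f(2) b(2)] spl_eq[OF f(1,2) b] spl_eq[OF f(2,1) b(2,1)]
    by (rule ctx_split_sym[OF r assms(3)])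
qed

lemma spl_runit:
  assumes "ctx \<Gamma>"
  shows "runit V (ten \<Gamma>) \<cdot> spl \<Gamma> Map.empty = Id V (ten \<Gamma>)"
proof -
  have f: "finite (dom \<Gamma>)" "finite (dom (Map.empty::nat \<rightharpoonup> 'o))" and r: "ran \<Gamma> \<subseteq> Ob V"
    using assms by (auto simp: ctx_def)
  show ?thesis
    unfolding ten_eq[OF f(1) dom_bound[OF f(1)]] spl_eq[OF f dom_bound[OF f(1)], simplified]
    by (rule ctx_split_runit[OF r])
qed


section \<open>Elements in context\<close>

definition El :: "'o \<Rightarrow> ('o, 'm) elt set" where
  "El X = {e. ctx (fst e) \<and> snd e \<in> hom V (ten (fst e)) X}"

definition act :: "'m \<Rightarrow> ('o, 'm) elt \<Rightarrow> ('o, 'm) elt" where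
  "act f e = (fst e, f \<cdot> snd e)"

text \<open>Pairing is meaningful only for elements with disjoint contexts. This is the linearity
  discipline of a monoidal category: no variable can be duplicated.\<close>

definition pr :: "('o, 'm) elt \<Rightarrow> ('o, 'm) elt \<Rightarrow> ('o, 'm) elt" where
  "pr d e = (fst d ++ fst e, (snd d \<boxtimes> snd e) \<cdot> spl (fst d) (fst e))"

definition star :: "('o, 'm) elt" where
  "star = (Map.empty, Id V U)"

text \<open>\<open>ctx_tens\<close> always ends in the unit, so a single variable is interpreted as
  X \<otimes> U; \<open>runit\<close> is the canonical isomorphism from there to X.\<close>

definition var :: "nat \<Rightarrow> 'o \<Rightarrow> ('o, 'm) elt" where
  "var n X = ([n \<mapsto> X], runit V X)"

definition disj :: "('o, 'm) elt \<Rightarrow> ('o, 'm) elt \<Rightarrow> bool" where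
  "disj d e \<longleftrightarrow> dom (fst d) \<inter> dom (fst e) = {}"

lemma ElD:
  assumes "e \<in> El X"
  shows "ctx (fst e)" "snd e \<in> Ar V" "Dom V (snd e) = ten (fst e)" "Cod V (snd e) = X" "X \<in> Ob V"
  using assms by (auto simp: El_def hom_def)

lemma El_Ob: "e \<in> El X \<Longrightarrow> X \<in> Ob V"
  by (rule ElD)

lemma act_El [simp]:
  assumes "f \<in> Ar V" "Cod V f = Y" "e \<in> El (Dom V f)"
  shows "act f e \<in> El Y"
  using ElD[OF assms(3)] assms(1,2) by (simp add: El_def act_def hom_def)

lemma pr_El [simp]:
  assumes "d \<in> El X" "e \<in> El Y" "disj d e"
  shows "pr d e \<in> El (X \<otimes> Y)"
  using ElD[OF assms(1)] ElD[OF assms(2)] assms(3) by (simp add: El_def pr_def hom_def disj_def)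

lemma star_El [simp]: "star \<in> El U"
  by (simp add: El_def star_def hom_def)

lemma disj_simps [simp]:
  "disj (act f d) e = disj d e" "disj d (act f e) = disj d e"
  "disj (pr d d') e \<longleftrightarrow> disj d e \<and> disj d' e" "disj e (pr d d') \<longleftrightarrow> disj e d \<and> disj e d'"
  "disj star e" "disj e star"
  by (auto simp: disj_def act_def pr_def star_def)

text \<open>As a simp rule this would loop. Many rules below therefore assume or provide
  disjointness in both orders.\<close>

lemma disj_sym: "disj d e \<Longrightarrow> disj e d"
  by (auto simp: disj_def)

lemma fst_simps [simp]:
  "fst (act f d) = fst d" "fst (pr d e) = fst d ++ fst e" "fst star = Map.empty"
  by (simp_all add: act_def pr_def star_def)

lemma ctx_single: "X \<in> Ob V \<Longrightarrow> ctx [n \<mapsto> X]"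
  by (auto simp: ctx_def)

lemma ten_single: "ten [n \<mapsto> X] = X \<otimes> U"
proof -
  have e: "k \<le> n \<Longrightarrow> ctx_tens k [n \<mapsto> X] = U" for k by (induction k) auto
  have "ten [n \<mapsto> X] = ctx_tens (Suc n) [n \<mapsto> X]" by (rule ten_eq) auto
  then show ?thesis using e[of n] by simp
qed

lemma var_El [simp]: "X \<in> Ob V \<Longrightarrow> var n X \<in> El X"
  by (simp add: El_def var_def ctx_single hom_def ten_single del: fun_upd_apply)

lemma disj_var [simp]: "disj (var m X) (var n Y) \<longleftrightarrow> m \<noteq> n"
  by (auto simp: disj_def var_def)

text \<open>Plays the part of a tuple of distinct variables: an arrow is recovered from its value on
  such an element by cancelling the isomorphism, as in \<open>act_cancel\<close>.\<close>

definition generic :: "('o, 'm) elt \<Rightarrow> bool" where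
  "generic e \<longleftrightarrow> (\<exists>X. e \<in> El X) \<and> iso V (snd e)"

lemma generic_var [simp]: "X \<in> Ob V \<Longrightarrow> generic (var n X)"
  unfolding generic_def by (rule conjI, rule exI, erule var_El) (simp add: var_def)

lemma generic_star [simp]: "generic star"
  unfolding generic_def by (rule conjI, rule exI, rule star_El) (simp add: star_def)

lemma generic_pr [simp]:
  assumes "generic d" "generic e" "disj d e"
  shows "generic (pr d e)"
proof -
  obtain X Y where *: "d \<in> El X" "e \<in> El Y" using assms by (auto simp: generic_def)
  have "iso V (snd (pr d e))"
    using ElD[OF *(1)] ElD[OF *(2)] assms by (simp add: pr_def disj_def generic_def)
  with pr_El[OF * assms(3)] show ?thesis by (auto simp: generic_def)
qed

lemma act_Id [simp]: "e \<in> El X \<Longrightarrow> act (Id V X) e = e"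
  using ElD[of e X] by (simp add: act_def prod_eq_iff)

lemma act_cmp [simp]:
  assumes "f \<in> Ar V" "g \<in> Ar V" "Dom V g = Cod V f" "e \<in> El (Dom V f)"
  shows "act (g \<cdot> f) e = act g (act f e)"
  using ElD[OF assms(4)] assms(1-3) by (simp add: act_def)

lemma act_tens [simp]:
  assumes "f \<in> Ar V" "g \<in> Ar V" "d \<in> El (Dom V f)" "e \<in> El (Dom V g)" "disj d e"
  shows "act (f \<boxtimes> g) (pr d e) = pr (act f d) (act g e)"
  using ElD[OF assms(3)] ElD[OF assms(4)] assms by (simp add: act_def pr_def disj_def)

text \<open>Here coherence disappears: naturality moves the associator onto the contexts, where
  \<open>spl_assoc\<close> absorbs it. On elements an associator then merely rebrackets
  pairs.\<close>

lemma act_assoc [simp]: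
  assumes "d \<in> El X" "e \<in> El Y" "h \<in> El Z" "disj d e" "disj d h" "disj e h"
  shows "act (assoc V X Y Z) (pr (pr d e) h) = pr d (pr e h)"
proof -
  note D = ElD[OF assms(1)] and E = ElD[OF assms(2)] and H = ElD[OF assms(3)]
  note [simp] = D E H
  let ?d = "fst d" and ?e = "fst e" and ?h = "fst h"
  have dj [simp]: "dom ?d \<inter> dom ?e = {}" "dom ?d \<inter> dom ?h = {}" "dom ?e \<inter> dom ?h = {}"
    "dom ?d \<inter> (dom ?h \<union> dom ?e) = {}" "(dom ?e \<union> dom ?d) \<inter> dom ?h = {}"
    using assms by (auto simp: disj_def)
  have "assoc V X Y Z \<cdot> (((((snd d \<boxtimes> snd e) \<cdot> spl ?d ?e) \<boxtimes> snd h)) \<cdot> spl (?d ++ ?e) ?h) =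
      (assoc V X Y Z \<cdot> ((snd d \<boxtimes> snd e) \<boxtimes> snd h)) \<cdot> ((spl ?d ?e \<boxtimes> Id V (ten ?h)) \<cdot> spl (?d ++ ?e) ?h)"
    by simp
  also have "\<dots> = (snd d \<boxtimes> (snd e \<boxtimes> snd h)) \<cdot>
      (assoc V (ten ?d) (ten ?e) (ten ?h) \<cdot> ((spl ?d ?e \<boxtimes> Id V (ten ?h)) \<cdot> spl (?d ++ ?e) ?h))"
    by (subst assoc_natural[where a = "ten ?d" and b = "ten ?e" and c = "ten ?h"]) simp_all
  also have "\<dots> = (snd d \<boxtimes> (snd e \<boxtimes> snd h)) \<cdot> ((Id V (ten ?d) \<boxtimes> spl ?e ?h) \<cdot> spl ?d (?e ++ ?h))"
    by (subst spl_assoc) simp_all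
  finally show ?thesis by (simp add: act_def pr_def map_add_assoc)
qed

lemma act_sym [simp]:
  assumes "d \<in> El X" "e \<in> El Y" "disj d e"
  shows "act (sym V X Y) (pr d e) = pr e d"
proof -
  note [simp] = ElD[OF assms(1)] ElD[OF assms(2)]
  let ?d = "fst d" and ?e = "fst e"
  have [simp]: "dom ?d \<inter> dom ?e = {}" "dom ?e \<inter> dom ?d = {}" and c: "?d ++ ?e = ?e ++ ?d"
    using assms by (auto simp: disj_def intro: map_add_comm)
  have "sym V X Y \<cdot> ((snd d \<boxtimes> snd e) \<cdot> spl ?d ?e) = (sym V X Y \<cdot> (snd d \<boxtimes> snd e)) \<cdot> spl ?d ?e"
    by simp
  also have "\<dots> = (snd e \<boxtimes> snd d) \<cdot> (sym V (ten ?d) (ten ?e) \<cdot> spl ?d ?e)"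
    by (subst sym_natural[where a = "ten ?d" and b = "ten ?e"]) simp_all
  also have "\<dots> = (snd e \<boxtimes> snd d) \<cdot> spl ?e ?d"
    by (subst spl_sym) simp_all
  finally show ?thesis using c by (simp add: act_def pr_def)
qed

lemma act_runit [simp]:
  assumes "d \<in> El X"
  shows "act (runit V X) (pr d star) = d"
proof -
  note [simp] = ElD[OF assms(1)]
  let ?d = "fst d"
  have s: "spl ?d Map.empty \<in> Ar V" "Cod V (spl ?d Map.empty) = ten ?d \<otimes> U"
    using spl_ar[of ?d Map.empty] by simp_all
  have "runit V X \<cdot> ((snd d \<boxtimes> Id V U) \<cdot> spl ?d Map.empty) =
      (runit V X \<cdot> (snd d \<boxtimes> Id V U)) \<cdot> spl ?d Map.empty"
    using s by simp
  also have "\<dots> = snd d \<cdot> (runit V (ten ?d) \<cdot> spl ?d Map.empty)"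
    using s by (subst runit_natural[where a = "ten ?d"]) simp_all
  also have "\<dots> = snd d"
    by (subst spl_runit) simp_all
  finally show ?thesis by (simp add: act_def pr_def star_def prod_eq_iff)
qed

lemma act_lunit [simp]:
  assumes "d \<in> El X"
  shows "act (lunit V X) (pr star d) = d"
proof -
  note [simp] = El_Ob[OF assms] assms
  have "act (lunit V X) (pr star d) = act (lunit V X \<cdot> sym V X U) (pr d star)"
    by simp
  also have "\<dots> = d" unfolding lunit_sym[OF El_Ob[OF assms]] by simp
  finally show ?thesis .
qed

lemma act_inv [simp]:
  assumes "iso V f"
  shows "e \<in> El (Dom V f) \<Longrightarrow> act (inv f) (act f e) = e"
    and "e \<in> El (Cod V f) \<Longrightarrow> act f (act (inv f) e) = e"
  using assms ElD[of e "Dom V f"] ElD[of e "Cod V f"] by (simp_all add: act_def iso_Ar)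

lemma act_assoc_inv [simp]:
  assumes "d \<in> El X" "e \<in> El Y" "h \<in> El Z" "disj d e" "disj d h" "disj e h"
  shows "act (inv (assoc V X Y Z)) (pr d (pr e h)) = pr (pr d e) h"
  using act_inv(1)[of "assoc V X Y Z" "pr (pr d e) h"] act_assoc[OF assms] assms
    El_Ob[OF assms(1)] El_Ob[OF assms(2)] El_Ob[OF assms(3)] by simp

lemma act_unit_inv [simp]:
  assumes "d \<in> El X"
  shows "act (inv (lunit V X)) d = pr star d" "act (inv (runit V X)) d = pr d star"
  using act_inv(1)[of "lunit V X" "pr star d"] act_inv(1)[of "runit V X" "pr d star"] assms
    El_Ob[OF assms(1)] by simp_all

section \<open>Testing arrows on elements\<close>

lemma act_cancel:
  assumes "act f e = act g e" "f \<in> hom V X Y" "g \<in> hom V X Y" "e \<in> El X" "generic e"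
  shows "f = g"
  by (rule iso_cancel_right[of _ "snd e"])
    (use assms ElD[OF assms(4)] in \<open>auto simp: act_def hom_def prod_eq_iff generic_def\<close>)

lemma arrow_ext:
  assumes "f \<in> hom V X Y" "g \<in> hom V X Y" "\<And>e. e \<in> El X \<Longrightarrow> act f e = act g e"
  shows "f = g"
  using act_cancel[OF assms(3) assms(1,2), of "var 0 X"] hom_Ob[OF assms(1)] by simp

lemma arrow_ext_unit:
  assumes "f \<in> hom V U Y" "g \<in> hom V U Y" "act f star = act g star"
  shows "f = g"
  using act_cancel[OF assms(3) assms(1,2)] by simp

text \<open>An element of a tensor product need not be a pair, but two distinct variables form a
  generic pair, so testing on pairs suffices.\<close>

lemma arrow_ext2:
  assumes "f \<in> hom V (X \<otimes> Y) Z" "g \<in> hom V (X \<otimes> Y) Z" "X \<in> Ob V" "Y \<in> Ob V"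
    "\<And>d e. d \<in> El X \<Longrightarrow> e \<in> El Y \<Longrightarrow> disj d e \<Longrightarrow> disj e d \<Longrightarrow> act f (pr d e) = act g (pr d e)"
  shows "f = g"
  by (rule act_cancel[OF assms(5)[of "var 0 X" "var 1 Y"] assms(1,2)]) (use assms(3,4) in simp_all)

text \<open>A unit factor is tested on \<open>star\<close> rather than on a variable, so that the
  rules about \<open>star\<close> can fire.\<close>

lemma arrow_ext_lunit:
  assumes "f \<in> hom V (U \<otimes> Y) Z" "g \<in> hom V (U \<otimes> Y) Z" "Y \<in> Ob V"
    "\<And>e. e \<in> El Y \<Longrightarrow> act f (pr star e) = act g (pr star e)"
  shows "f = g"
  by (rule act_cancel[OF assms(4)[of "var 1 Y"] assms(1,2)]) (use assms(3) in simp_all)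

lemma arrow_ext_runit:
  assumes "f \<in> hom V (Y \<otimes> U) Z" "g \<in> hom V (Y \<otimes> U) Z" "Y \<in> Ob V"
    "\<And>e. e \<in> El Y \<Longrightarrow> act f (pr e star) = act g (pr e star)"
  shows "f = g"
  by (rule act_cancel[OF assms(4)[of "var 1 Y"] assms(1,2)]) (use assms(3) in simp_all)

lemma arrow_ext3:
  assumes "f \<in> hom V ((W \<otimes> X) \<otimes> Y) Z" "g \<in> hom V ((W \<otimes> X) \<otimes> Y) Z" "W \<in> Ob V" "X \<in> Ob V" "Y \<in> Ob V"
    "\<And>c d e. c \<in> El W \<Longrightarrow> d \<in> El X \<Longrightarrow> e \<in> El Y \<Longrightarrow> disj c d \<Longrightarrow> disj d c \<Longrightarrow> disj c e \<Longrightarrow> disj e c \<Longrightarrow>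
      disj d e \<Longrightarrow> disj e d \<Longrightarrow> act f (pr (pr c d) e) = act g (pr (pr c d) e)"
  shows "f = g"
  by (rule act_cancel[OF assms(6)[of "var 0 W" "var 1 X" "var 2 Y"] assms(1,2)]) (use assms(3-5) in simp_all)

subsection \<open>Evaluation and transposition\<close>

abbreviation ap :: "'o \<Rightarrow> 'o \<Rightarrow> ('o, 'm) elt \<Rightarrow> ('o, 'm) elt \<Rightarrow> ('o, 'm) elt" where
  "ap y z g e \<equiv> act (ev V y z) (pr g e)"

lemma curry_ar_spec:
  assumes "f \<in> Ar V" "Dom V f = x \<otimes> y" "Cod V f = z" "x \<in> Ob V" "y \<in> Ob V"
  shows "curry_ar V x y z f \<in> hom V x (ihom V y z) \<and> ev V y z \<cdot> (curry_ar V x y z f \<boxtimes> Id V y) = f"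
  unfolding curry_ar_def by (rule theI', rule closed) (use assms in \<open>auto simp: hom_def\<close>)

lemma curry_ar_ar [simp]:
  assumes "f \<in> Ar V" "Dom V f = x \<otimes> y" "Cod V f = z" "x \<in> Ob V" "y \<in> Ob V"
  shows "curry_ar V x y z f \<in> Ar V" "Dom V (curry_ar V x y z f) = x" "Cod V (curry_ar V x y z f) = ihom V y z"
  using curry_ar_spec[OF assms] by (auto simp: hom_def)

lemma ap_curry [simp]:
  assumes "f \<in> Ar V" "Dom V f = x \<otimes> y" "Cod V f = z" "d \<in> El x" "e \<in> El y" "disj d e"
  shows "ap y z (act (curry_ar V x y z f) d) e = act f (pr d e)"
proof -
  note [simp] = El_Ob[OF assms(4)] El_Ob[OF assms(5)] assms
  have [simp]: "z \<in> Ob V" using Ob_ar(2)[OF assms(1)] assms(3) by simp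
  have "act (ev V y z \<cdot> (curry_ar V x y z f \<boxtimes> Id V y)) (pr d e) = act f (pr d e)"
    using curry_ar_spec[OF assms(1-3)] by simp
  then show ?thesis by simp
qed

text \<open>Function extensionality: a single variable that is fresh for both sides is enough, after
  which uniqueness of transposes applies. Equality of elements includes equality of their contexts,
  so these are compared first.\<close>

lemma ap_ext:
  assumes "d \<in> El (ihom V y z)" "e \<in> El (ihom V y z)" "y \<in> Ob V" "z \<in> Ob V"
    "\<And>u. u \<in> El y \<Longrightarrow> disj d u \<Longrightarrow> disj u d \<Longrightarrow> disj e u \<Longrightarrow> disj u e \<Longrightarrow> ap y z d u = ap y z e u"
  shows "d = e"
proof -
  note D = ElD[OF assms(1)] and E = ElD[OF assms(2)]
  note [simp] = D E assms(3,4)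
  have "finite (dom (fst d) \<union> dom (fst e))" using D(1) E(1) by (auto simp: ctx_def)
  then obtain n where n: "n \<notin> dom (fst d)" "n \<notin> dom (fst e)"
    using ex_new_if_finite[OF infinite_UNIV_nat] by blast
  let ?u = "var n y"
  have dj: "disj d ?u" "disj ?u d" "disj e ?u" "disj ?u e" using n by (auto simp: disj_def var_def)
  have dj': "dom (fst d) \<inter> dom (fst ?u) = {}" "dom (fst e) \<inter> dom (fst ?u) = {}" "ctx (fst ?u)"
    using dj ElD(1)[OF var_El] by (auto simp: disj_def)
  have eq: "ap y z d ?u = ap y z e ?u" by (rule assms(5)) (use dj in simp_all)
  have "fst d ++ [n \<mapsto> y] = fst e ++ [n \<mapsto> y]"
    using arg_cong[OF eq, of fst] by (simp add: var_def)
  \<comment> \<open>Freshness of \<open>n\<close> allows its binding to be removed from both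
    contexts.\<close>
  then have "fst d k = fst e k" for k using n by (cases "k = n") (auto dest: fun_cong[of _ _ k] simp: fun_upd_def map_add_def domIff split: if_splits)
  then have f: "fst d = fst e" by blast
  have i [simp]: "iso V (snd ?u)" by (simp add: var_def)
  have r: "snd ?u \<in> Ar V" "Dom V (snd ?u) = ten (fst ?u)" "Cod V (snd ?u) = y" using ElD[OF var_El] by simp_all
  \<comment> \<open>The splitting and then the variable itself are invertible; cancelling them
    leaves two arrows with the same transpose.\<close>
  have "(ev V y z \<cdot> (snd d \<boxtimes> snd ?u)) \<cdot> spl (fst d) (fst ?u) = (ev V y z \<cdot> (snd e \<boxtimes> snd ?u)) \<cdot> spl (fst d) (fst ?u)"
    using arg_cong[OF eq, of snd] dj' r f by (simp add: act_def pr_def)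
  then have "ev V y z \<cdot> (snd d \<boxtimes> snd ?u) = ev V y z \<cdot> (snd e \<boxtimes> snd ?u)"
    by (rule iso_cancel_right) (use dj' r f in simp_all)
  then have "(ev V y z \<cdot> (snd d \<boxtimes> Id V y)) \<cdot> (Id V (ten (fst d)) \<boxtimes> snd ?u) =
      (ev V y z \<cdot> (snd e \<boxtimes> Id V y)) \<cdot> (Id V (ten (fst d)) \<boxtimes> snd ?u)"
    using r f by simp
  then have "ev V y z \<cdot> (snd d \<boxtimes> Id V y) = ev V y z \<cdot> (snd e \<boxtimes> Id V y)"
    by (rule iso_cancel_right) (use r f in simp_all)
  moreover have "\<exists>!g. g \<in> hom V (ten (fst d)) (ihom V y z) \<and> ev V y z \<cdot> (g \<boxtimes> Id V y) = ev V y z \<cdot> (snd e \<boxtimes> Id V y)"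
    by (rule closed) (use f in \<open>simp_all add: hom_def\<close>)
  moreover have "snd d \<in> hom V (ten (fst d)) (ihom V y z)" "snd e \<in> hom V (ten (fst d)) (ihom V y z)"
    using f by (simp_all add: hom_def)
  ultimately have "snd d = snd e" by blast
  with f show ?thesis by (simp add: prod_eq_iff)
qed

lemma arrow_ext_ap:
  assumes "f \<in> hom V x (ihom V y z)" "g \<in> hom V x (ihom V y z)" "y \<in> Ob V" "z \<in> Ob V"
    "\<And>d e. d \<in> El x \<Longrightarrow> e \<in> El y \<Longrightarrow> disj d e \<Longrightarrow> disj e d \<Longrightarrow> ap y z (act f d) e = ap y z (act g d) e"
  shows "f = g"
proof (rule arrow_ext[OF assms(1,2)], rule ap_ext)
  show "act f e \<in> El (ihom V y z)" "act g e \<in> El (ihom V y z)" if "e \<in> El x" for e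
    using that assms by (auto simp: hom_def)
qed (use assms in auto)

lemma unname_ar [simp]:
  assumes "f \<in> Ar V" "Dom V f = U" "Cod V f = ihom V y z" "y \<in> Ob V" "z \<in> Ob V"
  shows "unname V y z f \<in> Ar V" "Dom V (unname V y z f) = y" "Cod V (unname V y z f) = z"
  unfolding unname_def using assms by simp_all

lemma act_unname [simp]:
  assumes "f \<in> Ar V" "Dom V f = U" "Cod V f = ihom V y z" "z \<in> Ob V" "e \<in> El y"
  shows "act (unname V y z f) e = ap y z (act f star) e"
  unfolding unname_def using assms El_Ob[OF assms(5)] by simp

text \<open>The passage opposite to \<open>unname\<close>. It turns ordinary arrows of
  \<open>V\<close> into arrows out of \<open>U\<close>, the form that \<open>vnat\<close> asks
  for.\<close>

definition name :: "'o \<Rightarrow> 'o \<Rightarrow> 'm \<Rightarrow> 'm" where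
  "name y z f = curry_ar V U y z (f \<cdot> lunit V y)"

lemma name_ar [simp]:
  assumes "f \<in> Ar V" "Dom V f = y" "Cod V f = z"
  shows "name y z f \<in> Ar V" "Dom V (name y z f) = U" "Cod V (name y z f) = ihom V y z"
  unfolding name_def using assms Ob_ar[OF assms(1)] by simp_all

lemma ap_name [simp]:
  assumes "f \<in> Ar V" "Cod V f = z" "Dom V f = y" "e \<in> El y"
  shows "ap y z (act (name y z f) star) e = act f e"
  unfolding name_def using assms El_Ob[OF assms(4)] by simp

lemma iso_elementsI:
  assumes "f \<in> hom V X Y" "g \<in> hom V Y X" "\<And>e. e \<in> El X \<Longrightarrow> act g (act f e) = e"
    "\<And>e. e \<in> El Y \<Longrightarrow> act f (act g e) = e"
  shows "iso V f" "inv f = g"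
proof -
  have [simp]: "f \<in> Ar V" "g \<in> Ar V" "Dom V f = X" "Cod V f = Y" "Dom V g = Y" "Cod V g = X"
      "X \<in> Ob V" "Y \<in> Ob V"
    using assms(1,2) hom_Ob[OF assms(1)] by (simp_all add: hom_def)
  have "g \<cdot> f = Id V X" by (rule arrow_ext[of _ X X]) (simp_all add: hom_def assms(3))
  moreover have "f \<cdot> g = Id V Y" by (rule arrow_ext[of _ Y Y]) (simp_all add: hom_def assms(4))
  ultimately show "iso V f" "inv f = g" using isoI[OF assms(1,2)] by auto
qed

section \<open>Enriched categories in terms of elements\<close>
abbreviation cmp where "cmp C a b c g f \<equiv> act (vcomp C a b c) (pr g f)"
abbreviation idt where "idt C a \<equiv> act (vid C a) star"

lemma vcategory_ar [simp]:
  assumes "vcategory V C"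
  shows "a \<in> vobj C \<Longrightarrow> b \<in> vobj C \<Longrightarrow> vhom C a b \<in> Ob V"
    "a \<in> vobj C \<Longrightarrow> vid C a \<in> Ar V" "a \<in> vobj C \<Longrightarrow> Dom V (vid C a) = U"
    "a \<in> vobj C \<Longrightarrow> Cod V (vid C a) = vhom C a a"
    "a \<in> vobj C \<Longrightarrow> b \<in> vobj C \<Longrightarrow> c \<in> vobj C \<Longrightarrow> vcomp C a b c \<in> Ar V"
    "a \<in> vobj C \<Longrightarrow> b \<in> vobj C \<Longrightarrow> c \<in> vobj C \<Longrightarrow> Dom V (vcomp C a b c) = vhom C b c \<otimes> vhom C a b"
    "a \<in> vobj C \<Longrightarrow> b \<in> vobj C \<Longrightarrow> c \<in> vobj C \<Longrightarrow> Cod V (vcomp C a b c) = vhom C a c"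
  using assms unfolding vcategory_def hom_def by auto

lemma vcategory_assoc [simp]:
  assumes "vcategory V C" "a \<in> vobj C" "b \<in> vobj C" "c \<in> vobj C" "d \<in> vobj C"
    "h \<in> El (vhom C c d)" "g \<in> El (vhom C b c)" "f \<in> El (vhom C a b)" "disj h g" "disj h f" "disj g f"
  shows "cmp C a b d (cmp C b c d h g) f = cmp C a c d h (cmp C a b c g f)"
proof -
  have "vcomp C a b d \<cdot> (vcomp C b c d \<boxtimes> Id V (vhom C a b)) =
        vcomp C a c d \<cdot> (Id V (vhom C c d) \<boxtimes> vcomp C a b c) \<cdot> assoc V (vhom C c d) (vhom C b c) (vhom C a b)"
    using assms(1-5) unfolding vcategory_def by blast
  then have "act (vcomp C a b d \<cdot> (vcomp C b c d \<boxtimes> Id V (vhom C a b))) (pr (pr h g) f) =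
        act (vcomp C a c d \<cdot> (Id V (vhom C c d) \<boxtimes> vcomp C a b c) \<cdot>
          assoc V (vhom C c d) (vhom C b c) (vhom C a b)) (pr (pr h g) f)"
    by simp
  then show ?thesis using assms by simp
qed

lemma vcategory_unit [simp]:
  assumes "vcategory V C" "a \<in> vobj C" "b \<in> vobj C" "f \<in> El (vhom C a b)"
  shows "cmp C a b b (idt C b) f = f" "cmp C a a b f (idt C a) = f"
proof -
  have "vcomp C a b b \<cdot> (vid C b \<boxtimes> Id V (vhom C a b)) = lunit V (vhom C a b)"
    "vcomp C a a b \<cdot> (Id V (vhom C a b) \<boxtimes> vid C a) = runit V (vhom C a b)"
    using assms(1-3) unfolding vcategory_def by blast+
  then have "act (vcomp C a b b \<cdot> (vid C b \<boxtimes> Id V (vhom C a b))) (pr star f) = act (lunit V (vhom C a b)) (pr star f)"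
    "act (vcomp C a a b \<cdot> (Id V (vhom C a b) \<boxtimes> vid C a)) (pr f star) = act (runit V (vhom C a b)) (pr f star)"
    by simp_all
  then show "cmp C a b b (idt C b) f = f" "cmp C a a b f (idt C a) = f" using assms by simp_all
qed

lemma vcategoryI:
  assumes [simp]: "\<And>a b. a \<in> vobj C \<Longrightarrow> b \<in> vobj C \<Longrightarrow> vhom C a b \<in> Ob V"
    and vid: "\<And>a. a \<in> vobj C \<Longrightarrow> vid C a \<in> hom V U (vhom C a a)"
    and vcomp: "\<And>a b c. a \<in> vobj C \<Longrightarrow> b \<in> vobj C \<Longrightarrow> c \<in> vobj C \<Longrightarrow>
      vcomp C a b c \<in> hom V (vhom C b c \<otimes> vhom C a b) (vhom C a c)"
    and ass: "\<And>a b c d f g h. a \<in> vobj C \<Longrightarrow> b \<in> vobj C \<Longrightarrow> c \<in> vobj C \<Longrightarrow> d \<in> vobj C \<Longrightarrow>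
      h \<in> El (vhom C c d) \<Longrightarrow> g \<in> El (vhom C b c) \<Longrightarrow> f \<in> El (vhom C a b) \<Longrightarrow>
      disj h g \<Longrightarrow> disj g h \<Longrightarrow> disj h f \<Longrightarrow> disj f h \<Longrightarrow> disj g f \<Longrightarrow> disj f g \<Longrightarrow>
      cmp C a b d (cmp C b c d h g) f = cmp C a c d h (cmp C a b c g f)"
    and unit: "\<And>a b f. a \<in> vobj C \<Longrightarrow> b \<in> vobj C \<Longrightarrow> f \<in> El (vhom C a b) \<Longrightarrow>
      cmp C a b b (idt C b) f = f \<and> cmp C a a b f (idt C a) = f"
  shows "vcategory V C"
proof -
  have [simp]: "\<And>a. a \<in> vobj C \<Longrightarrow> vid C a \<in> Ar V" "\<And>a. a \<in> vobj C \<Longrightarrow> Dom V (vid C a) = U"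
    "\<And>a. a \<in> vobj C \<Longrightarrow> Cod V (vid C a) = vhom C a a"
    "\<And>a b c. a \<in> vobj C \<Longrightarrow> b \<in> vobj C \<Longrightarrow> c \<in> vobj C \<Longrightarrow> vcomp C a b c \<in> Ar V"
    "\<And>a b c. a \<in> vobj C \<Longrightarrow> b \<in> vobj C \<Longrightarrow> c \<in> vobj C \<Longrightarrow> Dom V (vcomp C a b c) = vhom C b c \<otimes> vhom C a b"
    "\<And>a b c. a \<in> vobj C \<Longrightarrow> b \<in> vobj C \<Longrightarrow> c \<in> vobj C \<Longrightarrow> Cod V (vcomp C a b c) = vhom C a c"
    using vid vcomp by (auto simp: hom_def)
  show ?thesis
    unfolding vcategory_def
  proof (intro conjI ballI)
    fix a b c d assume [simp]: "a \<in> vobj C" "b \<in> vobj C" "c \<in> vobj C" "d \<in> vobj C"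
    show "vcomp C a b d \<cdot> (vcomp C b c d \<boxtimes> Id V (vhom C a b)) =
        vcomp C a c d \<cdot> (Id V (vhom C c d) \<boxtimes> vcomp C a b c) \<cdot> assoc V (vhom C c d) (vhom C b c) (vhom C a b)"
      by (rule arrow_ext3[where W = "vhom C c d" and X = "vhom C b c" and Y = "vhom C a b" and Z = "vhom C a d"])
        (simp_all add: hom_def ass)
  next
    fix a b assume [simp]: "a \<in> vobj C" "b \<in> vobj C"
    show "vcomp C a b b \<cdot> (vid C b \<boxtimes> Id V (vhom C a b)) = lunit V (vhom C a b)"
      by (rule arrow_ext_lunit[where Y = "vhom C a b" and Z = "vhom C a b"]) (simp_all add: hom_def unit)
    show "vcomp C a a b \<cdot> (Id V (vhom C a b) \<boxtimes> vid C a) = runit V (vhom C a b)"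
      by (rule arrow_ext_runit[where Y = "vhom C a b" and Z = "vhom C a b"]) (simp_all add: hom_def unit)
  qed (simp_all add: vid vcomp)
qed

lemma vself_simps [simp]: "vobj (vself V) = Ob V" "vhom (vself V) = ihom V"
  by (simp_all add: vself_def)

lemma vself_ar:
  "a \<in> Ob V \<Longrightarrow> vid (vself V) a \<in> hom V U (ihom V a a)"
  "a \<in> Ob V \<Longrightarrow> b \<in> Ob V \<Longrightarrow> c \<in> Ob V \<Longrightarrow>
    vcomp (vself V) a b c \<in> hom V (ihom V b c \<otimes> ihom V a b) (ihom V a c)"
  by (simp_all add: vself_def hom_def)

lemma ap_idt [simp]: "e \<in> El a \<Longrightarrow> ap a a (idt (vself V) a) e = e"
  by (simp add: vself_def El_Ob)

text \<open>Under evaluation, composition in \<open>vself V\<close> becomes composition of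
  functions; with \<open>ap_ext\<close> the category laws of \<open>vself V\<close> become
  immediate.\<close>

lemma ap_cmp [simp]:
  assumes "a \<in> Ob V" "b \<in> Ob V" "c \<in> Ob V" "g \<in> El (ihom V b c)" "f \<in> El (ihom V a b)" "e \<in> El a"
    "disj g f" "disj g e" "disj f e"
  shows "ap a c (cmp (vself V) a b c g f) e = ap b c g (ap a b f e)"
  using assms by (simp add: vself_def)

lemma vcategory_vself [simp]: "vcategory V (vself V)"
proof (rule vcategoryI)
  fix a b f assume a: "a \<in> vobj (vself V)" "b \<in> vobj (vself V)" "f \<in> El (vhom (vself V) a b)"
  then have [simp]: "a \<in> Ob V" "b \<in> Ob V" "f \<in> El (ihom V a b)" by simp_all
  note ar = vself_ar[unfolded hom_def, simplified]
  have "cmp (vself V) a b b (idt (vself V) b) f = f"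
    by (rule ap_ext[of _ a b]) (simp_all add: ar)
  moreover have "cmp (vself V) a a b f (idt (vself V) a) = f"
    by (rule ap_ext[of _ a b]) (simp_all add: ar)
  ultimately show "cmp (vself V) a b b (idt (vself V) b) f = f \<and> cmp (vself V) a a b f (idt (vself V) a) = f" ..
next
  fix a b c d f g h
  assume *: "a \<in> vobj (vself V)" "b \<in> vobj (vself V)" "c \<in> vobj (vself V)" "d \<in> vobj (vself V)"
    "h \<in> El (vhom (vself V) c d)" "g \<in> El (vhom (vself V) b c)" "f \<in> El (vhom (vself V) a b)"
    "disj h g" "disj g h" "disj h f" "disj f h" "disj g f" "disj f g"
  note ar = vself_ar[unfolded hom_def, simplified]
  show "cmp (vself V) a b d (cmp (vself V) b c d h g) f = cmp (vself V) a c d h (cmp (vself V) a b c g f)"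
    by (rule ap_ext[of _ a d]) (use * in \<open>simp_all add: ar\<close>)
qed (use vself_ar in simp_all)

lemma vop_simps [simp]:
  "vobj (vop V C) = vobj C" "vhom (vop V C) a b = vhom C b a" "vid (vop V C) = vid C"
  by (simp_all add: vop_def)

lemma cmp_vop [simp]:
  assumes "vcategory V C" "a \<in> vobj C" "b \<in> vobj C" "c \<in> vobj C"
    "g \<in> El (vhom C c b)" "f \<in> El (vhom C b a)" "disj g f" "disj f g"
  shows "cmp (vop V C) a b c g f = cmp C c b a f g"
  using assms by (simp add: vop_def)

lemma vcategory_vop [simp]:
  assumes [simp]: "vcategory V C"
  shows "vcategory V (vop V C)"
proof -
  have [simp]: "vcomp (vop V C) a b c \<in> Ar V" "Dom V (vcomp (vop V C) a b c) = vhom C c b \<otimes> vhom C b a"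
    "Cod V (vcomp (vop V C) a b c) = vhom C c a" if "a \<in> vobj C" "b \<in> vobj C" "c \<in> vobj C" for a b c
    using that by (simp_all add: vop_def)
  show ?thesis by (rule vcategoryI) (simp_all add: hom_def)
qed

lemma ucomp_ar [simp]:
  assumes "vcategory V C" "a \<in> vobj C" "b \<in> vobj C" "c \<in> vobj C" "g \<in> hom V U (vhom C b c)" "f \<in> hom V U (vhom C a b)"
  shows "ucomp V C a b c g f \<in> hom V U (vhom C a c)"
    "act (ucomp V C a b c g f) star = cmp C a b c (act g star) (act f star)"
  using assms by (simp_all add: ucomp_def hom_def)

text \<open>Both sides are arrows out of \<open>U\<close>, where \<open>star\<close> is
  generic.\<close>

lemma ucomp_eq_iff:
  assumes "vcategory V C" "a \<in> vobj C" "b \<in> vobj C" "c \<in> vobj C" "g \<in> hom V U (vhom C b c)" "f \<in> hom V U (vhom C a b)"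
    "h \<in> hom V U (vhom C a c)"
  shows "ucomp V C a b c g f = h \<longleftrightarrow> cmp C a b c (act g star) (act f star) = act h star"
  using ucomp_ar[OF assms(1-6)] arrow_ext_unit[of "ucomp V C a b c g f" _ h] assms(7) by auto

subsection \<open>Functors and natural transformations\<close>

lemma vfunctorD:
  assumes "vfunctor V C D F"
  shows "a \<in> vobj C \<Longrightarrow> fobj F a \<in> vobj D"
    "a \<in> vobj C \<Longrightarrow> b \<in> vobj C \<Longrightarrow> fmap F a b \<in> Ar V"
    "a \<in> vobj C \<Longrightarrow> b \<in> vobj C \<Longrightarrow> Dom V (fmap F a b) = vhom C a b"
    "a \<in> vobj C \<Longrightarrow> b \<in> vobj C \<Longrightarrow> Cod V (fmap F a b) = vhom D (fobj F a) (fobj F b)"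
  using assms by (auto simp: vfunctor_def hom_def)

lemma vfunctor_idt:
  assumes "vfunctor V C D F" "vcategory V C" "a \<in> vobj C"
  shows "act (fmap F a a) (idt C a) = idt D (fobj F a)"
proof -
  have "fmap F a a \<cdot> vid C a = vid D (fobj F a)" using assms by (auto simp: vfunctor_def)
  then have "act (fmap F a a \<cdot> vid C a) star = idt D (fobj F a)" by simp
  then show ?thesis using assms vfunctorD[OF assms(1)] by simp
qed

lemma vfunctor_cmp:
  assumes "vfunctor V C D F" "vcategory V C" "vcategory V D" "a \<in> vobj C" "b \<in> vobj C" "c \<in> vobj C"
    "g \<in> El (vhom C b c)" "f \<in> El (vhom C a b)" "disj g f"
  shows "act (fmap F a c) (cmp C a b c g f) =
    cmp D (fobj F a) (fobj F b) (fobj F c) (act (fmap F b c) g) (act (fmap F a b) f)"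
proof -
  have "fmap F a c \<cdot> vcomp C a b c = vcomp D (fobj F a) (fobj F b) (fobj F c) \<cdot> (fmap F b c \<boxtimes> fmap F a b)"
    using assms by (auto simp: vfunctor_def)
  then have "act (fmap F a c \<cdot> vcomp C a b c) (pr g f) =
    act (vcomp D (fobj F a) (fobj F b) (fobj F c) \<cdot> (fmap F b c \<boxtimes> fmap F a b)) (pr g f)" by simp
  then show ?thesis using assms vfunctorD[OF assms(1)] by simp
qed

lemmas vfunctor_simps = vfunctorD vfunctor_idt vfunctor_cmp

lemma mk_vfun_simps [simp]:
  "a \<in> A \<Longrightarrow> fobj (mk_vfun A f g) a = f a"
  "a \<in> A \<Longrightarrow> b \<in> A \<Longrightarrow> fmap (mk_vfun A f g) a b = g a b"
  by (simp_all add: mk_vfun_def)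

lemma vfunctor_mk:
  assumes C [simp]: "vcategory V C" and D [simp]: "vcategory V D"
    and f [simp]: "\<And>a. a \<in> vobj C \<Longrightarrow> f a \<in> vobj D"
    and g: "\<And>a b. a \<in> vobj C \<Longrightarrow> b \<in> vobj C \<Longrightarrow> g a b \<in> hom V (vhom C a b) (vhom D (f a) (f b))"
    and idt: "\<And>a. a \<in> vobj C \<Longrightarrow> act (g a a) (idt C a) = idt D (f a)"
    and cmp: "\<And>a b c u v. a \<in> vobj C \<Longrightarrow> b \<in> vobj C \<Longrightarrow> c \<in> vobj C \<Longrightarrow> u \<in> El (vhom C b c) \<Longrightarrow>
      v \<in> El (vhom C a b) \<Longrightarrow> disj u v \<Longrightarrow> disj v u \<Longrightarrow>
      act (g a c) (cmp C a b c u v) = cmp D (f a) (f b) (f c) (act (g b c) u) (act (g a b) v)"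
  shows "vfunctor V C D (mk_vfun (vobj C) f g)"
proof -
  have [simp]: "g a b \<in> Ar V" "Dom V (g a b) = vhom C a b" "Cod V (g a b) = vhom D (f a) (f b)"
    if "a \<in> vobj C" "b \<in> vobj C" for a b
    using g[OF that] by (auto simp: hom_def)
  show ?thesis
    unfolding vfunctor_def
  proof (intro conjI ballI)
    fix a assume [simp]: "a \<in> vobj C"
    show "fmap (mk_vfun (vobj C) f g) a a \<cdot> vid C a = vid D (fobj (mk_vfun (vobj C) f g) a)"
      by (rule arrow_ext_unit[of _ "vhom D (f a) (f a)"]) (simp_all add: hom_def idt)
  next
    fix a b c assume [simp]: "a \<in> vobj C" "b \<in> vobj C" "c \<in> vobj C"
    show "fmap (mk_vfun (vobj C) f g) a c \<cdot> vcomp C a b c =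
      vcomp D (fobj (mk_vfun (vobj C) f g) a) (fobj (mk_vfun (vobj C) f g) b) (fobj (mk_vfun (vobj C) f g) c) \<cdot>
       (fmap (mk_vfun (vobj C) f g) b c \<boxtimes> fmap (mk_vfun (vobj C) f g) a b)"
      by (rule arrow_ext2[of _ "vhom C b c" "vhom C a b" "vhom D (f a) (f c)"]) (simp_all add: hom_def cmp)
  qed (auto simp: g, auto simp: mk_vfun_def)
qed

lemma vfunctor_vfcomp:
  assumes C [simp]: "vcategory V C" and D [simp]: "vcategory V D" and E [simp]: "vcategory V E"
    and F: "vfunctor V C D F" and G: "vfunctor V D E G"
  shows "vfunctor V C E (vfcomp V C G F)"
  unfolding vfcomp_def
  by (rule vfunctor_mk) (simp_all add: vfunctor_simps[OF F] vfunctor_simps[OF G] hom_def)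

lemma vfcomp_simps [simp]:
  "a \<in> vobj C \<Longrightarrow> fobj (vfcomp V C G F) a = fobj G (fobj F a)"
  "a \<in> vobj C \<Longrightarrow> b \<in> vobj C \<Longrightarrow> fmap (vfcomp V C G F) a b = fmap G (fobj F a) (fobj F b) \<cdot> fmap F a b"
  by (simp_all add: vfcomp_def)

text \<open>Only the typing of the data of F and G is assumed. The criterion thus applies to
  \<open>bracket\<close>, \<open>vfid\<close> and \<open>vfcomp\<close> without a prior proof that
  they are functors.\<close>

lemma vnat_iff:
  assumes C [simp]: "vcategory V C" and D [simp]: "vcategory V D"
    and F: "\<And>a. a \<in> vobj C \<Longrightarrow> fobj F a \<in> vobj D"
      "\<And>a b. a \<in> vobj C \<Longrightarrow> b \<in> vobj C \<Longrightarrow> fmap F a b \<in> hom V (vhom C a b) (vhom D (fobj F a) (fobj F b))"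
    and G: "\<And>a. a \<in> vobj C \<Longrightarrow> fobj G a \<in> vobj D"
      "\<And>a b. a \<in> vobj C \<Longrightarrow> b \<in> vobj C \<Longrightarrow> fmap G a b \<in> hom V (vhom C a b) (vhom D (fobj G a) (fobj G b))"
  shows "vnat V C D F G \<alpha> \<longleftrightarrow>
    (\<forall>a\<in>vobj C. \<alpha> a \<in> hom V U (vhom D (fobj F a) (fobj G a))) \<and>
    (\<forall>a\<in>vobj C. \<forall>b\<in>vobj C. \<forall>t\<in>El (vhom C a b).
        cmp D (fobj F a) (fobj F b) (fobj G b) (act (\<alpha> b) star) (act (fmap F a b) t) =
        cmp D (fobj F a) (fobj G a) (fobj G b) (act (fmap G a b) t) (act (\<alpha> a) star))" (is "_ \<longleftrightarrow> ?t \<and> ?n")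
proof -
  have "vcomp D (fobj F a) (fobj F b) (fobj G b) \<cdot> (\<alpha> b \<boxtimes> fmap F a b) \<cdot> inv (lunit V (vhom C a b)) =
        vcomp D (fobj F a) (fobj G a) (fobj G b) \<cdot> (fmap G a b \<boxtimes> \<alpha> a) \<cdot> inv (runit V (vhom C a b))
      \<longleftrightarrow> (\<forall>t\<in>El (vhom C a b).
        cmp D (fobj F a) (fobj F b) (fobj G b) (act (\<alpha> b) star) (act (fmap F a b) t) =
        cmp D (fobj F a) (fobj G a) (fobj G b) (act (fmap G a b) t) (act (\<alpha> a) star))"
      (is "?l = ?r \<longleftrightarrow> ?e")
    if ?t and [simp]: "a \<in> vobj C" "b \<in> vobj C" for a b
  proof -
    note [simp] = F(1)[OF that(2)] F(1)[OF that(3)] G(1)[OF that(2)] G(1)[OF that(3)]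
    have [simp]: "\<alpha> a \<in> Ar V" "Dom V (\<alpha> a) = U" "Cod V (\<alpha> a) = vhom D (fobj F a) (fobj G a)"
      "\<alpha> b \<in> Ar V" "Dom V (\<alpha> b) = U" "Cod V (\<alpha> b) = vhom D (fobj F b) (fobj G b)"
      "fmap F a b \<in> Ar V" "Dom V (fmap F a b) = vhom C a b" "Cod V (fmap F a b) = vhom D (fobj F a) (fobj F b)"
      "fmap G a b \<in> Ar V" "Dom V (fmap G a b) = vhom C a b" "Cod V (fmap G a b) = vhom D (fobj G a) (fobj G b)"
      using that F(2)[OF that(2,3)] G(2)[OF that(2,3)] by (auto simp: hom_def)
    have h: "?l \<in> hom V (vhom C a b) (vhom D (fobj F a) (fobj G b))"
      "?r \<in> hom V (vhom C a b) (vhom D (fobj F a) (fobj G b))"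
      by (simp_all add: hom_def)
    have e: "act ?l t = cmp D (fobj F a) (fobj F b) (fobj G b) (act (\<alpha> b) star) (act (fmap F a b) t)"
      "act ?r t = cmp D (fobj F a) (fobj G a) (fobj G b) (act (fmap G a b) t) (act (\<alpha> a) star)"
      if "t \<in> El (vhom C a b)" for t
      using that by simp_all
    show ?thesis
    proof
      assume "?l = ?r"
      then show ?e using e by auto
    next
      assume ?e
      then show "?l = ?r" using e by (intro arrow_ext[OF h]) simp
    qed
  qed
  then show ?thesis unfolding vnat_def by blast
qed


lemma vnat_iso_iff:
  assumes D: "vcategory V D"
    and F: "\<And>a. a \<in> vobj C \<Longrightarrow> fobj F a \<in> vobj D" and G: "\<And>a. a \<in> vobj C \<Longrightarrow> fobj G a \<in> vobj D"
  shows "vnat_iso V C D F G \<alpha> \<longleftrightarrow> vnat V C D F G \<alpha> \<and>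
    (\<forall>a\<in>vobj C. \<exists>\<beta>\<in>hom V U (vhom D (fobj G a) (fobj F a)).
      cmp D (fobj F a) (fobj G a) (fobj F a) (act \<beta> star) (act (\<alpha> a) star) = idt D (fobj F a) \<and>
      cmp D (fobj G a) (fobj F a) (fobj G a) (act (\<alpha> a) star) (act \<beta> star) = idt D (fobj G a))"
proof -
  have "ucomp V D (fobj F a) (fobj G a) (fobj F a) \<beta> (\<alpha> a) = vid D (fobj F a) \<and>
        ucomp V D (fobj G a) (fobj F a) (fobj G a) (\<alpha> a) \<beta> = vid D (fobj G a) \<longleftrightarrow>
      cmp D (fobj F a) (fobj G a) (fobj F a) (act \<beta> star) (act (\<alpha> a) star) = idt D (fobj F a) \<and>
      cmp D (fobj G a) (fobj F a) (fobj G a) (act (\<alpha> a) star) (act \<beta> star) = idt D (fobj G a)"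
    if "vnat V C D F G \<alpha>" "a \<in> vobj C" "\<beta> \<in> hom V U (vhom D (fobj G a) (fobj F a))" for a \<beta>
  proof -
    have "\<alpha> a \<in> hom V U (vhom D (fobj F a) (fobj G a))" using that by (auto simp: vnat_def)
    moreover have "vid D (fobj F a) \<in> hom V U (vhom D (fobj F a) (fobj F a))"
      "vid D (fobj G a) \<in> hom V U (vhom D (fobj G a) (fobj G a))"
      using D F[OF that(2)] G[OF that(2)] by (auto simp: hom_def)
    ultimately show ?thesis using ucomp_eq_iff[OF D] F[OF that(2)] G[OF that(2)] that(3) by simp
  qed
  then show ?thesis unfolding vnat_iso_def by (metis (no_types, lifting))
qed

text \<open>Converts invertibility in the underlying category of \<open>vself V\<close>, as
  \<open>vnat_iso\<close> demands it, into invertibility in \<open>V\<close>; the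
  \<open>name\<close> of the inverse arrow is the witness.\<close>

lemma vself_iso_iff:
  assumes \<alpha>: "\<alpha> \<in> hom V U (ihom V x y)" and [simp]: "x \<in> Ob V" "y \<in> Ob V"
  shows "(\<exists>\<beta>\<in>hom V U (ihom V y x).
      cmp (vself V) x y x (act \<beta> star) (act \<alpha> star) = idt (vself V) x \<and>
      cmp (vself V) y x y (act \<alpha> star) (act \<beta> star) = idt (vself V) y) \<longleftrightarrow> iso V (unname V x y \<alpha>)"
    (is "?l \<longleftrightarrow> ?r")
proof
  have [simp]: "\<alpha> \<in> Ar V" "Dom V \<alpha> = U" "Cod V \<alpha> = ihom V x y" using \<alpha> by (auto simp: hom_def)
  {
    assume ?l
    then obtain \<beta> where b: "\<beta> \<in> hom V U (ihom V y x)"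
      and i: "cmp (vself V) x y x (act \<beta> star) (act \<alpha> star) = idt (vself V) x"
      "cmp (vself V) y x y (act \<alpha> star) (act \<beta> star) = idt (vself V) y" by auto
    have [simp]: "\<beta> \<in> Ar V" "Dom V \<beta> = U" "Cod V \<beta> = ihom V y x" using b by (auto simp: hom_def)
    have "ap y x (act \<beta> star) (ap x y (act \<alpha> star) e) = e" if "e \<in> El x" for e
      using arg_cong[OF i(1), of "\<lambda>u. ap x x u e"] that by simp
    moreover have "ap x y (act \<alpha> star) (ap y x (act \<beta> star) e) = e" if "e \<in> El y" for e
      using arg_cong[OF i(2), of "\<lambda>u. ap y y u e"] that by simp
    ultimately show ?r
      by (intro iso_elementsI(1)[of _ x y "unname V y x \<beta>"]) (simp_all add: hom_def)
  next
    assume r [simp]: ?r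
    let ?b = "name y x (inv (unname V x y \<alpha>))"
    have a: "ap x y (act \<alpha> star) u = act (unname V x y \<alpha>) u" if "u \<in> El x" for u
      using that by simp
    have 1: "cmp (vself V) x y x (act ?b star) (act \<alpha> star) = idt (vself V) x"
      by (rule ap_ext[of _ x x]) (simp_all add: a del: act_unname)
    have 2: "cmp (vself V) y x y (act \<alpha> star) (act ?b star) = idt (vself V) y"
      by (rule ap_ext[of _ y y]) (simp_all add: a del: act_unname)
    show ?l by (rule bexI[of _ ?b]) (simp_all add: 1 2 hom_def)
  }
qed

text \<open>For functors into \<open>V\<close> the naturality equation can be evaluated at a further
  element of F a, so that it speaks of values rather than of composites in
  \<open>vself V\<close>.\<close>

lemma vnat_vself_iff:
  assumes C [simp]: "vcategory V C" and F: "vfunctor V C (vself V) F" and G: "vfunctor V C (vself V) G"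
  shows "vnat_iso V C (vself V) F G \<alpha> \<longleftrightarrow>
    (\<forall>a\<in>vobj C. \<alpha> a \<in> hom V U (ihom V (fobj F a) (fobj G a)) \<and> iso V (unname V (fobj F a) (fobj G a) (\<alpha> a))) \<and>
    (\<forall>a\<in>vobj C. \<forall>b\<in>vobj C. \<forall>t\<in>El (vhom C a b). \<forall>e\<in>El (fobj F a). disj t e \<longrightarrow> disj e t \<longrightarrow>
      ap (fobj F b) (fobj G b) (act (\<alpha> b) star) (ap (fobj F a) (fobj F b) (act (fmap F a b) t) e) =
      ap (fobj G a) (fobj G b) (act (fmap G a b) t) (ap (fobj F a) (fobj G a) (act (\<alpha> a) star) e))"
    (is "_ \<longleftrightarrow> ?i \<and> ?n")
proof -
  note [simp] = vfunctor_simps[OF F, simplified] vfunctor_simps[OF G, simplified]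
  have n: "cmp (vself V) (fobj F a) (fobj F b) (fobj G b) (act (\<alpha> b) star) (act (fmap F a b) t) =
      cmp (vself V) (fobj F a) (fobj G a) (fobj G b) (act (fmap G a b) t) (act (\<alpha> a) star) \<longleftrightarrow>
      (\<forall>e\<in>El (fobj F a). disj t e \<longrightarrow> disj e t \<longrightarrow>
      ap (fobj F b) (fobj G b) (act (\<alpha> b) star) (ap (fobj F a) (fobj F b) (act (fmap F a b) t) e) =
      ap (fobj G a) (fobj G b) (act (fmap G a b) t) (ap (fobj F a) (fobj G a) (act (\<alpha> a) star) e))"
      (is "?l = ?r \<longleftrightarrow> ?e")
    if h: "\<forall>a\<in>vobj C. \<alpha> a \<in> hom V U (ihom V (fobj F a) (fobj G a))"
      and [simp]: "a \<in> vobj C" "b \<in> vobj C" "t \<in> El (vhom C a b)" for a b t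
  proof -
    have [simp]: "\<alpha> a \<in> Ar V" "Dom V (\<alpha> a) = U" "Cod V (\<alpha> a) = ihom V (fobj F a) (fobj G a)"
      "\<alpha> b \<in> Ar V" "Dom V (\<alpha> b) = U" "Cod V (\<alpha> b) = ihom V (fobj F b) (fobj G b)"
      using h by (auto simp: hom_def)
    show ?thesis
    proof
      assume eq: "?l = ?r"
      show ?e
      proof (intro ballI impI)
        fix e assume [simp]: "e \<in> El (fobj F a)" "disj t e" "disj e t"
        show "ap (fobj F b) (fobj G b) (act (\<alpha> b) star) (ap (fobj F a) (fobj F b) (act (fmap F a b) t) e) =
          ap (fobj G a) (fobj G b) (act (fmap G a b) t) (ap (fobj F a) (fobj G a) (act (\<alpha> a) star) e)"
          using arg_cong[OF eq, of "\<lambda>u. ap (fobj F a) (fobj G b) u e"] by simp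
      qed
    next
      assume e: ?e
      show "?l = ?r"
        by (rule ap_ext[of _ "fobj F a" "fobj G b"]) (simp_all add: e)
    qed
  qed
  have v: "vnat V C (vself V) F G \<alpha> \<longleftrightarrow>
    (\<forall>a\<in>vobj C. \<alpha> a \<in> hom V U (ihom V (fobj F a) (fobj G a))) \<and>
    (\<forall>a\<in>vobj C. \<forall>b\<in>vobj C. \<forall>t\<in>El (vhom C a b).
        cmp (vself V) (fobj F a) (fobj F b) (fobj G b) (act (\<alpha> b) star) (act (fmap F a b) t) =
        cmp (vself V) (fobj F a) (fobj G a) (fobj G b) (act (fmap G a b) t) (act (\<alpha> a) star))"
    by (subst vnat_iff) (simp_all add: hom_def)
  have w: "vnat_iso V C (vself V) F G \<alpha> \<longleftrightarrow> vnat V C (vself V) F G \<alpha> \<and>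
    (\<forall>a\<in>vobj C. \<exists>\<beta>\<in>hom V U (ihom V (fobj G a) (fobj F a)).
      cmp (vself V) (fobj F a) (fobj G a) (fobj F a) (act \<beta> star) (act (\<alpha> a) star) = idt (vself V) (fobj F a) \<and>
      cmp (vself V) (fobj G a) (fobj F a) (fobj G a) (act (\<alpha> a) star) (act \<beta> star) = idt (vself V) (fobj G a))"
    by (subst vnat_iso_iff) simp_all
  have i: "(\<exists>\<beta>\<in>hom V U (ihom V (fobj G a) (fobj F a)).
      cmp (vself V) (fobj F a) (fobj G a) (fobj F a) (act \<beta> star) (act (\<alpha> a) star) = idt (vself V) (fobj F a) \<and>
      cmp (vself V) (fobj G a) (fobj F a) (fobj G a) (act (\<alpha> a) star) (act \<beta> star) = idt (vself V) (fobj G a))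
     \<longleftrightarrow> iso V (unname V (fobj F a) (fobj G a) (\<alpha> a))"
    if "\<forall>a\<in>vobj C. \<alpha> a \<in> hom V U (ihom V (fobj F a) (fobj G a))" "a \<in> vobj C" for a
    by (rule vself_iso_iff) (use that in auto)
  show ?thesis unfolding w v using n i by (auto cong: conj_cong)
qed

lemma viso_vselfE:
  assumes C [simp]: "vcategory V C" and F: "vfunctor V C (vself V) F" and G: "vfunctor V C (vself V) G"
    and n: "vnat_iso V C (vself V) F G \<alpha>"
  defines "h \<equiv> \<lambda>a. unname V (fobj F a) (fobj G a) (\<alpha> a)"
  shows "\<And>a. a \<in> vobj C \<Longrightarrow> h a \<in> hom V (fobj F a) (fobj G a)" "\<And>a. a \<in> vobj C \<Longrightarrow> iso V (h a)"
    "\<And>a. a \<in> vobj C \<Longrightarrow> \<alpha> a \<in> hom V U (ihom V (fobj F a) (fobj G a))"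
    "\<And>a b t e. a \<in> vobj C \<Longrightarrow> b \<in> vobj C \<Longrightarrow> t \<in> El (vhom C a b) \<Longrightarrow> e \<in> El (fobj F a) \<Longrightarrow> disj t e \<Longrightarrow>
      act (h b) (ap (fobj F a) (fobj F b) (act (fmap F a b) t) e) =
      ap (fobj G a) (fobj G b) (act (fmap G a b) t) (act (h a) e)"
proof -
  note [simp] = vfunctor_simps[OF F, simplified] vfunctor_simps[OF G, simplified]
  note n = n[unfolded vnat_vself_iff[OF C F G]]
  show a: "\<alpha> a \<in> hom V U (ihom V (fobj F a) (fobj G a))" if "a \<in> vobj C" for a using n that by blast
  then have [simp]: "\<alpha> a \<in> Ar V" "Dom V (\<alpha> a) = U" "Cod V (\<alpha> a) = ihom V (fobj F a) (fobj G a)" if "a \<in> vobj C" for a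
    using that by (auto simp: hom_def)
  show "h a \<in> hom V (fobj F a) (fobj G a)" "iso V (h a)" if "a \<in> vobj C" for a
    using n that unfolding h_def by (auto simp: hom_def)
  show "act (h b) (ap (fobj F a) (fobj F b) (act (fmap F a b) t) e) =
      ap (fobj G a) (fobj G b) (act (fmap G a b) t) (act (h a) e)"
    if "a \<in> vobj C" "b \<in> vobj C" "t \<in> El (vhom C a b)" "e \<in> El (fobj F a)" "disj t e" for a b t e
    using n that disj_sym[OF that(5)] by (simp add: h_def)
qed

lemma viso_vselfI:
  assumes C [simp]: "vcategory V C" and F: "vfunctor V C (vself V) F" and G: "vfunctor V C (vself V) G"
    and h: "\<And>a. a \<in> vobj C \<Longrightarrow> h a \<in> hom V (fobj F a) (fobj G a)" "\<And>a. a \<in> vobj C \<Longrightarrow> iso V (h a)"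
    and n: "\<And>a b t e. a \<in> vobj C \<Longrightarrow> b \<in> vobj C \<Longrightarrow> t \<in> El (vhom C a b) \<Longrightarrow> e \<in> El (fobj F a) \<Longrightarrow> disj t e \<Longrightarrow> disj e t \<Longrightarrow>
      act (h b) (ap (fobj F a) (fobj F b) (act (fmap F a b) t) e) =
      ap (fobj G a) (fobj G b) (act (fmap G a b) t) (act (h a) e)"
  shows "vnat_iso V C (vself V) F G (\<lambda>a. name (fobj F a) (fobj G a) (h a))"
proof -
  note [simp] = vfunctor_simps[OF F, simplified] vfunctor_simps[OF G, simplified]
  have [simp]: "h a \<in> Ar V" "Dom V (h a) = fobj F a" "Cod V (h a) = fobj G a" "iso V (h a)" if "a \<in> vobj C" for a
    using h that by (auto simp: hom_def)
  have u: "unname V (fobj F a) (fobj G a) (name (fobj F a) (fobj G a) (h a)) = h a" if "a \<in> vobj C" for a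
    by (rule arrow_ext[of _ "fobj F a" "fobj G a"]) (use that in \<open>simp_all add: hom_def\<close>)
  show ?thesis unfolding vnat_vself_iff[OF C F G]
    by (simp add: u hom_def n)
qed

subsection \<open>Hom functors\<close>

lemma hom_fun_fobj [simp]: "b \<in> vobj C \<Longrightarrow> fobj (hom_fun V C a) b = vhom C a b"
  by (simp add: hom_fun_def)

lemma hom_fun_ar [simp]:
  assumes "vcategory V C" "a \<in> vobj C" "b \<in> vobj C" "c \<in> vobj C"
  shows "fmap (hom_fun V C a) b c \<in> Ar V" "Dom V (fmap (hom_fun V C a) b c) = vhom C b c"
    "Cod V (fmap (hom_fun V C a) b c) = ihom V (vhom C a b) (vhom C a c)"
  using assms by (simp_all add: hom_fun_def)

lemma ap_hom_fun [simp]: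
  assumes "vcategory V C" "a \<in> vobj C" "b \<in> vobj C" "c \<in> vobj C"
    "g \<in> El (vhom C b c)" "f \<in> El (vhom C a b)" "disj g f"
  shows "ap (vhom C a b) (vhom C a c) (act (fmap (hom_fun V C a) b c) g) f = cmp C a b c g f"
  using assms by (simp add: hom_fun_def)

lemma ap_hom_fun_vop [simp]:
  assumes "vcategory V C" "a \<in> vobj C" "b \<in> vobj C" "c \<in> vobj C"
    "g \<in> El (vhom C c b)" "f \<in> El (vhom C b a)" "disj g f" "disj f g"
  shows "ap (vhom C b a) (vhom C c a) (act (fmap (hom_fun V (vop V C) a) b c) g) f = cmp C c b a f g"
  using ap_hom_fun[of "vop V C" a b c g f] assms by simp

lemma ap_hom_fun_vself [simp]:
  assumes "a \<in> Ob V" "b \<in> Ob V" "c \<in> Ob V" "g \<in> El (ihom V b c)" "f \<in> El (ihom V a b)" "disj g f"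
  shows "ap (ihom V a b) (ihom V a c) (act (fmap (hom_fun V (vself V) a) b c) g) f = cmp (vself V) a b c g f"
  using ap_hom_fun[of "vself V" a b c g f] assms by simp

lemma vfunctor_hom_fun [simp]:
  assumes C [simp]: "vcategory V C" and a [simp]: "a \<in> vobj C"
  shows "vfunctor V C (vself V) (hom_fun V C a)"
proof -
  show ?thesis
    unfolding hom_fun_def
  proof (rule vfunctor_mk)
    fix b assume [simp]: "b \<in> vobj C"
    show "act (curry_ar V (vhom C b b) (vhom C a b) (vhom C a b) (vcomp C a b b)) (idt C b) = idt (vself V) (vhom C a b)"
      by (rule ap_ext[of _ "vhom C a b" "vhom C a b"]) simp_all
  next
    fix b c d u v
    assume [simp]: "b \<in> vobj C" "c \<in> vobj C" "d \<in> vobj C" "u \<in> El (vhom C c d)" "v \<in> El (vhom C b c)"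
      "disj u v" "disj v u"
    show "act (curry_ar V (vhom C b d) (vhom C a b) (vhom C a d) (vcomp C a b d)) (cmp C b c d u v) =
       cmp (vself V) (vhom C a b) (vhom C a c) (vhom C a d)
        (act (curry_ar V (vhom C c d) (vhom C a c) (vhom C a d) (vcomp C a c d)) u)
        (act (curry_ar V (vhom C b c) (vhom C a b) (vhom C a c) (vcomp C a b c)) v)"
      by (rule ap_ext[of _ "vhom C a b" "vhom C a d"]) simp_all
  qed (simp_all add: hom_def)
qed

subsection \<open>Wedges and ends\<close>

text \<open>The symmetry in \<open>is_wedge\<close> becomes a mere exchange of variables. Elements
  of x are arbitrary here; when x is \<open>U\<close> or a tensor product a special generic element
  is more convenient, and \<open>is_wedge_unitI\<close> and \<open>Alg_cmp\<close> verify the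
  condition directly.\<close>

lemma is_wedge_iff:
  assumes K [simp]: "vcategory V K" and F: "vfunctor V K (vself V) F" and G: "vfunctor V K (vself V) G"
    and x [simp]: "x \<in> Ob V" and e: "\<And>k. k \<in> vobj K \<Longrightarrow> e k \<in> hom V x (ihom V (fobj F k) (fobj G k))"
  shows "is_wedge V K F G x e \<longleftrightarrow>
    (\<forall>k\<in>vobj K. \<forall>l\<in>vobj K. \<forall>u\<in>El x. \<forall>t\<in>El (vhom K k l). \<forall>w\<in>El (fobj F k).
      disj u t \<longrightarrow> disj t u \<longrightarrow> disj u w \<longrightarrow> disj w u \<longrightarrow> disj t w \<longrightarrow> disj w t \<longrightarrow>
      ap (fobj G k) (fobj G l) (act (fmap G k l) t) (ap (fobj F k) (fobj G k) (act (e k) u) w) =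
      ap (fobj F l) (fobj G l) (act (e l) u) (ap (fobj F k) (fobj F l) (act (fmap F k l) t) w))"
proof -
  note [simp] = vfunctor_simps[OF F, simplified] vfunctor_simps[OF G, simplified]
  have [simp]: "e k \<in> Ar V" "Dom V (e k) = x" "Cod V (e k) = ihom V (fobj F k) (fobj G k)" if "k \<in> vobj K" for k
    using e[OF that] by (auto simp: hom_def)
  have "vcomp (vself V) (fobj F k) (fobj G k) (fobj G l) \<cdot> (fmap G k l \<boxtimes> e k) \<cdot> sym V x (vhom K k l) =
        vcomp (vself V) (fobj F k) (fobj F l) (fobj G l) \<cdot> (e l \<boxtimes> fmap F k l) \<longleftrightarrow>
      (\<forall>u\<in>El x. \<forall>t\<in>El (vhom K k l). \<forall>w\<in>El (fobj F k).
      disj u t \<longrightarrow> disj t u \<longrightarrow> disj u w \<longrightarrow> disj w u \<longrightarrow> disj t w \<longrightarrow> disj w t \<longrightarrow>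
      ap (fobj G k) (fobj G l) (act (fmap G k l) t) (ap (fobj F k) (fobj G k) (act (e k) u) w) =
      ap (fobj F l) (fobj G l) (act (e l) u) (ap (fobj F k) (fobj F l) (act (fmap F k l) t) w))"
    (is "?l = ?r \<longleftrightarrow> ?e") if [simp]: "k \<in> vobj K" "l \<in> vobj K" for k l
  proof
    assume eq: "?l = ?r"
    show ?e
    proof (intro ballI impI)
      fix u t w assume [simp]: "u \<in> El x" "t \<in> El (vhom K k l)" "w \<in> El (fobj F k)"
        "disj u t" "disj t u" "disj u w" "disj w u" "disj t w" "disj w t"
      show "ap (fobj G k) (fobj G l) (act (fmap G k l) t) (ap (fobj F k) (fobj G k) (act (e k) u) w) =
        ap (fobj F l) (fobj G l) (act (e l) u) (ap (fobj F k) (fobj F l) (act (fmap F k l) t) w)"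
        using arg_cong[OF eq, of "\<lambda>f. ap (fobj F k) (fobj G l) (act f (pr u t)) w"] by simp
    qed
  next
    assume e: ?e
    show "?l = ?r"
    proof (rule arrow_ext2[of _ x "vhom K k l" "ihom V (fobj F k) (fobj G l)"])
      fix u t assume [simp]: "u \<in> El x" "t \<in> El (vhom K k l)" "disj u t" "disj t u"
      show "act ?l (pr u t) = act ?r (pr u t)"
        by (rule ap_ext[of _ "fobj F k" "fobj G l"]) (simp_all add: e)
    qed (simp_all add: hom_def)
  qed
  then show ?thesis unfolding is_wedge_def using e x by auto
qed

lemma is_wedgeD:
  assumes K: "vcategory V K" and F: "vfunctor V K (vself V) F" and G: "vfunctor V K (vself V) G"
    and w: "is_wedge V K F G x e"
  shows "x \<in> Ob V" "\<And>k. k \<in> vobj K \<Longrightarrow> e k \<in> hom V x (ihom V (fobj F k) (fobj G k))"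
    "\<And>k l u t w. k \<in> vobj K \<Longrightarrow> l \<in> vobj K \<Longrightarrow> u \<in> El x \<Longrightarrow> t \<in> El (vhom K k l) \<Longrightarrow> w \<in> El (fobj F k) \<Longrightarrow>
      disj u t \<Longrightarrow> disj u w \<Longrightarrow> disj t w \<Longrightarrow>
      ap (fobj G k) (fobj G l) (act (fmap G k l) t) (ap (fobj F k) (fobj G k) (act (e k) u) w) =
      ap (fobj F l) (fobj G l) (act (e l) u) (ap (fobj F k) (fobj F l) (act (fmap F k l) t) w)"
proof -
  show x: "x \<in> Ob V" "\<And>k. k \<in> vobj K \<Longrightarrow> e k \<in> hom V x (ihom V (fobj F k) (fobj G k))"
    using w by (auto simp: is_wedge_def)
  note i = iffD1[OF is_wedge_iff[OF K F G x] w]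
  show "ap (fobj G k) (fobj G l) (act (fmap G k l) t) (ap (fobj F k) (fobj G k) (act (e k) u) w) =
      ap (fobj F l) (fobj G l) (act (e l) u) (ap (fobj F k) (fobj F l) (act (fmap F k l) t) w)"
    if "k \<in> vobj K" "l \<in> vobj K" "u \<in> El x" "t \<in> El (vhom K k l)" "w \<in> El (fobj F k)"
      "disj u t" "disj u w" "disj t w" for k l u t w
    using i that disj_sym[OF that(6)] disj_sym[OF that(7)] disj_sym[OF that(8)] by blast
qed

lemma is_wedge_unitI:
  assumes K [simp]: "vcategory V K" and F: "vfunctor V K (vself V) F" and G: "vfunctor V K (vself V) G"
    and e: "\<And>k. k \<in> vobj K \<Longrightarrow> e k \<in> hom V U (ihom V (fobj F k) (fobj G k))"
    and nat: "\<And>k l t w. k \<in> vobj K \<Longrightarrow> l \<in> vobj K \<Longrightarrow> t \<in> El (vhom K k l) \<Longrightarrow> w \<in> El (fobj F k) \<Longrightarrow>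
      disj t w \<Longrightarrow> disj w t \<Longrightarrow>
      ap (fobj G k) (fobj G l) (act (fmap G k l) t) (ap (fobj F k) (fobj G k) (act (e k) star) w) =
      ap (fobj F l) (fobj G l) (act (e l) star) (ap (fobj F k) (fobj F l) (act (fmap F k l) t) w)"
  shows "is_wedge V K F G U e"
proof -
  note [simp] = vfunctor_simps[OF F, simplified] vfunctor_simps[OF G, simplified]
  have [simp]: "e k \<in> Ar V" "Dom V (e k) = U" "Cod V (e k) = ihom V (fobj F k) (fobj G k)" if "k \<in> vobj K" for k
    using e[OF that] by (auto simp: hom_def)
  show ?thesis
    unfolding is_wedge_def
  proof (intro conjI ballI)
    fix k l assume [simp]: "k \<in> vobj K" "l \<in> vobj K"
    show "vcomp (vself V) (fobj F k) (fobj G k) (fobj G l) \<cdot> (fmap G k l \<boxtimes> e k) \<cdot> sym V U (vhom K k l) =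
        vcomp (vself V) (fobj F k) (fobj F l) (fobj G l) \<cdot> (e l \<boxtimes> fmap F k l)" (is "?l = ?r")
    proof (rule arrow_ext_lunit[of _ "vhom K k l" "ihom V (fobj F k) (fobj G l)"])
      fix t assume [simp]: "t \<in> El (vhom K k l)"
      show "act ?l (pr star t) = act ?r (pr star t)"
        by (rule ap_ext[of _ "fobj F k" "fobj G l"]) (simp_all add: nat)
    qed (simp_all add: hom_def)
  qed (simp_all add: e)
qed

lemma is_wedge_cmp:
  assumes K [simp]: "vcategory V K" and F: "vfunctor V K (vself V) F" and G: "vfunctor V K (vself V) G"
    and w: "is_wedge V K F G y e" and f: "f \<in> hom V x y" and d: "\<And>k. k \<in> vobj K \<Longrightarrow> d k = e k \<cdot> f"
  shows "is_wedge V K F G x d"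
proof -
  note [simp] = vfunctor_simps[OF F, simplified] vfunctor_simps[OF G, simplified]
  have [simp]: "f \<in> Ar V" "Dom V f = x" "Cod V f = y" "x \<in> Ob V" using f hom_Ob[OF f] by (auto simp: hom_def)
  have [simp]: "e k \<in> Ar V" "Dom V (e k) = y" "Cod V (e k) = ihom V (fobj F k) (fobj G k)" if "k \<in> vobj K" for k
    using is_wedgeD(2)[OF K F G w that] by (auto simp: hom_def)
  show ?thesis
    by (subst is_wedge_iff[OF K F G]) (simp_all add: hom_def d is_wedgeD(3)[OF K F G w])
qed

lemma is_end_chosen:
  assumes "has_end V K F G"
  shows "is_end V K F G (nat_ob V K F G) (nat_proj V K F G)"
proof -
  obtain h e where "is_end V K F G (fst (h, e)) (snd (h, e))"
    using assms by (auto simp: has_end_def)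
  then have "is_end V K F G (fst (SOME x. is_end V K F G (fst x) (snd x))) (snd (SOME x. is_end V K F G (fst x) (snd x)))"
    by (rule someI[of "\<lambda>x. is_end V K F G (fst x) (snd x)"])
  then show ?thesis
    unfolding nat_ob_def nat_proj_def chosen_end_def case_prod_beta .
qed

lemma nat_proj_wedge: "has_end V K F G \<Longrightarrow> is_wedge V K F G (nat_ob V K F G) (nat_proj V K F G)"
  by (drule is_end_chosen) (simp add: is_end_def)

lemma nat_ob_Ob: "has_end V K F G \<Longrightarrow> nat_ob V K F G \<in> Ob V"
  by (drule nat_proj_wedge) (simp add: is_wedge_def)

lemma nat_proj_ar:
  assumes "has_end V K F G" "k \<in> vobj K"
  shows "nat_proj V K F G k \<in> Ar V" "Dom V (nat_proj V K F G k) = nat_ob V K F G"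
    "Cod V (nat_proj V K F G k) = ihom V (fobj F k) (fobj G k)"
  using nat_proj_wedge[OF assms(1)] assms(2) by (auto simp: is_wedge_def hom_def)

lemma end_lift_spec:
  assumes "has_end V K F G" "is_wedge V K F G x d"
  shows "end_lift V K F G x d \<in> hom V x (nat_ob V K F G) \<and>
    (\<forall>k\<in>vobj K. nat_proj V K F G k \<cdot> end_lift V K F G x d = d k)"
proof -
  have "\<exists>!f. f \<in> hom V x (nat_ob V K F G) \<and> (\<forall>k\<in>vobj K. nat_proj V K F G k \<cdot> f = d k)"
    using is_end_chosen[OF assms(1)] assms(2) unfolding is_end_def by blast
  then show ?thesis unfolding end_lift_def by (rule theI')
qed

lemma end_lift_ar:
  assumes "has_end V K F G" "is_wedge V K F G x d"
  shows "end_lift V K F G x d \<in> Ar V" "Dom V (end_lift V K F G x d) = x" "Cod V (end_lift V K F G x d) = nat_ob V K F G"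
  using end_lift_spec[OF assms] by (auto simp: hom_def)

lemma nat_proj_end_lift:
  assumes "has_end V K F G" "is_wedge V K F G x d" "k \<in> vobj K" "e \<in> El x"
  shows "act (nat_proj V K F G k) (act (end_lift V K F G x d) e) = act (d k) e"
proof -
  have "act (nat_proj V K F G k \<cdot> end_lift V K F G x d) e = act (d k) e"
    using end_lift_spec[OF assms(1,2)] assms(3) by simp
  then show ?thesis
    using end_lift_ar[OF assms(1,2)] nat_proj_ar[OF assms(1,3)] assms(4) by simp
qed

text \<open>Lets a factorization be recognized by exhibiting it: a family that factors through the
  end is a wedge automatically.\<close>

lemma end_lift_eqI:
  assumes "vcategory V K" "vfunctor V K (vself V) F" "vfunctor V K (vself V) G" "has_end V K F G"
    and f: "f \<in> hom V x (nat_ob V K F G)" and d: "\<And>k. k \<in> vobj K \<Longrightarrow> d k = nat_proj V K F G k \<cdot> f"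
  shows "end_lift V K F G x d = f"
proof -
  have "is_wedge V K F G x d"
    by (rule is_wedge_cmp[OF assms(1-3) nat_proj_wedge[OF assms(4)] f d])
  then have "\<exists>!f. f \<in> hom V x (nat_ob V K F G) \<and> (\<forall>k\<in>vobj K. nat_proj V K F G k \<cdot> f = d k)"
    using is_end_chosen[OF assms(4)] unfolding is_end_def by blast
  then show ?thesis
    unfolding end_lift_def by (rule the1_equality) (use f d in auto)
qed

lemma nat_ob_ext:
  assumes K [simp]: "vcategory V K" and F: "vfunctor V K (vself V) F" and G: "vfunctor V K (vself V) G"
    and h: "has_end V K F G" and u: "u \<in> El (nat_ob V K F G)" and v: "v \<in> El (nat_ob V K F G)"
    and ne: "vobj K \<noteq> {}"
    and eq: "\<And>k. k \<in> vobj K \<Longrightarrow> act (nat_proj V K F G k) u = act (nat_proj V K F G k) v"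
  shows "u = v"
proof -
  note [simp] = vfunctor_simps[OF F, simplified] vfunctor_simps[OF G, simplified]
  note [simp] = nat_proj_ar[OF h] nat_ob_Ob[OF h]
  \<comment> \<open>Equal elements must have equal contexts, and this is read off from some
    component; it is here that nonemptiness enters.\<close>
  obtain k where "k \<in> vobj K" using ne by blast
  from arg_cong[OF eq[OF this], of fst] have f: "fst u = fst v" by simp
  note Eu = ElD[OF u] and Ev = ElD[OF v]
  note [simp] = Eu Ev
  let ?d = "\<lambda>k. nat_proj V K F G k \<cdot> snd u"
  have s: "\<And>k. k \<in> vobj K \<Longrightarrow> nat_proj V K F G k \<cdot> snd v = ?d k"
    using eq by (auto simp: act_def)
  have w: "is_wedge V K F G (ten (fst u)) ?d"
    by (rule is_wedge_cmp[OF K F G nat_proj_wedge[OF h]]) (simp_all add: hom_def)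
  have "\<exists>!f. f \<in> hom V (ten (fst u)) (nat_ob V K F G) \<and> (\<forall>k\<in>vobj K. nat_proj V K F G k \<cdot> f = ?d k)"
    using is_end_chosen[OF h] w unfolding is_end_def by blast
  moreover have "snd u \<in> hom V (ten (fst u)) (nat_ob V K F G)" "snd v \<in> hom V (ten (fst u)) (nat_ob V K F G)"
    using f by (simp_all add: hom_def)
  ultimately have "snd u = snd v" using s by blast
  with f show ?thesis by (simp add: prod_eq_iff)
qed

subsection \<open>Powers\<close>

text \<open>On elements this is f \<mapsto> (y \<mapsto> \<kappa>(y) \<circ> f), the comparison
  arrow induced by a prospective counit \<kappa>.\<close>

definition power_ar :: "('o, 'm, 'c) vcat \<Rightarrow> 'o \<Rightarrow> 'c \<Rightarrow> 'c \<Rightarrow> 'm \<Rightarrow> 'c \<Rightarrow> 'm" where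
  "power_ar C x c p \<kappa> b = curry_ar V (vhom C b p) x (vhom C b c)
     (vcomp C b p c \<cdot> ((\<kappa> \<boxtimes> Id V (vhom C b p)) \<cdot> sym V (vhom C b p) x))"

lemma power_ar_ar [simp]:
  assumes "vcategory V C" "x \<in> Ob V" "c \<in> vobj C" "p \<in> vobj C" "b \<in> vobj C" "\<kappa> \<in> hom V x (vhom C p c)"
  shows "power_ar C x c p \<kappa> b \<in> Ar V" "Dom V (power_ar C x c p \<kappa> b) = vhom C b p"
    "Cod V (power_ar C x c p \<kappa> b) = ihom V x (vhom C b c)"
  using assms by (simp_all add: power_ar_def hom_def)

lemma ap_power_ar [simp]:
  assumes "vcategory V C" "c \<in> vobj C" "p \<in> vobj C" "b \<in> vobj C" "\<kappa> \<in> hom V x (vhom C p c)"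
    "f \<in> El (vhom C b p)" "y \<in> El x" "disj f y" "disj y f"
  shows "ap x (vhom C b c) (act (power_ar C x c p \<kappa> b) f) y = cmp C b p c (act \<kappa> y) f"
  using assms El_Ob[OF assms(7)] by (simp add: power_ar_def hom_def)

text \<open>By Yoneda, a natural family \<phi> out of C(-, p) is determined by its value at the
  identity, and that value is the counit. So \<phi> can only be \<open>power_ar\<close>, and the
  existential over \<phi> becomes invertibility of explicit arrows.\<close>

lemma is_power_iff:
  assumes C [simp]: "vcategory V C"
  shows "is_power V C x c p \<kappa> \<longleftrightarrow> x \<in> Ob V \<and> c \<in> vobj C \<and> p \<in> vobj C \<and> \<kappa> \<in> hom V x (vhom C p c) \<and>
    (\<forall>b\<in>vobj C. iso V (power_ar C x c p \<kappa> b))"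
proof (cases "x \<in> Ob V \<and> c \<in> vobj C \<and> p \<in> vobj C")
  case False
  then show ?thesis by (auto simp: is_power_def)
next
  case True
  then have [simp]: "x \<in> Ob V" "c \<in> vobj C" "p \<in> vobj C" by auto
  let ?F = "hom_fun V (vop V C) p"
  let ?G = "vfcomp V (vop V C) (hom_fun V (vself V) x) (hom_fun V (vop V C) c)"
  have F: "vfunctor V (vop V C) (vself V) ?F" by simp
  have G: "vfunctor V (vop V C) (vself V) ?G"
    by (rule vfunctor_vfcomp[of _ "vself V"]) simp_all
  have C': "vcategory V (vop V C)" by simp
  show ?thesis
  proof
    assume "is_power V C x c p \<kappa>"
    then obtain \<phi> where n: "vnat_iso V (vop V C) (vself V) ?F ?G \<phi>"
      and \<kappa>: "\<kappa> = unname V x (vhom C p c) (unname V (vhom C p p) (ihom V x (vhom C p c)) (\<phi> p) \<cdot> vid C p)"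
      by (auto simp: is_power_def)
    define h where "h b = unname V (fobj ?F b) (fobj ?G b) (\<phi> b)" for b
    note h = viso_vselfE[OF C' F G n, folded h_def, simplified]
    have [simp]: "h b \<in> Ar V" "Dom V (h b) = vhom C b p" "Cod V (h b) = ihom V x (vhom C b c)" if "b \<in> vobj C" for b
      using h(1)[OF that] that by (simp_all add: hom_def)
    have \<kappa>': "\<kappa> = unname V x (vhom C p c) (h p \<cdot> vid C p)" unfolding \<kappa> h_def by simp
    have khom: "\<kappa> \<in> hom V x (vhom C p c)" unfolding \<kappa>' by (simp add: hom_def)
    have "power_ar C x c p \<kappa> b = h b" if [simp]: "b \<in> vobj C" for b
    proof (rule arrow_ext_ap[of _ "vhom C b p" x "vhom C b c"])
      fix f y assume [simp]: "f \<in> El (vhom C b p)" "y \<in> El x" "disj f y" "disj y f"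
      \<comment> \<open>Naturality along \<open>f\<close>, applied to the identity of p.\<close>
      have "act (h b) f = ap (ihom V x (vhom C p c)) (ihom V x (vhom C b c)) (act (fmap ?G p b) f) (act (h p) (idt C p))"
        using h(4)[of p b f "idt C p"] by simp
      then have "ap x (vhom C b c) (act (h b) f) y = cmp C b p c (ap x (vhom C p c) (act (h p) (idt C p)) y) f"
        by simp
      also have "ap x (vhom C p c) (act (h p) (idt C p)) y = act \<kappa> y" unfolding \<kappa>' by simp
      finally show "ap x (vhom C b c) (act (power_ar C x c p \<kappa> b) f) y = ap x (vhom C b c) (act (h b) f) y"
        using khom by simp
    qed (use khom in \<open>simp_all add: hom_def\<close>)
    then show "x \<in> Ob V \<and> c \<in> vobj C \<and> p \<in> vobj C \<and> \<kappa> \<in> hom V x (vhom C p c) \<and>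
      (\<forall>b\<in>vobj C. iso V (power_ar C x c p \<kappa> b))" using khom h(2) by simp
  next
    assume "x \<in> Ob V \<and> c \<in> vobj C \<and> p \<in> vobj C \<and> \<kappa> \<in> hom V x (vhom C p c) \<and>
      (\<forall>b\<in>vobj C. iso V (power_ar C x c p \<kappa> b))"
    then have khom: "\<kappa> \<in> hom V x (vhom C p c)" and i [simp]: "\<And>b. b \<in> vobj C \<Longrightarrow> iso V (power_ar C x c p \<kappa> b)" by auto
    note [simp] = khom
    have [simp]: "\<kappa> \<in> Ar V" "Dom V \<kappa> = x" "Cod V \<kappa> = vhom C p c" using khom by (auto simp: hom_def)
    let ?h = "power_ar C x c p \<kappa>"
    have "vnat_iso V (vop V C) (vself V) ?F ?G (\<lambda>a. name (fobj ?F a) (fobj ?G a) (?h a))"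
    proof (rule viso_vselfI[OF C' F G])
      fix a b t e assume "a \<in> vobj (vop V C)" "b \<in> vobj (vop V C)" "t \<in> El (vhom (vop V C) a b)"
        "e \<in> El (fobj ?F a)" and [simp]: "disj t e" "disj e t"
      then have [simp]: "a \<in> vobj C" "b \<in> vobj C" "t \<in> El (vhom C b a)" "e \<in> El (vhom C a p)" by simp_all
      show "act (?h b) (ap (fobj ?F a) (fobj ?F b) (act (fmap ?F a b) t) e) =
         ap (fobj ?G a) (fobj ?G b) (act (fmap ?G a b) t) (act (?h a) e)"
        by (rule ap_ext[of _ x "vhom C b c"]) simp_all
    qed (simp_all add: hom_def)
    moreover have "\<kappa> = unname V x (vhom C p c) (unname V (vhom C p p) (ihom V x (vhom C p c)) (name (fobj ?F p) (fobj ?G p) (?h p)) \<cdot> vid C p)"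
      by (rule arrow_ext[of _ x "vhom C p c"]) (simp_all add: hom_def)
    ultimately show "is_power V C x c p \<kappa>" unfolding is_power_def by auto
  qed
qed


section \<open>Powers in \<open>V\<close> itself, where one arrow decides\<close>

definition point_power_ar :: "'o \<Rightarrow> 'o \<Rightarrow> 'o \<Rightarrow> 'm \<Rightarrow> 'm" where
  "point_power_ar x a p \<kappa> = curry_ar V p x a (ev V p a \<cdot> ((\<kappa> \<boxtimes> Id V p) \<cdot> sym V p x))"

lemma point_power_ar_ar [simp]:
  assumes "x \<in> Ob V" "a \<in> Ob V" "p \<in> Ob V" "\<kappa> \<in> hom V x (ihom V p a)"
  shows "point_power_ar x a p \<kappa> \<in> Ar V" "Dom V (point_power_ar x a p \<kappa>) = p"
    "Cod V (point_power_ar x a p \<kappa>) = ihom V x a"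
  using assms by (simp_all add: point_power_ar_def hom_def)

lemma ap_point_power_ar [simp]:
  assumes "a \<in> Ob V" "\<kappa> \<in> hom V x (ihom V p a)" "f \<in> El p" "y \<in> El x" "disj f y" "disj y f"
  shows "ap x a (act (point_power_ar x a p \<kappa>) f) y = ap p a (act \<kappa> y) f"
  using assms El_Ob[OF assms(3)] El_Ob[OF assms(4)] by (simp add: point_power_ar_def hom_def)

text \<open>With \<Psi> the given isomorphism, the comparison at b is [b, p] \<cong> [b, [x, a]]
  \<cong> [x, [b, a]]: composition with \<Psi> followed by an exchange of arguments.\<close>

lemma is_power_vselfI:
  assumes [simp]: "x \<in> Ob V" "a \<in> Ob V" "p \<in> Ob V" and \<kappa> [simp]: "\<kappa> \<in> hom V x (ihom V p a)"
    and i [simp]: "iso V (point_power_ar x a p \<kappa>)"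
  shows "is_power V (vself V) x a p \<kappa>"
proof -
  have \<kappa>' [simp]: "\<kappa> \<in> Ar V" "Dom V \<kappa> = x" "Cod V \<kappa> = ihom V p a" using \<kappa> by (auto simp: hom_def)
  let ?\<Psi> = "point_power_ar x a p \<kappa>"
  have "iso V (power_ar (vself V) x a p \<kappa> b)" if [simp]: "b \<in> Ob V" for b
  proof -
    let ?W = "ihom V x (ihom V b a)"
    let ?P = "power_ar (vself V) x a p \<kappa> b"
    have P [simp]: "?P \<in> Ar V" "Dom V ?P = ihom V b p" "Cod V ?P = ?W"
      using power_ar_ar[of "vself V" x a p b \<kappa>] by simp_all
    have aP [simp]: "ap x (ihom V b a) (act ?P f) y = cmp (vself V) b p a (act \<kappa> y) f"
      if "f \<in> El (ihom V b p)" "y \<in> El x" "disj f y" "disj y f" for f y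
      using that ap_power_ar[of "vself V" a p b \<kappa> x f y] by simp
    \<comment> \<open>This is the exchange of arguments (w, e) \<mapsto> (y \<mapsto> w y e). The
      inverse \<open>?Q\<close> of the comparison then sends w to the map e \<mapsto> \<Psi>^-1 (m
      (w, e)).\<close>
    let ?m = "curry_ar V (?W \<otimes> b) x a (ev V b a \<cdot> (ev V x (ihom V b a) \<boxtimes> Id V b) \<cdot>
      inv (assoc V ?W x b) \<cdot> (Id V ?W \<boxtimes> sym V b x) \<cdot> assoc V ?W b x)"
    have m: "?m \<in> Ar V" "Dom V ?m = ?W \<otimes> b" "Cod V ?m = ihom V x a" by simp_all
    have am: "ap x a (act ?m (pr w e)) y = ap b a (ap x (ihom V b a) w y) e"
      if "w \<in> El ?W" "e \<in> El b" "y \<in> El x" "disj w e" "disj e w" "disj w y" "disj y w" "disj e y" "disj y e" for w e y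
      using that by simp
    define m where "m = ?m"
    note [simp] = m[folded m_def] am[folded m_def]
    let ?Q = "curry_ar V ?W b p (inv ?\<Psi> \<cdot> m)"
    show ?thesis
    proof (rule iso_elementsI(1)[of _ "ihom V b p" ?W ?Q])
      fix f assume [simp]: "f \<in> El (ihom V b p)"
      show "act ?Q (act ?P f) = f"
      proof (rule ap_ext[of _ b p])
        fix e assume [simp]: "e \<in> El b" "disj (act ?Q (act ?P f)) e" "disj e (act ?Q (act ?P f))"
        then have [simp]: "disj f e" "disj e f" by simp_all
        have "act m (pr (act ?P f) e) = act ?\<Psi> (ap b p f e)"
          by (rule ap_ext[of _ x a]) simp_all
        then show "ap b p (act ?Q (act ?P f)) e = ap b p f e" by simp
      qed simp_all
    next
      fix w assume [simp]: "w \<in> El ?W"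
      show "act ?P (act ?Q w) = w"
      proof (rule ap_ext[of _ x "ihom V b a"])
        fix y assume [simp]: "y \<in> El x" "disj (act ?P (act ?Q w)) y" "disj y (act ?P (act ?Q w))"
        then have [simp]: "disj w y" "disj y w" by simp_all
        show "ap x (ihom V b a) (act ?P (act ?Q w)) y = ap x (ihom V b a) w y"
        proof (rule ap_ext[of _ b a])
          fix e assume [simp]: "e \<in> El b" "disj (ap x (ihom V b a) w y) e" "disj e (ap x (ihom V b a) w y)"
          then have [simp]: "disj w e" "disj e w" "disj y e" "disj e y" by simp_all
          have "ap b a (ap x (ihom V b a) (act ?P (act ?Q w)) y) e = ap p a (act \<kappa> y) (act (inv ?\<Psi>) (act m (pr w e)))"
            by simp
          also have "\<dots> = ap x a (act ?\<Psi> (act (inv ?\<Psi>) (act m (pr w e)))) y"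
            by (rule ap_point_power_ar[symmetric]) simp_all
          also have "\<dots> = ap b a (ap x (ihom V b a) w y) e" by simp
          finally show "ap b a (ap x (ihom V b a) (act ?P (act ?Q w)) y) e = ap b a (ap x (ihom V b a) w y) e" .
        qed simp_all
      qed simp_all
    qed (simp_all add: hom_def)
  qed
  then show ?thesis by (simp add: is_power_iff)
qed

text \<open>Up to an exchange of arguments the comparison arrows are composition with \<Psi>, so
  their invertibility for all b forces that of \<Psi> by Yoneda.\<close>

lemma is_power_vselfD:
  assumes "is_power V (vself V) x a p \<kappa>"
  shows "iso V (point_power_ar x a p \<kappa>)"
proof -
  have [simp]: "x \<in> Ob V" "a \<in> Ob V" "p \<in> Ob V" and \<kappa> [simp]: "\<kappa> \<in> hom V x (ihom V p a)"
    and iP [simp]: "\<And>b. b \<in> Ob V \<Longrightarrow> iso V (power_ar (vself V) x a p \<kappa> b)"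
    using assms by (simp_all add: is_power_iff)
  have \<kappa>' [simp]: "\<kappa> \<in> Ar V" "Dom V \<kappa> = x" "Cod V \<kappa> = ihom V p a" using \<kappa> by (auto simp: hom_def)
  let ?\<Psi> = "point_power_ar x a p \<kappa>" and ?P = "power_ar (vself V) x a p \<kappa>" and ?v = "ihom V x a"
  have P [simp]: "?P b \<in> Ar V" "Dom V (?P b) = ihom V b p" "Cod V (?P b) = ihom V x (ihom V b a)"
    if "b \<in> Ob V" for b
    using that power_ar_ar[of "vself V" x a p b \<kappa>] by simp_all
  have aP [simp]: "ap x (ihom V b a) (act (?P b) f) y = cmp (vself V) b p a (act \<kappa> y) f"
    if "f \<in> El (ihom V b p)" "y \<in> El x" "disj f y" "disj y f" "b \<in> Ob V" for f y b
    using that ap_power_ar[of "vself V" a p b \<kappa> x f y] by simp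
  \<comment> \<open>Yoneda: the inverse corresponds to the evaluation \<open>x \<rightarrow> [[x, a], a]\<close> under the
    isomorphism \<open>[[x, a], p] \<rightarrow> [x, [[x, a], a]]\<close>.\<close>
  let ?e = "curry_ar V x ?v a (ev V x a \<cdot> sym V x ?v)"
  let ?N = "inv (?P ?v) \<cdot> name x (ihom V ?v a) ?e"
  let ?G = "unname V ?v p ?N"
  have G: "ap p a (act \<kappa> y) (act ?G w) = ap x a w y"
    if [simp]: "w \<in> El ?v" "y \<in> El x" "disj w y" "disj y w" for w y
  proof -
    have "cmp (vself V) ?v p a (act \<kappa> y) (act ?N star) = ap x (ihom V ?v a) (act (?P ?v) (act ?N star)) y"
      by (rule aP[symmetric]) simp_all
    also have "\<dots> = act ?e y" by simp
    finally have "ap ?v a (cmp (vself V) ?v p a (act \<kappa> y) (act ?N star)) w = ap ?v a (act ?e y) w" by simp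
    then show ?thesis by simp
  qed
  have [simp]: "?G \<in> Ar V" "Dom V ?G = ?v" "Cod V ?G = p" by simp_all
  define G where "G = ?G"
  note G = G[folded G_def]
  have [simp]: "G \<in> Ar V" "Dom V G = ?v" "Cod V G = p" by (simp_all add: G_def)
  show ?thesis
  proof (rule iso_elementsI(1)[of _ p ?v G])
    show "act ?\<Psi> (act G w) = w" if [simp]: "w \<in> El ?v" for w
      by (rule ap_ext[of _ x a]) (simp_all add: G)
  next
    fix f assume [simp]: "f \<in> El p"
    \<comment> \<open>The other composite is compared with the identity of p after applying
      \<open>?P p\<close>, which is injective on elements because it is invertible.\<close>
    have "act (?P p) (act (name p p (G \<cdot> ?\<Psi>)) star) = act (?P p) (idt (vself V) p)"
    proof (rule ap_ext[of _ x "ihom V p a"])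
      fix y assume [simp]: "y \<in> El x"
      show "ap x (ihom V p a) (act (?P p) (act (name p p (G \<cdot> ?\<Psi>)) star)) y =
          ap x (ihom V p a) (act (?P p) (idt (vself V) p)) y"
        by (rule ap_ext[of _ p a]) (simp_all add: G)
    qed simp_all
    then have "act (inv (?P p)) (act (?P p) (act (name p p (G \<cdot> ?\<Psi>)) star)) =
        act (inv (?P p)) (act (?P p) (idt (vself V) p))" by simp
    then have "act (name p p (G \<cdot> ?\<Psi>)) star = idt (vself V) p"
      by simp
    then have "ap p p (act (name p p (G \<cdot> ?\<Psi>)) star) f = ap p p (idt (vself V) p) f" by simp
    then show "act G (act ?\<Psi> f) = f" by simp
  qed (simp_all add: hom_def)
qed

text \<open>The pointwise comparison arrow of C(b, -) coincides with \<open>power_ar\<close> at b,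
  so preservation is the component at b of the power property.\<close>

lemma hom_fun_preserves_power:
  assumes C [simp]: "vcategory V C" and b [simp]: "b \<in> vobj C" and "is_power V C x c p \<kappa>"
  shows "is_power V (vself V) x (vhom C b c) (vhom C b p) (fmap (hom_fun V C b) p c \<cdot> \<kappa>)"
proof -
  have [simp]: "x \<in> Ob V" "c \<in> vobj C" "p \<in> vobj C" and k [simp]: "\<kappa> \<in> hom V x (vhom C p c)"
    and i: "iso V (power_ar C x c p \<kappa> b)"
    using assms by (auto simp: is_power_iff)
  have [simp]: "\<kappa> \<in> Ar V" "Dom V \<kappa> = x" "Cod V \<kappa> = vhom C p c" using k by (auto simp: hom_def)
  let ?k = "fmap (hom_fun V C b) p c \<cdot> \<kappa>"
  have k': "?k \<in> hom V x (ihom V (vhom C b p) (vhom C b c))" by (simp add: hom_def)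
  have "point_power_ar x (vhom C b c) (vhom C b p) ?k = power_ar C x c p \<kappa> b"
    by (rule arrow_ext_ap[of _ "vhom C b p" x "vhom C b c"]) (simp_all add: hom_def)
  then show ?thesis using is_power_vselfI[OF _ _ _ k'] i by simp
qed


section \<open>Adjunctions from universal arrows\<close>

lemma vfid_simps [simp]:
  "a \<in> vobj C \<Longrightarrow> fobj (vfid V C) a = a"
  "a \<in> vobj C \<Longrightarrow> b \<in> vobj C \<Longrightarrow> fmap (vfid V C) a b = Id V (vhom C a b)"
  by (simp_all add: vfid_def)

text \<open>A universal arrow for each object suffices, in the enriched sense that u \<mapsto> R u
  \<circ> \<eta> is invertible as an arrow of hom-objects. Functoriality of L, naturality of the
  counit and the first triangle equation are checked after applying R and precomposing with \<eta>,
  which is injective.\<close>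

lemma left_adjoint_if_universal:
  assumes A [simp]: "vcategory V A" and B [simp]: "vcategory V B" and R: "vfunctor V B A R"
    and l [simp]: "\<And>a. a \<in> vobj A \<Longrightarrow> l a \<in> vobj B"
    and \<eta>: "\<And>a. a \<in> vobj A \<Longrightarrow> \<eta> a \<in> hom V U (vhom A a (fobj R (l a)))"
    and \<Phi>: "\<And>a b. a \<in> vobj A \<Longrightarrow> b \<in> vobj B \<Longrightarrow> \<Phi> a b \<in> hom V (vhom B (l a) b) (vhom A a (fobj R b))"
      "\<And>a b. a \<in> vobj A \<Longrightarrow> b \<in> vobj B \<Longrightarrow> iso V (\<Phi> a b)"
      "\<And>a b u. a \<in> vobj A \<Longrightarrow> b \<in> vobj B \<Longrightarrow> u \<in> El (vhom B (l a) b) \<Longrightarrow>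
        act (\<Phi> a b) u = cmp A a (fobj R (l a)) (fobj R b) (act (fmap R (l a) b) u) (act (\<eta> a) star)"
  shows "\<exists>L. left_adjoint V A B L R"
proof -
  let ?R = "fobj R"
  note [simp] = vfunctor_simps[OF R]
  have [simp]: "\<eta> a \<in> Ar V" "Dom V (\<eta> a) = U" "Cod V (\<eta> a) = vhom A a (?R (l a))" if "a \<in> vobj A" for a
    using \<eta>[OF that] by (auto simp: hom_def)
  have Phi_ar [simp]: "\<Phi> a b \<in> Ar V" "Dom V (\<Phi> a b) = vhom B (l a) b" "Cod V (\<Phi> a b) = vhom A a (?R b)"
    "iso V (\<Phi> a b)" if "a \<in> vobj A" "b \<in> vobj B" for a b
    using \<Phi>(1,2)[OF that] by (auto simp: hom_def)
  let ?e = "\<lambda>a. act (\<eta> a) star"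
  have inj: "u = v" if "cmp A a (?R (l a)) (?R b) (act (fmap R (l a) b) u) (?e a) =
      cmp A a (?R (l a)) (?R b) (act (fmap R (l a) b) v) (?e a)"
    "a \<in> vobj A" "b \<in> vobj B" "u \<in> El (vhom B (l a) b)" "v \<in> El (vhom B (l a) b)" for a b u v
  proof -
    have "act (inv (\<Phi> a b)) (act (\<Phi> a b) u) = act (inv (\<Phi> a b)) (act (\<Phi> a b) v)"
      using that \<Phi>(3) by simp
    then show ?thesis using that by simp
  qed
  have inv: "cmp A a (?R (l a)) (?R b) (act (fmap R (l a) b) (act (inv (\<Phi> a b)) w)) (?e a) = w"
    if "a \<in> vobj A" "b \<in> vobj B" "w \<in> El (vhom A a (?R b))" for a b w
    using \<Phi>(3)[OF that(1,2), of "act (inv (\<Phi> a b)) w"] that by simp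
  \<comment> \<open>K is g \<mapsto> \<eta> \<circ> g, and \<Lambda> is its transpose under \<Phi>:
    L g is the unique arrow with R (L g) \<circ> \<eta> = \<eta> \<circ> g.\<close>
  define K where "K a a' = vcomp A a a' (?R (l a')) \<cdot> ((\<eta> a' \<boxtimes> Id V (vhom A a a')) \<cdot> inv (lunit V (vhom A a a')))" for a a'
  have [simp]: "K a a' \<in> Ar V" "Dom V (K a a') = vhom A a a'" "Cod V (K a a') = vhom A a (?R (l a'))"
    if "a \<in> vobj A" "a' \<in> vobj A" for a a'
    using that by (simp_all add: K_def)
  have K [simp]: "act (K a a') g = cmp A a a' (?R (l a')) (?e a') g" if "a \<in> vobj A" "a' \<in> vobj A" "g \<in> El (vhom A a a')" for a a' g
    using that by (simp add: K_def)
  define \<Lambda> where "\<Lambda> a a' = inv (\<Phi> a (l a')) \<cdot> K a a'" for a a'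
  have [simp]: "\<Lambda> a a' \<in> Ar V" "Dom V (\<Lambda> a a') = vhom A a a'" "Cod V (\<Lambda> a a') = vhom B (l a) (l a')"
    if "a \<in> vobj A" "a' \<in> vobj A" for a a'
    using that by (simp_all add: \<Lambda>_def)
  have \<Lambda> [simp]: "cmp A a (?R (l a)) (?R (l a')) (act (fmap R (l a) (l a')) (act (\<Lambda> a a') g)) (?e a) =
      cmp A a a' (?R (l a')) (?e a') g"
    if "a \<in> vobj A" "a' \<in> vobj A" "g \<in> El (vhom A a a')" for a a' g
    using that by (simp add: \<Lambda>_def inv)
  \<comment> \<open>The same equation with a tail f, because the simplifier nests composites to the
    right; \<open>\<epsilon>2\<close> does this for the counit.\<close>
  have \<Lambda>2 [simp]: "cmp A c (?R (l a)) (?R (l a')) (act (fmap R (l a) (l a')) (act (\<Lambda> a a') g))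
        (cmp A c a (?R (l a)) (?e a) f) =
      cmp A c a' (?R (l a')) (?e a') (cmp A c a a' g f)"
    if "a \<in> vobj A" "a' \<in> vobj A" "c \<in> vobj A" "g \<in> El (vhom A a a')" "f \<in> El (vhom A c a)" "disj g f" for a a' c g f
  proof -
    have "cmp A c (?R (l a)) (?R (l a')) (act (fmap R (l a) (l a')) (act (\<Lambda> a a') g))
        (cmp A c a (?R (l a)) (?e a) f) =
      cmp A c a (?R (l a')) (cmp A a (?R (l a)) (?R (l a')) (act (fmap R (l a) (l a')) (act (\<Lambda> a a') g)) (?e a)) f"
      by (rule vcategory_assoc[symmetric]) (use that in simp_all)
    also have "\<dots> = cmp A c a (?R (l a')) (cmp A a a' (?R (l a')) (?e a') g) f"
      using that by (subst \<Lambda>) simp_all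
    also have "\<dots> = cmp A c a' (?R (l a')) (?e a') (cmp A c a a' g f)"
      by (rule vcategory_assoc) (use that in simp_all)
    finally show ?thesis .
  qed
  let ?L = "mk_vfun (vobj A) l \<Lambda>"
  have L: "vfunctor V A B ?L"
  proof (rule vfunctor_mk)
    fix a assume [simp]: "a \<in> vobj A"
    show "act (\<Lambda> a a) (idt A a) = idt B (l a)"
      by (rule inj[of a "l a"]) simp_all
  next
    fix a b c u v assume [simp]: "a \<in> vobj A" "b \<in> vobj A" "c \<in> vobj A" "u \<in> El (vhom A b c)" "v \<in> El (vhom A a b)"
      "disj u v" "disj v u"
    show "act (\<Lambda> a c) (cmp A a b c u v) = cmp B (l a) (l b) (l c) (act (\<Lambda> b c) u) (act (\<Lambda> a b) v)"
      by (rule inj[of a "l c"]) simp_all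
  qed (simp_all add: hom_def)
  note [simp] = vfunctor_simps[OF L]
  \<comment> \<open>The counit at b corresponds under \<Phi> to the identity of R b.\<close>
  define \<epsilon> where "\<epsilon> b = inv (\<Phi> (?R b) b) \<cdot> vid A (?R b)" for b
  have [simp]: "\<epsilon> b \<in> Ar V" "Dom V (\<epsilon> b) = U" "Cod V (\<epsilon> b) = vhom B (l (?R b)) b" if "b \<in> vobj B" for b
    using that by (simp_all add: \<epsilon>_def)
  let ?c = "\<lambda>b. act (\<epsilon> b) star"
  have \<epsilon> [simp]: "cmp A (?R b) (?R (l (?R b))) (?R b) (act (fmap R (l (?R b)) b) (?c b)) (?e (?R b)) =
      idt A (?R b)" if "b \<in> vobj B" for b
    using that by (simp add: \<epsilon>_def inv)
  have \<epsilon>2 [simp]: "cmp A c (?R (l (?R b))) (?R b) (act (fmap R (l (?R b)) b) (?c b))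
      (cmp A c (?R b) (?R (l (?R b))) (?e (?R b)) f) = f"
    if "b \<in> vobj B" "c \<in> vobj A" "f \<in> El (vhom A c (?R b))" for b c f
  proof -
    have "cmp A c (?R (l (?R b))) (?R b) (act (fmap R (l (?R b)) b) (?c b))
        (cmp A c (?R b) (?R (l (?R b))) (?e (?R b)) f) =
      cmp A c (?R b) (?R b) (cmp A (?R b) (?R (l (?R b))) (?R b) (act (fmap R (l (?R b)) b) (?c b)) (?e (?R b))) f"
      by (rule vcategory_assoc[symmetric]) (use that in simp_all)
    also have "\<dots> = f" using that by (subst \<epsilon>) simp_all
    finally show ?thesis .
  qed
  have n1: "vnat V A A (vfid V A) (vfcomp V A R ?L) \<eta>"
    by (subst vnat_iff) (simp_all add: hom_def)
  have n2: "vnat V B B (vfcomp V B ?L R) (vfid V B) \<epsilon>"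
  proof (subst vnat_iff)
    have "cmp B (l (?R a)) (l (?R b)) b (?c b) (act (\<Lambda> (?R a) (?R b)) (act (fmap R a b) t)) =
        cmp B (l (?R a)) a b t (?c a)"
      if [simp]: "a \<in> vobj B" "b \<in> vobj B" "t \<in> El (vhom B a b)" for a b t
      by (rule inj[of "?R a" b]) simp_all
    then show "(\<forall>a\<in>vobj B. \<epsilon> a \<in> hom V U (vhom B (fobj (vfcomp V B ?L R) a) (fobj (vfid V B) a))) \<and>
       (\<forall>a\<in>vobj B. \<forall>b\<in>vobj B. \<forall>t\<in>El (vhom B a b).
          cmp B (fobj (vfcomp V B ?L R) a) (fobj (vfcomp V B ?L R) b) (fobj (vfid V B) b) (?c b)
            (act (fmap (vfcomp V B ?L R) a b) t) =
          cmp B (fobj (vfcomp V B ?L R) a) (fobj (vfid V B) a) (fobj (vfid V B) b)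
            (act (fmap (vfid V B) a b) t) (?c a))"
      by (simp add: hom_def)
  qed (simp_all add: hom_def)
  have t1: "ucomp V B (l a) (l (?R (l a))) (l a) (\<epsilon> (l a)) (\<Lambda> a (?R (l a)) \<cdot> \<eta> a) = vid B (l a)"
    if [simp]: "a \<in> vobj A" for a
  proof (subst ucomp_eq_iff)
    show "cmp B (l a) (l (?R (l a))) (l a) (?c (l a)) (act (\<Lambda> a (?R (l a)) \<cdot> \<eta> a) star) = idt B (l a)"
      by (rule inj[of a "l a"]) simp_all
  qed (simp_all add: hom_def)
  have t2: "ucomp V A (?R b) (?R (l (?R b))) (?R b) (fmap R (l (?R b)) b \<cdot> \<epsilon> b) (\<eta> (?R b)) = vid A (?R b)"
    if [simp]: "b \<in> vobj B" for b
    by (subst ucomp_eq_iff) (simp_all add: hom_def)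
  have "left_adjoint V A B ?L R"
    unfolding left_adjoint_def
    by (intro conjI exI[of _ \<eta>] exI[of _ \<epsilon>] L R n1 n2) (simp_all add: t1 t2)
  then show ?thesis by blast
qed

text \<open>The adjunction read on elements: the unit constraints hidden in \<open>vnat\<close> and
  \<open>ucomp\<close> disappear from naturality and the triangle equations.\<close>

lemma left_adjointE:
  assumes A [simp]: "vcategory V A" and B [simp]: "vcategory V B" and adj: "left_adjoint V A B L R"
  obtains \<eta> \<epsilon> where "vfunctor V A B L" "vfunctor V B A R"
    "\<And>a. a \<in> vobj A \<Longrightarrow> \<eta> a \<in> hom V U (vhom A a (fobj R (fobj L a)))"
    "\<And>b. b \<in> vobj B \<Longrightarrow> \<epsilon> b \<in> hom V U (vhom B (fobj L (fobj R b)) b)"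
    "\<And>a b t. a \<in> vobj A \<Longrightarrow> b \<in> vobj A \<Longrightarrow> t \<in> El (vhom A a b) \<Longrightarrow>
      cmp A a b (fobj R (fobj L b)) (act (\<eta> b) star) t =
      cmp A a (fobj R (fobj L a)) (fobj R (fobj L b)) (act (fmap R (fobj L a) (fobj L b)) (act (fmap L a b) t)) (act (\<eta> a) star)"
    "\<And>a b t. a \<in> vobj B \<Longrightarrow> b \<in> vobj B \<Longrightarrow> t \<in> El (vhom B a b) \<Longrightarrow>
      cmp B (fobj L (fobj R a)) (fobj L (fobj R b)) b (act (\<epsilon> b) star) (act (fmap L (fobj R a) (fobj R b)) (act (fmap R a b) t)) =
      cmp B (fobj L (fobj R a)) a b t (act (\<epsilon> a) star)"
    "\<And>a. a \<in> vobj A \<Longrightarrow> cmp B (fobj L a) (fobj L (fobj R (fobj L a))) (fobj L a) (act (\<epsilon> (fobj L a)) star)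
      (act (fmap L a (fobj R (fobj L a))) (act (\<eta> a) star)) = idt B (fobj L a)"
    "\<And>b. b \<in> vobj B \<Longrightarrow> cmp A (fobj R b) (fobj R (fobj L (fobj R b))) (fobj R b)
      (act (fmap R (fobj L (fobj R b)) b) (act (\<epsilon> b) star)) (act (\<eta> (fobj R b)) star) = idt A (fobj R b)"
proof -
  let ?R = "fobj R" and ?L = "fobj L"
  from adj obtain \<eta> \<epsilon> where L: "vfunctor V A B L" and R: "vfunctor V B A R"
    and n: "vnat V A A (vfid V A) (vfcomp V A R L) \<eta>" "vnat V B B (vfcomp V B L R) (vfid V B) \<epsilon>"
    and t1: "\<And>a. a \<in> vobj A \<Longrightarrow> ucomp V B (?L a) (?L (?R (?L a))) (?L a) (\<epsilon> (?L a))
       (fmap L a (?R (?L a)) \<cdot> \<eta> a) = vid B (?L a)"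
    and t2: "\<And>b. b \<in> vobj B \<Longrightarrow> ucomp V A (?R b) (?R (?L (?R b))) (?R b)
       (fmap R (?L (?R b)) b \<cdot> \<epsilon> b) (\<eta> (?R b)) = vid A (?R b)"
    unfolding left_adjoint_def Let_def by blast
  note [simp] = vfunctor_simps[OF L] vfunctor_simps[OF R]
  have \<eta>: "(\<forall>a\<in>vobj A. \<eta> a \<in> hom V U (vhom A a (?R (?L a)))) \<and>
    (\<forall>a\<in>vobj A. \<forall>b\<in>vobj A. \<forall>t\<in>El (vhom A a b).
      cmp A a b (?R (?L b)) (act (\<eta> b) star) t =
      cmp A a (?R (?L a)) (?R (?L b)) (act (fmap R (?L a) (?L b)) (act (fmap L a b) t)) (act (\<eta> a) star))"
    using n(1) by (subst (asm) vnat_iff) (simp_all add: hom_def)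
  have \<epsilon>: "(\<forall>a\<in>vobj B. \<epsilon> a \<in> hom V U (vhom B (?L (?R a)) a)) \<and>
    (\<forall>a\<in>vobj B. \<forall>b\<in>vobj B. \<forall>t\<in>El (vhom B a b).
      cmp B (?L (?R a)) (?L (?R b)) b (act (\<epsilon> b) star) (act (fmap L (?R a) (?R b)) (act (fmap R a b) t)) =
      cmp B (?L (?R a)) a b t (act (\<epsilon> a) star))"
    using n(2) by (subst (asm) vnat_iff) (simp_all add: hom_def)
  have [simp]: "\<eta> a \<in> Ar V" "Dom V (\<eta> a) = U" "Cod V (\<eta> a) = vhom A a (?R (?L a))" if "a \<in> vobj A" for a
    using \<eta> that by (auto simp: hom_def)
  have [simp]: "\<epsilon> a \<in> Ar V" "Dom V (\<epsilon> a) = U" "Cod V (\<epsilon> a) = vhom B (?L (?R a)) a" if "a \<in> vobj B" for a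
    using \<epsilon> that by (auto simp: hom_def)
  have t1': "cmp B (?L a) (?L (?R (?L a))) (?L a) (act (\<epsilon> (?L a)) star)
      (act (fmap L a (?R (?L a))) (act (\<eta> a) star)) = idt B (?L a)" if "a \<in> vobj A" for a
    using t1[OF that] that by (subst (asm) ucomp_eq_iff) (simp_all add: hom_def)
  have t2': "cmp A (?R b) (?R (?L (?R b))) (?R b)
      (act (fmap R (?L (?R b)) b) (act (\<epsilon> b) star)) (act (\<eta> (?R b)) star) = idt A (?R b)" if "b \<in> vobj B" for b
    using t2[OF that] that by (subst (asm) ucomp_eq_iff) (simp_all add: hom_def)
  show ?thesis
    by (rule that[OF L R]) (use \<eta> \<epsilon> t1' t2' in blast)+
qed

end

section \<open>Theories and their algebras\<close>

locale arity_theory = symmetric_monoidal_closed V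
  for V :: "('o, 'm) smc" (structure) and J :: "'o set" and T :: "('o, 'm, 'o) vcat" +
  fixes \<tau> :: "('m, 'o, 'o) vfun"
  assumes arities_J: "system_of_arities V J" and amenable_J: "amenable V J" and theory_T: "is_theory V J T \<tau>"
begin

abbreviation alg where "alg \<equiv> is_algebra V J T (vself V)"
abbreviation Alg where "Alg \<equiv> alg_cat V J T"
abbreviation proj where "proj \<equiv> nat_proj V T"

lemma T_simps [simp]: "vcategory V T" "vobj T = J"
  using theory_T by (auto simp: is_theory_def)

lemma unit_J [simp]: "U \<in> J"
  using arities_J by (simp add: system_of_arities_def)

lemma Alg_simps [simp]: "A \<in> vobj Alg \<longleftrightarrow> alg A"
  "vhom Alg = nat_ob V T"
  by (simp_all add: alg_cat_def full_sub_def fun_cat_def)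

lemma algebra_vfunctor [simp]: "is_algebra V J T C A \<Longrightarrow> vfunctor V T C A"
  by (simp add: is_algebra_def)

lemma algebra_ar [simp]:
  assumes "alg A"
  shows "j \<in> J \<Longrightarrow> fobj A j \<in> Ob V"
    "i \<in> J \<Longrightarrow> j \<in> J \<Longrightarrow> fmap A i j \<in> Ar V"
    "i \<in> J \<Longrightarrow> j \<in> J \<Longrightarrow> Dom V (fmap A i j) = vhom T i j"
    "i \<in> J \<Longrightarrow> j \<in> J \<Longrightarrow> Cod V (fmap A i j) = ihom V (fobj A i) (fobj A j)"
  using vfunctorD[OF algebra_vfunctor[OF assms]] by simp_all

lemma algebra_cmp [simp]:
  assumes "alg A" "i \<in> J" "j \<in> J" "k \<in> J" "g \<in> El (vhom T j k)" "f \<in> El (vhom T i j)"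
    "e \<in> El (fobj A i)" "disj g f" "disj g e" "disj f e"
  shows "ap (fobj A i) (fobj A k) (act (fmap A i k) (cmp T i j k g f)) e =
    ap (fobj A j) (fobj A k) (act (fmap A j k) g) (ap (fobj A i) (fobj A j) (act (fmap A i j) f) e)"
  using vfunctor_cmp[OF algebra_vfunctor[OF assms(1)], of i j k g f] assms by simp

lemma algebra_idt [simp]:
  assumes "alg A" "j \<in> J" "e \<in> El (fobj A j)"
  shows "ap (fobj A j) (fobj A j) (act (fmap A j j) (idt T j)) e = e"
  using vfunctor_idt[OF algebra_vfunctor[OF assms(1)], of j] assms by simp

text \<open>Amenability supplies ends for pairs of algebras; the hom-objects below rest on
  this.\<close>

lemma algebra_has_end [simp]:
  "alg A \<Longrightarrow> alg B \<Longrightarrow> has_end V T A B"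
  using amenable_J theory_T unfolding amenable_def by blast

lemma proj_ar [simp]:
  assumes "alg A" "alg B"
  shows "nat_ob V T A B \<in> Ob V"
    "k \<in> J \<Longrightarrow> proj A B k \<in> Ar V" "k \<in> J \<Longrightarrow> Dom V (proj A B k) = nat_ob V T A B"
    "k \<in> J \<Longrightarrow> Cod V (proj A B k) = ihom V (fobj A k) (fobj B k)"
  using nat_proj_ar[OF algebra_has_end[OF assms]] nat_ob_Ob[OF algebra_has_end[OF assms]] by simp_all

lemma proj_natural:
  assumes "alg A" "alg B" "k \<in> J" "l \<in> J"
    "u \<in> El (nat_ob V T A B)" "t \<in> El (vhom T k l)" "w \<in> El (fobj A k)" "disj u t" "disj u w" "disj t w"
  shows "ap (fobj A l) (fobj B l) (act (proj A B l) u) (ap (fobj A k) (fobj A l) (act (fmap A k l) t) w) =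
    ap (fobj B k) (fobj B l) (act (fmap B k l) t) (ap (fobj A k) (fobj B k) (act (proj A B k) u) w)"
  by (rule is_wedgeD(3)[symmetric, OF _ _ _ nat_proj_wedge]) (use assms in simp_all)

text \<open>The projections of the end reduce a comparison of transformations to components, and
  \<open>ap_ext\<close> reduces components to points.\<close>

lemma Alg_ext:
  assumes "alg A" "alg B"
    "u \<in> El (nat_ob V T A B)" "v \<in> El (nat_ob V T A B)"
    and eq: "\<And>k w. k \<in> J \<Longrightarrow> w \<in> El (fobj A k) \<Longrightarrow> disj u w \<Longrightarrow> disj w u \<Longrightarrow> disj v w \<Longrightarrow> disj w v \<Longrightarrow>
      ap (fobj A k) (fobj B k) (act (proj A B k) u) w = ap (fobj A k) (fobj B k) (act (proj A B k) v) w"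
  shows "u = v"
proof (rule nat_ob_ext[of T A B])
  show "vobj T \<noteq> {}" using unit_J unfolding T_simps by blast
  show "act (proj A B k) u = act (proj A B k) v" if "k \<in> vobj T" for k
    by (rule ap_ext[of _ "fobj A k" "fobj B k"]) (use assms that in simp_all)
qed (use assms in simp_all)

lemma Alg_lift:
  assumes "alg A" "alg B" "x \<in> Ob V"
    "\<And>k. k \<in> J \<Longrightarrow> d k \<in> hom V x (ihom V (fobj A k) (fobj B k))"
    "\<And>k l u t w. k \<in> J \<Longrightarrow> l \<in> J \<Longrightarrow> u \<in> El x \<Longrightarrow> t \<in> El (vhom T k l) \<Longrightarrow> w \<in> El (fobj A k) \<Longrightarrow>
      disj u t \<Longrightarrow> disj t u \<Longrightarrow> disj u w \<Longrightarrow> disj w u \<Longrightarrow> disj t w \<Longrightarrow> disj w t \<Longrightarrow>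
      ap (fobj B k) (fobj B l) (act (fmap B k l) t) (ap (fobj A k) (fobj B k) (act (d k) u) w) =
      ap (fobj A l) (fobj B l) (act (d l) u) (ap (fobj A k) (fobj A l) (act (fmap A k l) t) w)"
  shows "end_lift V T A B x d \<in> Ar V" "Dom V (end_lift V T A B x d) = x"
    "Cod V (end_lift V T A B x d) = nat_ob V T A B"
    "k \<in> J \<Longrightarrow> u \<in> El x \<Longrightarrow> act (proj A B k) (act (end_lift V T A B x d) u) = act (d k) u"
proof -
  have w: "is_wedge V T A B x d"
    by (subst is_wedge_iff) (use assms in simp_all)
  note h = algebra_has_end[OF assms(1,2)]
  show "end_lift V T A B x d \<in> Ar V" "Dom V (end_lift V T A B x d) = x"
    "Cod V (end_lift V T A B x d) = nat_ob V T A B"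
    using end_lift_ar[OF h w] by auto
  show "k \<in> J \<Longrightarrow> u \<in> El x \<Longrightarrow> act (proj A B k) (act (end_lift V T A B x d) u) = act (d k) u"
    using nat_proj_end_lift[OF h w] by simp
qed

text \<open>Version of \<open>Alg_lift\<close> for arrows out of \<open>U\<close>, tested on
  \<open>star\<close>. It turns an ordinary natural family of arrows into an arrow of
  algebras.\<close>

lemma Alg_lift_unit:
  assumes "alg A" "alg B"
    "\<And>k. k \<in> J \<Longrightarrow> d k \<in> hom V U (ihom V (fobj A k) (fobj B k))"
    "\<And>k l t w. k \<in> J \<Longrightarrow> l \<in> J \<Longrightarrow> t \<in> El (vhom T k l) \<Longrightarrow> w \<in> El (fobj A k) \<Longrightarrow> disj t w \<Longrightarrow> disj w t \<Longrightarrow>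
      ap (fobj B k) (fobj B l) (act (fmap B k l) t) (ap (fobj A k) (fobj B k) (act (d k) star) w) =
      ap (fobj A l) (fobj B l) (act (d l) star) (ap (fobj A k) (fobj A l) (act (fmap A k l) t) w)"
  shows "end_lift V T A B U d \<in> Ar V" "Dom V (end_lift V T A B U d) = U"
    "Cod V (end_lift V T A B U d) = nat_ob V T A B"
    "k \<in> J \<Longrightarrow> act (proj A B k) (act (end_lift V T A B U d) star) = act (d k) star"
proof -
  have w: "is_wedge V T A B U d"
    by (rule is_wedge_unitI) (use assms in simp_all)
  note h = algebra_has_end[OF assms(1,2)]
  show "end_lift V T A B U d \<in> Ar V" "Dom V (end_lift V T A B U d) = U"
    "Cod V (end_lift V T A B U d) = nat_ob V T A B"
    using end_lift_ar[OF h w] by auto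
  show "k \<in> J \<Longrightarrow> act (proj A B k) (act (end_lift V T A B U d) star) = act (d k) star"
    using nat_proj_end_lift[OF h w] by simp
qed

lemma Alg_idt [simp]:
  assumes "alg A"
  shows "vid Alg A \<in> Ar V" "Dom V (vid Alg A) = U" "Cod V (vid Alg A) = nat_ob V T A A"
    "k \<in> J \<Longrightarrow> act (proj A A k) (idt Alg A) = idt (vself V) (fobj A k)"
proof -
  have e: "vid Alg A = end_lift V T A A U (\<lambda>k. vid (vself V) (fobj A k))"
    by (simp add: alg_cat_def full_sub_def fun_cat_def)
  have h: "vid (vself V) (fobj A k) \<in> hom V U (ihom V (fobj A k) (fobj A k))" if "k \<in> J" for k
    using assms that by (intro vself_ar) simp
  note L = Alg_lift_unit[OF assms assms, where d = "\<lambda>k. vid (vself V) (fobj A k)"]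
  show "vid Alg A \<in> Ar V" unfolding e by (rule L(1)) (use assms h in simp_all)
  show "Dom V (vid Alg A) = U" unfolding e by (rule L(2)) (use assms h in simp_all)
  show "Cod V (vid Alg A) = nat_ob V T A A" unfolding e by (rule L(3)) (use assms h in simp_all)
  show "act (proj A A k) (idt Alg A) = idt (vself V) (fobj A k)" if "k \<in> J"
    unfolding e by (rule L(4)) (use assms h that in simp_all)
qed

lemma Alg_cmp [simp]:
  assumes [simp]: "alg A" "alg B" "alg C"
  shows "vcomp Alg A B C \<in> Ar V" "Dom V (vcomp Alg A B C) = nat_ob V T B C \<otimes> nat_ob V T A B"
    "Cod V (vcomp Alg A B C) = nat_ob V T A C"
    "k \<in> J \<Longrightarrow> g \<in> El (nat_ob V T B C) \<Longrightarrow> f \<in> El (nat_ob V T A B) \<Longrightarrow> disj g f \<Longrightarrow>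
      act (proj A C k) (cmp Alg A B C g f) =
      cmp (vself V) (fobj A k) (fobj B k) (fobj C k) (act (proj B C k) g) (act (proj A B k) f)"
proof -
  let ?x = "nat_ob V T B C \<otimes> nat_ob V T A B"
  define d where "d = (\<lambda>k. vcomp (vself V) (fobj A k) (fobj B k) (fobj C k) \<cdot> (proj B C k \<boxtimes> proj A B k))"
  have e: "vcomp Alg A B C = end_lift V T A C ?x d"
    by (simp add: alg_cat_def full_sub_def fun_cat_def d_def)
  have d: "d k \<in> hom V ?x (ihom V (fobj A k) (fobj C k))" if "k \<in> J" for k
    using that by (simp add: d_def hom_def)
  have x: "?x \<in> Ob V" by simp
  have w: "is_wedge V T A C ?x d"
  proof -
    have d': "d k \<in> Ar V" "Dom V (d k) = ?x" "Cod V (d k) = ihom V (fobj A k) (fobj C k)" if "k \<in> J" for k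
      using d[OF that] by (auto simp: hom_def)
    \<comment> \<open>The source is a tensor product of hom-objects, so the wedge condition is
      tested on pairs: the formula \<open>dd\<close> for \<open>d\<close> applies to pairs, not to a
      single variable of product type.\<close>
    have ext: "f = g" if "f \<in> hom V (?x \<otimes> y) z" "g \<in> hom V (?x \<otimes> y) z" "y \<in> Ob V"
      "\<And>b a t. b \<in> El (nat_ob V T B C) \<Longrightarrow> a \<in> El (nat_ob V T A B) \<Longrightarrow> t \<in> El y \<Longrightarrow> disj b a \<Longrightarrow> disj a b \<Longrightarrow>
        disj b t \<Longrightarrow> disj t b \<Longrightarrow> disj a t \<Longrightarrow> disj t a \<Longrightarrow> act f (pr (pr b a) t) = act g (pr (pr b a) t)" for f g y z
      by (rule arrow_ext3[OF that(1,2)]) (use that(3,4) in simp_all)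
    show ?thesis
      unfolding is_wedge_def
    proof (intro conjI ballI)
      fix k l assume "k \<in> vobj T" "l \<in> vobj T"
      then have [simp]: "k \<in> J" "l \<in> J" by simp_all
      note [simp] = d'
      show "vcomp (vself V) (fobj A k) (fobj C k) (fobj C l) \<cdot> (fmap C k l \<boxtimes> d k) \<cdot> sym V ?x (vhom T k l) =
        vcomp (vself V) (fobj A k) (fobj A l) (fobj C l) \<cdot> (d l \<boxtimes> fmap A k l)"
      proof (rule ext[of _ _ "ihom V (fobj A k) (fobj C l)"])
        fix b a t assume [simp]: "b \<in> El (nat_ob V T B C)" "a \<in> El (nat_ob V T A B)" "t \<in> El (vhom T k l)"
          "disj b a" "disj a b" "disj b t" "disj t b" "disj a t" "disj t a"
        have dd: "act (d j) (pr b a) = cmp (vself V) (fobj A j) (fobj B j) (fobj C j) (act (proj B C j) b) (act (proj A B j) a)"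
          if "j \<in> J" for j using that by (simp add: d_def)
        have "cmp (vself V) (fobj A k) (fobj C k) (fobj C l) (act (fmap C k l) t) (act (d k) (pr b a)) =
            cmp (vself V) (fobj A k) (fobj A l) (fobj C l) (act (d l) (pr b a)) (act (fmap A k l) t)"
          by (rule ap_ext[of _ "fobj A k" "fobj C l"]) (simp_all add: dd proj_natural)
        then show "act (vcomp (vself V) (fobj A k) (fobj C k) (fobj C l) \<cdot> (fmap C k l \<boxtimes> d k) \<cdot> sym V ?x (vhom T k l)) (pr (pr b a) t) =
          act (vcomp (vself V) (fobj A k) (fobj A l) (fobj C l) \<cdot> (d l \<boxtimes> fmap A k l)) (pr (pr b a) t)"
          by simp
      qed (simp_all add: hom_def)
    qed (use d in simp_all)
  qed
  note h = algebra_has_end[OF assms(1,3)]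
  show "vcomp Alg A B C \<in> Ar V" "Dom V (vcomp Alg A B C) = ?x"
    "Cod V (vcomp Alg A B C) = nat_ob V T A C"
    unfolding e using end_lift_ar[OF h w] by auto
  show "k \<in> J \<Longrightarrow> g \<in> El (nat_ob V T B C) \<Longrightarrow> f \<in> El (nat_ob V T A B) \<Longrightarrow> disj g f \<Longrightarrow>
      act (proj A C k) (cmp Alg A B C g f) =
      cmp (vself V) (fobj A k) (fobj B k) (fobj C k) (act (proj B C k) g) (act (proj A B k) f)"
    unfolding e using nat_proj_end_lift[OF h w] by (simp add: d_def)
qed

text \<open>The laws are inherited from \<open>vself V\<close> at each object k of T, since
  \<open>Alg_ext\<close> compares pointwise.\<close>

lemma vcategory_Alg [simp]: "vcategory V Alg"
proof (rule vcategoryI)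
  fix A B C D f g h
  assume "A \<in> vobj Alg" "B \<in> vobj Alg" "C \<in> vobj Alg" "D \<in> vobj Alg"
    "h \<in> El (vhom Alg C D)" "g \<in> El (vhom Alg B C)" "f \<in> El (vhom Alg A B)"
    and [simp]: "disj h g" "disj g h" "disj h f" "disj f h" "disj g f" "disj f g"
  then have [simp]: "alg A" "alg B" "alg C"
    "alg D" "h \<in> El (nat_ob V T C D)" "g \<in> El (nat_ob V T B C)" "f \<in> El (nat_ob V T A B)"
    by simp_all
  show "cmp Alg A B D (cmp Alg B C D h g) f = cmp Alg A C D h (cmp Alg A B C g f)"
    by (rule Alg_ext[of A D]) simp_all
next
  fix A B f assume "A \<in> vobj Alg" "B \<in> vobj Alg" "f \<in> El (vhom Alg A B)"
  then have [simp]: "alg A" "alg B" "f \<in> El (nat_ob V T A B)"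
    by simp_all
  have "cmp Alg A B B (idt Alg B) f = f" by (rule Alg_ext[of A B]) simp_all
  moreover have "cmp Alg A A B f (idt Alg A) = f" by (rule Alg_ext[of A B]) simp_all
  ultimately show "cmp Alg A B B (idt Alg B) f = f \<and> cmp Alg A A B f (idt Alg A) = f" ..
qed (simp_all add: hom_def)


section \<open>Representable functors into the category of algebras\<close>


lemma algebraI:
  assumes "vfunctor V T C A"
    and "\<And>x c p \<kappa>. x \<in> J \<Longrightarrow> c \<in> J \<Longrightarrow> p \<in> J \<Longrightarrow> is_power V T x c p \<kappa> \<Longrightarrow> \<kappa> \<in> hom V x (vhom T p c) \<Longrightarrow>
      is_power V C x (fobj A c) (fobj A p) (fmap A p c \<cdot> \<kappa>)"
  shows "is_algebra V J T C A"
  unfolding is_algebra_def preserves_powers_def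
  using assms by (auto simp: is_power_iff)

text \<open>This places the Yoneda embedding among the algebras, where the hom-objects it needs
  exist.\<close>

lemma hom_fun_algebra [simp]: "j \<in> J \<Longrightarrow> alg (hom_fun V T j)"
  by (rule algebraI) (auto simp: hom_fun_preserves_power)

abbreviation hom_pt :: "('o, 'm, 'c) vcat \<Rightarrow> ('m, 'o, 'c) vfun \<Rightarrow> 'c \<Rightarrow> ('m, 'o, 'o) vfun" where
  "hom_pt C E b \<equiv> vfcomp V T (hom_fun V C b) E"

lemma hom_pt_algebra [simp]:
  assumes C [simp]: "vcategory V C" and E: "is_algebra V J T C E" and b [simp]: "b \<in> vobj C"
  shows "alg (hom_pt C E b)"
proof (rule algebraI)
  note E' = algebra_vfunctor[OF E]
  note [simp] = vfunctorD[OF E', simplified]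
  show "vfunctor V T (vself V) (hom_pt C E b)"
    by (rule vfunctor_vfcomp[OF _ C _ E']) simp_all
  fix x c p \<kappa> assume [simp]: "x \<in> J" "c \<in> J" "p \<in> J" and pow: "is_power V T x c p \<kappa>"
    and k: "\<kappa> \<in> hom V x (vhom T p c)"
  have "is_power V C x (fobj E c) (fobj E p) (fmap E p c \<cdot> \<kappa>)"
    using E pow by (auto simp: is_algebra_def preserves_powers_def)
  then have "is_power V (vself V) x (vhom C b (fobj E c)) (vhom C b (fobj E p))
      (fmap (hom_fun V C b) (fobj E p) (fobj E c) \<cdot> (fmap E p c \<cdot> \<kappa>))"
    by (rule hom_fun_preserves_power[OF C b])
  then show "is_power V (vself V) x (fobj (hom_pt C E b) c) (fobj (hom_pt C E b) p) (fmap (hom_pt C E b) p c \<cdot> \<kappa>)"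
    using k by (simp add: hom_def)
qed

text \<open>Precomposition is natural in k by associativity in C, and the source and target of the
  hom-object are algebras by \<open>hom_pt_algebra\<close>; so the lift that defines the action
  exists.\<close>

lemma bracket_ar:
  assumes C [simp]: "vcategory V C" and E [simp]: "is_algebra V J T C E" and [simp]: "c \<in> vobj C" "d \<in> vobj C"
  shows "fmap (bracket V T C E) c d \<in> Ar V" "Dom V (fmap (bracket V T C E) c d) = vhom C d c"
    "Cod V (fmap (bracket V T C E) c d) = nat_ob V T (hom_pt C E c) (hom_pt C E d)"
    "k \<in> J \<Longrightarrow> u \<in> El (vhom C d c) \<Longrightarrow> act (proj (hom_pt C E c) (hom_pt C E d) k) (act (fmap (bracket V T C E) c d) u) =
      act (fmap (hom_fun V (vop V C) (fobj E k)) c d) u"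
proof -
  note [simp] = vfunctorD[OF algebra_vfunctor[OF E], simplified]
  have e: "fmap (bracket V T C E) c d = end_lift V T (hom_pt C E c) (hom_pt C E d) (vhom C d c)
      (\<lambda>k. fmap (hom_fun V (vop V C) (fobj E k)) c d)"
    by (simp add: bracket_def)
  have h: "fmap (hom_fun V (vop V C) (fobj E k)) c d \<in> hom V (vhom C d c) (ihom V (fobj (hom_pt C E c) k) (fobj (hom_pt C E d) k))"
    if "k \<in> J" for k using that by (simp add: hom_def)
  note L = Alg_lift[of "hom_pt C E c" "hom_pt C E d" "vhom C d c" "\<lambda>k. fmap (hom_fun V (vop V C) (fobj E k)) c d"]
  show "fmap (bracket V T C E) c d \<in> Ar V" unfolding e by (rule L(1)) (simp_all add: hom_def)
  show "Dom V (fmap (bracket V T C E) c d) = vhom C d c" unfolding e by (rule L(2)) (simp_all add: hom_def)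
  show "Cod V (fmap (bracket V T C E) c d) = nat_ob V T (hom_pt C E c) (hom_pt C E d)"
    unfolding e by (rule L(3)) (simp_all add: hom_def)
  show "act (proj (hom_pt C E c) (hom_pt C E d) k) (act (fmap (bracket V T C E) c d) u) =
      act (fmap (hom_fun V (vop V C) (fobj E k)) c d) u" if "k \<in> J" "u \<in> El (vhom C d c)"
    unfolding e by (rule L(4)) (use that in \<open>simp_all add: hom_def\<close>)
qed

lemma bracket_fobj [simp]: "c \<in> vobj C \<Longrightarrow> fobj (bracket V T C E) c = hom_pt C E c"
  by (simp add: bracket_def)

subsection \<open>The Yoneda embedding\<close>

lemma yoneda_fobj [simp]: "j \<in> J \<Longrightarrow> fobj (yoneda V T) j = hom_fun V T j"
  by (simp add: yoneda_def)

lemma yoneda_ar [simp]: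
  assumes [simp]: "i \<in> J" "j \<in> J"
  shows "fmap (yoneda V T) i j \<in> Ar V" "Dom V (fmap (yoneda V T) i j) = vhom T j i"
    "Cod V (fmap (yoneda V T) i j) = nat_ob V T (hom_fun V T i) (hom_fun V T j)"
    "k \<in> J \<Longrightarrow> u \<in> El (vhom T j i) \<Longrightarrow> act (proj (hom_fun V T i) (hom_fun V T j) k) (act (fmap (yoneda V T) i j) u) =
      act (fmap (hom_fun V (vop V T) k) i j) u"
proof -
  have e: "fmap (yoneda V T) i j = end_lift V T (hom_fun V T i) (hom_fun V T j) (vhom T j i)
      (\<lambda>k. fmap (hom_fun V (vop V T) k) i j)"
    by (simp add: yoneda_def)
  note L = Alg_lift[of "hom_fun V T i" "hom_fun V T j" "vhom T j i" "\<lambda>k. fmap (hom_fun V (vop V T) k) i j"]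
  show "fmap (yoneda V T) i j \<in> Ar V" unfolding e by (rule L(1)) (simp_all add: hom_def)
  show "Dom V (fmap (yoneda V T) i j) = vhom T j i" unfolding e by (rule L(2)) (simp_all add: hom_def)
  show "Cod V (fmap (yoneda V T) i j) = nat_ob V T (hom_fun V T i) (hom_fun V T j)"
    unfolding e by (rule L(3)) (simp_all add: hom_def)
  show "act (proj (hom_fun V T i) (hom_fun V T j) k) (act (fmap (yoneda V T) i j) u) =
      act (fmap (hom_fun V (vop V T) k) i j) u" if "k \<in> J" "u \<in> El (vhom T j i)"
    unfolding e by (rule L(4)) (use that in \<open>simp_all add: hom_def\<close>)
qed

lemma yoneda_idt:
  assumes [simp]: "j \<in> J"
  shows "act (fmap (yoneda V T) j j) (idt T j) = idt Alg (hom_fun V T j)"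
  by (rule Alg_ext[of "hom_fun V T j" "hom_fun V T j"]) simp_all

lemma yoneda_cmp:
  assumes [simp]: "i \<in> J" "j \<in> J" "k \<in> J" "g \<in> El (vhom T j k)" "f \<in> El (vhom T i j)" "disj g f" "disj f g"
  shows "act (fmap (yoneda V T) k i) (cmp T i j k g f) =
    cmp Alg (hom_fun V T k) (hom_fun V T j) (hom_fun V T i) (act (fmap (yoneda V T) j i) f) (act (fmap (yoneda V T) k j) g)"
  by (rule Alg_ext[of "hom_fun V T k" "hom_fun V T i"]) simp_all

text \<open>The Yoneda map a \<mapsto> (t \<mapsto> A t a) from A j into the hom-object. By
  \<open>yoneda_lift_unique\<close> it recovers each u from its value at the identity.\<close>

definition yoneda_lift :: "'o \<Rightarrow> ('m, 'o, 'o) vfun \<Rightarrow> 'm" where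
  "yoneda_lift j A = end_lift V T (hom_fun V T j) A (fobj A j)
    (\<lambda>k. curry_ar V (fobj A j) (vhom T j k) (fobj A k)
      (ev V (fobj A j) (fobj A k) \<cdot> ((fmap A j k \<boxtimes> Id V (fobj A j)) \<cdot> sym V (fobj A j) (vhom T j k))))"

lemma yoneda_lift_ar [simp]:
  assumes A [simp]: "alg A" and j [simp]: "j \<in> J"
  shows "yoneda_lift j A \<in> Ar V" "Dom V (yoneda_lift j A) = fobj A j" "Cod V (yoneda_lift j A) = nat_ob V T (hom_fun V T j) A"
    "k \<in> J \<Longrightarrow> a \<in> El (fobj A j) \<Longrightarrow> t \<in> El (vhom T j k) \<Longrightarrow> disj a t \<Longrightarrow> disj t a \<Longrightarrow>
      ap (vhom T j k) (fobj A k) (act (proj (hom_fun V T j) A k) (act (yoneda_lift j A) a)) t =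
      ap (fobj A j) (fobj A k) (act (fmap A j k) t) a"
proof -
  let ?d = "\<lambda>k. curry_ar V (fobj A j) (vhom T j k) (fobj A k)
      (ev V (fobj A j) (fobj A k) \<cdot> ((fmap A j k \<boxtimes> Id V (fobj A j)) \<cdot> sym V (fobj A j) (vhom T j k)))"
  note L = Alg_lift[of "hom_fun V T j" A "fobj A j" ?d, folded yoneda_lift_def]
  show "yoneda_lift j A \<in> Ar V" by (rule L(1)) (simp_all add: hom_def)
  show "Dom V (yoneda_lift j A) = fobj A j" by (rule L(2)) (simp_all add: hom_def)
  show "Cod V (yoneda_lift j A) = nat_ob V T (hom_fun V T j) A" by (rule L(3)) (simp_all add: hom_def)
  have "act (proj (hom_fun V T j) A k) (act (yoneda_lift j A) a) = act (?d k) a" if "k \<in> J" "a \<in> El (fobj A j)" for k a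
    by (rule L(4)) (use that in \<open>simp_all add: hom_def\<close>)
  then show "k \<in> J \<Longrightarrow> a \<in> El (fobj A j) \<Longrightarrow> t \<in> El (vhom T j k) \<Longrightarrow> disj a t \<Longrightarrow> disj t a \<Longrightarrow>
      ap (vhom T j k) (fobj A k) (act (proj (hom_fun V T j) A k) (act (yoneda_lift j A) a)) t =
      ap (fobj A j) (fobj A k) (act (fmap A j k) t) a" by simp
qed

text \<open>Naturality of u along t, applied to the identity of j.\<close>

lemma proj_yoneda:
  assumes [simp]: "alg A" "j \<in> J" "k \<in> J" "u \<in> El (nat_ob V T (hom_fun V T j) A)"
    "t \<in> El (vhom T j k)" "disj u t" "disj t u"
  shows "ap (vhom T j k) (fobj A k) (act (proj (hom_fun V T j) A k) u) t =
    ap (fobj A j) (fobj A k) (act (fmap A j k) t)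
      (ap (vhom T j j) (fobj A j) (act (proj (hom_fun V T j) A j) u) (idt T j))"
  using proj_natural[of "hom_fun V T j" A j k u t "idt T j"] by simp

lemma yoneda_lift_unique:
  assumes [simp]: "alg A" "j \<in> J" "u \<in> El (nat_ob V T (hom_fun V T j) A)"
  shows "act (yoneda_lift j A) (ap (vhom T j j) (fobj A j) (act (proj (hom_fun V T j) A j) u) (idt T j)) = u"
proof (rule Alg_ext[of "hom_fun V T j" A])
  fix k w assume [simp]: "k \<in> J" and w: "w \<in> El (fobj (hom_fun V T j) k)" "disj u w" "disj w u"
  then have "w \<in> El (vhom T j k)" by simp
  with w show "ap (fobj (hom_fun V T j) k) (fobj A k) (act (proj (hom_fun V T j) A k)
       (act (yoneda_lift j A) (ap (vhom T j j) (fobj A j) (act (proj (hom_fun V T j) A j) u) (idt T j)))) w =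
    ap (fobj (hom_fun V T j) k) (fobj A k) (act (proj (hom_fun V T j) A k) u) w"
    using proj_yoneda[of A j k u w] by simp
qed simp_all

subsection \<open>The algebra of a left adjoint\<close>

text \<open>The isomorphism B(L T(j, -), b) \<cong> (S b) j, natural in j (third property) and in b
  (fourth). It is stated for a right adjoint S out of any B and later used with B the opposite of
  C.\<close>

lemma left_adjoint_points:
  assumes B [simp]: "vcategory V B" and adj: "left_adjoint V Alg B L S"
  obtains \<psi> where
    "\<And>b j. b \<in> vobj B \<Longrightarrow> j \<in> J \<Longrightarrow> \<psi> b j \<in> hom V (vhom B (fobj L (hom_fun V T j)) b) (fobj (fobj S b) j)"
    "\<And>b j. b \<in> vobj B \<Longrightarrow> j \<in> J \<Longrightarrow> iso V (\<psi> b j)"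
    "\<And>b j k t f. b \<in> vobj B \<Longrightarrow> j \<in> J \<Longrightarrow> k \<in> J \<Longrightarrow> t \<in> El (vhom T j k) \<Longrightarrow>
      f \<in> El (vhom B (fobj L (hom_fun V T j)) b) \<Longrightarrow> disj t f \<Longrightarrow> disj f t \<Longrightarrow>
      act (\<psi> b k) (cmp B (fobj L (hom_fun V T k)) (fobj L (hom_fun V T j)) b f
        (act (fmap L (hom_fun V T k) (hom_fun V T j)) (act (fmap (yoneda V T) k j) t))) =
      ap (fobj (fobj S b) j) (fobj (fobj S b) k) (act (fmap (fobj S b) j k) t) (act (\<psi> b j) f)"
    "\<And>a b j g f. a \<in> vobj B \<Longrightarrow> b \<in> vobj B \<Longrightarrow> j \<in> J \<Longrightarrow> g \<in> El (vhom B a b) \<Longrightarrow>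
      f \<in> El (vhom B (fobj L (hom_fun V T j)) a) \<Longrightarrow> disj g f \<Longrightarrow> disj f g \<Longrightarrow>
      act (\<psi> b j) (cmp B (fobj L (hom_fun V T j)) a b g f) =
      ap (fobj (fobj S a) j) (fobj (fobj S b) j) (act (proj (fobj S a) (fobj S b) j) (act (fmap S a b) g)) (act (\<psi> a j) f)"
proof (rule left_adjointE[OF vcategory_Alg B adj])
  let ?S = "fobj S" and ?L = "fobj L"
  fix \<eta> \<epsilon>
  assume L: "vfunctor V Alg B L" and S: "vfunctor V B Alg S"
    and \<eta>: "\<And>a. a \<in> vobj Alg \<Longrightarrow> \<eta> a \<in> hom V U (vhom Alg a (?S (?L a)))"
    and \<epsilon>: "\<And>b. b \<in> vobj B \<Longrightarrow> \<epsilon> b \<in> hom V U (vhom B (?L (?S b)) b)"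
    and n\<eta>: "\<And>a b t. a \<in> vobj Alg \<Longrightarrow> b \<in> vobj Alg \<Longrightarrow> t \<in> El (vhom Alg a b) \<Longrightarrow>
      cmp Alg a b (?S (?L b)) (act (\<eta> b) star) t =
      cmp Alg a (?S (?L a)) (?S (?L b)) (act (fmap S (?L a) (?L b)) (act (fmap L a b) t)) (act (\<eta> a) star)"
    and n\<epsilon>: "\<And>a b t. a \<in> vobj B \<Longrightarrow> b \<in> vobj B \<Longrightarrow> t \<in> El (vhom B a b) \<Longrightarrow>
      cmp B (?L (?S a)) (?L (?S b)) b (act (\<epsilon> b) star) (act (fmap L (?S a) (?S b)) (act (fmap S a b) t)) =
      cmp B (?L (?S a)) a b t (act (\<epsilon> a) star)"
    and t1: "\<And>a. a \<in> vobj Alg \<Longrightarrow> cmp B (?L a) (?L (?S (?L a))) (?L a) (act (\<epsilon> (?L a)) star)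
      (act (fmap L a (?S (?L a))) (act (\<eta> a) star)) = idt B (?L a)"
    and t2: "\<And>b. b \<in> vobj B \<Longrightarrow> cmp Alg (?S b) (?S (?L (?S b))) (?S b)
      (act (fmap S (?L (?S b)) b) (act (\<epsilon> b) star)) (act (\<eta> (?S b)) star) = idt Alg (?S b)"
  note [simp] = vfunctorD[OF L, simplified] vfunctorD[OF S, simplified]
  have [simp]: "\<eta> a \<in> Ar V" "Dom V (\<eta> a) = U" "Cod V (\<eta> a) = nat_ob V T a (?S (?L a))"
    if "alg a" for a
    using \<eta>[of a] that by (simp_all add: hom_def)
  have [simp]: "\<epsilon> b \<in> Ar V" "Dom V (\<epsilon> b) = U" "Cod V (\<epsilon> b) = vhom B (?L (?S b)) b" if "b \<in> vobj B" for b
    using \<epsilon>[of b] that by (simp_all add: hom_def)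
  let ?Y = "hom_fun V T" and ?E = "\<lambda>j. ?L (hom_fun V T j)"
  let ?h = "\<lambda>j. act (\<eta> (?Y j)) star"
  \<comment> \<open>\<open>u j\<close> is the universal element \<open>\<eta> (1\<^sub>j)\<close> of \<open>(S (E j)) j\<close>; \<open>\<psi>\<close> sends \<open>f\<close> to \<open>S f (u j)\<close>, and its
    inverse \<open>\<chi>\<close> sends \<open>s\<close> to the adjoint transpose of the arrow \<open>T(j, -) \<rightarrow> S b\<close> that Yoneda
    assigns to \<open>s\<close>.\<close>
  define u where "u j = ev V (vhom T j j) (fobj (?S (?E j)) j) \<cdot>
      ((proj (?Y j) (?S (?E j)) j \<cdot> \<eta> (?Y j)) \<boxtimes> vid T j) \<cdot> inv (lunit V U)" for j
  have u_ar [simp]: "u j \<in> Ar V" "Dom V (u j) = U" "Cod V (u j) = fobj (?S (?E j)) j" if "j \<in> J" for j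
    using that by (simp_all add: u_def)
  have au: "act (u j) star = ap (vhom T j j) (fobj (?S (?E j)) j) (act (proj (?Y j) (?S (?E j)) j) (?h j)) (idt T j)"
    if "j \<in> J" for j
    using that by (simp add: u_def)
  define \<psi> where "\<psi> b j = ev V (fobj (?S (?E j)) j) (fobj (?S b) j) \<cdot>
      ((proj (?S (?E j)) (?S b) j \<cdot> fmap S (?E j) b) \<boxtimes> u j) \<cdot> inv (runit V (vhom B (?E j) b))" for b j
  have psi_ar [simp]: "\<psi> b j \<in> Ar V" "Dom V (\<psi> b j) = vhom B (?E j) b" "Cod V (\<psi> b j) = fobj (?S b) j"
    if "b \<in> vobj B" "j \<in> J" for b j
    using that by (simp_all add: \<psi>_def)
  have psi: "act (\<psi> b j) f = ap (fobj (?S (?E j)) j) (fobj (?S b) j)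
      (act (proj (?S (?E j)) (?S b) j) (act (fmap S (?E j) b) f)) (act (u j) star)"
    if "b \<in> vobj B" "j \<in> J" "f \<in> El (vhom B (?E j) b)" for b j f
    using that by (simp add: \<psi>_def)
  \<comment> \<open>The same value in the form to which Yoneda applies: the transformation S f
    \<circ> \<eta>, evaluated at the identity of j.\<close>
  have psi': "act (\<psi> b j) f = ap (vhom T j j) (fobj (?S b) j)
      (act (proj (?Y j) (?S b) j) (cmp Alg (?Y j) (?S (?E j)) (?S b) (act (fmap S (?E j) b) f) (?h j))) (idt T j)"
    if "b \<in> vobj B" "j \<in> J" "f \<in> El (vhom B (?E j) b)" for b j f
    using that by (simp add: psi au)
  define \<chi> where "\<chi> b j = vcomp B (?E j) (?L (?S b)) b \<cdot>
      (\<epsilon> b \<boxtimes> (fmap L (?Y j) (?S b) \<cdot> yoneda_lift j (?S b))) \<cdot> inv (lunit V (fobj (?S b) j))" for b j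
  have chi_ar [simp]: "\<chi> b j \<in> Ar V" "Dom V (\<chi> b j) = fobj (?S b) j" "Cod V (\<chi> b j) = vhom B (?E j) b"
    if "b \<in> vobj B" "j \<in> J" for b j
    using that by (simp_all add: \<chi>_def)
  have chi: "act (\<chi> b j) s = cmp B (?E j) (?L (?S b)) b (act (\<epsilon> b) star)
      (act (fmap L (?Y j) (?S b)) (act (yoneda_lift j (?S b)) s))"
    if "b \<in> vobj B" "j \<in> J" "s \<in> El (fobj (?S b) j)" for b j s
    using that by (simp add: \<chi>_def)
  have psi_chi: "act (\<psi> b j) (act (\<chi> b j) s) = s"
    if [simp]: "b \<in> vobj B" "j \<in> J" "s \<in> El (fobj (?S b) j)" for b j s
  proof -
    let ?s = "act (yoneda_lift j (?S b)) s"
    \<comment> \<open>It suffices that the adjoint transpose of \<chi> s is the Yoneda lift of s.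
      This is naturality of \<eta> followed by the triangle equation on the side of S.\<close>
    have "cmp Alg (?Y j) (?S (?E j)) (?S b) (act (fmap S (?E j) b) (act (\<chi> b j) s)) (?h j) =
        cmp Alg (?Y j) (?S (?L (?S b))) (?S b) (act (fmap S (?L (?S b)) b) (act (\<epsilon> b) star))
         (cmp Alg (?Y j) (?S (?E j)) (?S (?L (?S b)))
            (act (fmap S (?E j) (?L (?S b))) (act (fmap L (?Y j) (?S b)) ?s)) (?h j))"
      by (simp add: chi vfunctor_cmp[OF S])
    also have "\<dots> = cmp Alg (?Y j) (?S (?L (?S b))) (?S b) (act (fmap S (?L (?S b)) b) (act (\<epsilon> b) star))
         (cmp Alg (?Y j) (?S b) (?S (?L (?S b))) (act (\<eta> (?S b)) star) ?s)"
      by (subst n\<eta>) simp_all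
    also have "\<dots> = cmp Alg (?Y j) (?S b) (?S b) (cmp Alg (?S b) (?S (?L (?S b))) (?S b)
         (act (fmap S (?L (?S b)) b) (act (\<epsilon> b) star)) (act (\<eta> (?S b)) star)) ?s"
      by (rule vcategory_assoc[symmetric]) simp_all
    also have "\<dots> = ?s" by (subst t2) simp_all
    finally show ?thesis by (simp add: psi')
  qed
  have chi_psi: "act (\<chi> b j) (act (\<psi> b j) f) = f"
    if [simp]: "b \<in> vobj B" "j \<in> J" "f \<in> El (vhom B (?E j) b)" for b j f
  proof -
    \<comment> \<open>By Yoneda uniqueness the lift of \<psi> f is S f \<circ> \<eta>. Its transpose
      is f by naturality of \<epsilon> and the triangle equation on the side of L.\<close>
    have y: "act (yoneda_lift j (?S b)) (act (\<psi> b j) f) = cmp Alg (?Y j) (?S (?E j)) (?S b) (act (fmap S (?E j) b) f) (?h j)"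
      unfolding psi'[OF that] by (rule yoneda_lift_unique) simp_all
    have "act (\<chi> b j) (act (\<psi> b j) f) = cmp B (?E j) (?L (?S b)) b (act (\<epsilon> b) star)
      (act (fmap L (?Y j) (?S b)) (cmp Alg (?Y j) (?S (?E j)) (?S b) (act (fmap S (?E j) b) f) (?h j)))"
      by (subst chi) (simp_all add: y)
    also have "\<dots> = cmp B (?E j) (?L (?S (?E j))) b (cmp B (?L (?S (?E j))) (?L (?S b)) b (act (\<epsilon> b) star)
        (act (fmap L (?S (?E j)) (?S b)) (act (fmap S (?E j) b) f)))
      (act (fmap L (?Y j) (?S (?E j))) (?h j))"
      by (simp add: vfunctor_cmp[OF L])
    also have "\<dots> = cmp B (?E j) (?L (?S (?E j))) b (cmp B (?L (?S (?E j))) (?E j) b f (act (\<epsilon> (?E j)) star))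
      (act (fmap L (?Y j) (?S (?E j))) (?h j))"
      by (subst n\<epsilon>) simp_all
    also have "\<dots> = cmp B (?E j) (?E j) b f (cmp B (?E j) (?L (?S (?E j))) (?E j) (act (\<epsilon> (?E j)) star)
      (act (fmap L (?Y j) (?S (?E j))) (?h j)))"
      by simp
    also have "\<dots> = f" by (subst t1) simp_all
    finally show ?thesis .
  qed
  show ?thesis
  proof (rule that[of \<psi>])
    show "\<psi> b j \<in> hom V (vhom B (?E j) b) (fobj (?S b) j)" "iso V (\<psi> b j)" if "b \<in> vobj B" "j \<in> J" for b j
      using that iso_elementsI(1)[of "\<psi> b j" "vhom B (?E j) b" "fobj (?S b) j" "\<chi> b j"]
      by (simp_all add: hom_def psi_chi chi_psi)
  next
    fix b j k t f assume [simp]: "b \<in> vobj B" "j \<in> J" "k \<in> J" "t \<in> El (vhom T j k)" "f \<in> El (vhom B (?E j) b)"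
      "disj t f" "disj f t"
    let ?Et = "act (fmap L (?Y k) (?Y j)) (act (fmap (yoneda V T) k j) t)"
    \<comment> \<open>Naturality of \<eta> along the Yoneda image of t moves t into the argument of
      the component, where \<open>proj_yoneda\<close> turns it into the action of S b.\<close>
    have "cmp Alg (?Y k) (?S (?E k)) (?S b) (act (fmap S (?E k) b) (cmp B (?E k) (?E j) b f ?Et)) (?h k) =
        cmp Alg (?Y k) (?S (?E j)) (?S b) (act (fmap S (?E j) b) f)
          (cmp Alg (?Y k) (?S (?E k)) (?S (?E j)) (act (fmap S (?E k) (?E j)) ?Et) (?h k))"
      by (simp add: vfunctor_cmp[OF S])
    also have "\<dots> = cmp Alg (?Y k) (?S (?E j)) (?S b) (act (fmap S (?E j) b) f)
          (cmp Alg (?Y k) (?Y j) (?S (?E j)) (?h j) (act (fmap (yoneda V T) k j) t))"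
      by (subst n\<eta>) simp_all
    finally have "act (\<psi> b k) (cmp B (?E k) (?E j) b f ?Et) = ap (vhom T j k) (fobj (?S b) k)
        (act (proj (?Y j) (?S b) k) (cmp Alg (?Y j) (?S (?E j)) (?S b) (act (fmap S (?E j) b) f) (?h j))) t"
      by (simp add: psi')
    also have "\<dots> = ap (fobj (?S b) j) (fobj (?S b) k) (act (fmap (?S b) j k) t) (act (\<psi> b j) f)"
      unfolding psi'[OF \<open>b \<in> vobj B\<close> \<open>j \<in> J\<close> \<open>f \<in> El (vhom B (?E j) b)\<close>] by (rule proj_yoneda) simp_all
    finally show "act (\<psi> b k) (cmp B (?E k) (?E j) b f ?Et) =
      ap (fobj (?S b) j) (fobj (?S b) k) (act (fmap (?S b) j k) t) (act (\<psi> b j) f)" .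
  next
    fix a b j g f assume [simp]: "a \<in> vobj B" "b \<in> vobj B" "j \<in> J" "g \<in> El (vhom B a b)" "f \<in> El (vhom B (?E j) a)"
      "disj g f" "disj f g"
    show "act (\<psi> b j) (cmp B (?E j) a b g f) =
      ap (fobj (?S a) j) (fobj (?S b) j) (act (proj (?S a) (?S b) j) (act (fmap S a b) g)) (act (\<psi> a j) f)"
      by (simp add: psi vfunctor_cmp[OF S])
  qed
qed

text \<open>The arrow q is [x, h]. Its effect on elements is recorded as well, since it is used to
  compare powers in C with powers in \<open>V\<close>.\<close>

lemma iso_postcompose:
  assumes "iso V h" and [simp]: "x \<in> Ob V"
  obtains q where "iso V q" "q \<in> hom V (ihom V x (Dom V h)) (ihom V x (Cod V h))"
    "\<And>f y. f \<in> El (ihom V x (Dom V h)) \<Longrightarrow> y \<in> El x \<Longrightarrow> disj f y \<Longrightarrow>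
      ap x (Cod V h) (act q f) y = act h (ap x (Dom V h) f y)"
proof
  let ?q = "curry_ar V (ihom V x (Dom V h)) x (Cod V h) (h \<cdot> ev V x (Dom V h))"
  have [simp]: "iso V h" "h \<in> Ar V" using assms by (auto simp: iso_Ar)
  let ?y = "Dom V h" and ?z = "Cod V h"
  let ?r = "curry_ar V (ihom V x ?z) x ?y (inv h \<cdot> ev V x ?z)"
  show q: "?q \<in> hom V (ihom V x ?y) (ihom V x ?z)" by (simp add: hom_def)
  have [simp]: "?q \<in> Ar V" "Dom V ?q = ihom V x ?y" "Cod V ?q = ihom V x ?z" using q by (auto simp: hom_def)
  show "ap x ?z (act ?q f) y = act h (ap x ?y f y)"
    if "f \<in> El (ihom V x ?y)" "y \<in> El x" "disj f y" for f y
    using that by simp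
  show "iso V ?q"
  proof (rule iso_elementsI(1)[of _ "ihom V x ?y" "ihom V x ?z" ?r])
    show "act ?r (act ?q e) = e" if "e \<in> El (ihom V x ?y)" for e
      by (rule ap_ext[of _ x ?y]) (use that in simp_all)
    show "act ?q (act ?r e) = e" if "e \<in> El (ihom V x ?z)" for e
      by (rule ap_ext[of _ x ?z]) (use that in simp_all)
  qed (simp_all add: hom_def)
qed

theorem left_adjoint_algebra:
  assumes C [simp]: "vcategory V C" and adj: "left_adjoint V Alg (vop V C) L S"
  defines "E \<equiv> vfcomp V T (vfop L) (vfop (yoneda V T))"
  shows "is_algebra V J T C E" "viso V (vop V C) Alg S (bracket V T C E)"
proof -
  let ?S = "fobj S" and ?L = "fobj L" and ?B = "bracket V T C E" and ?H = "hom_pt C E"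
  have B: "vcategory V (vop V C)" by simp
  have L: "vfunctor V Alg (vop V C) L" and S: "vfunctor V (vop V C) Alg S"
    using adj by (auto simp: left_adjoint_def)
  note [simp] = vfunctorD[OF L, simplified] vfunctorD[OF S, simplified]
  let ?Y = "hom_fun V T"
  have Eo: "fobj E j = ?L (?Y j)" if "j \<in> J" for j
    using that by (simp add: E_def vfop_def)
  have Em: "fmap E i j = fmap L (?Y j) (?Y i) \<cdot> fmap (yoneda V T) j i" if "i \<in> J" "j \<in> J" for i j
    using that by (simp add: E_def vfop_def)
  have E: "vfunctor V T C E"
    unfolding E_def vfcomp_def
  proof (rule vfunctor_mk)
    fix a assume "a \<in> vobj T"
    then have [simp]: "a \<in> J" by simp
    show "act (fmap (vfop L) (fobj (vfop (yoneda V T)) a) (fobj (vfop (yoneda V T)) a) \<cdot> fmap (vfop (yoneda V T)) a a) (idt T a) =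
        idt C (fobj (vfop L) (fobj (vfop (yoneda V T)) a))"
      using vfunctor_idt[OF L vcategory_Alg, of "?Y a"] by (simp add: vfop_def yoneda_idt)
  next
    fix a b c u v assume "a \<in> vobj T" "b \<in> vobj T" "c \<in> vobj T" and [simp]: "u \<in> El (vhom T b c)" "v \<in> El (vhom T a b)"
      "disj u v" "disj v u"
    then have [simp]: "a \<in> J" "b \<in> J" "c \<in> J" by simp_all
    show "act (fmap (vfop L) (fobj (vfop (yoneda V T)) a) (fobj (vfop (yoneda V T)) c) \<cdot> fmap (vfop (yoneda V T)) a c) (cmp T a b c u v) =
       cmp C (fobj (vfop L) (fobj (vfop (yoneda V T)) a)) (fobj (vfop L) (fobj (vfop (yoneda V T)) b))
        (fobj (vfop L) (fobj (vfop (yoneda V T)) c))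
        (act (fmap (vfop L) (fobj (vfop (yoneda V T)) b) (fobj (vfop (yoneda V T)) c) \<cdot> fmap (vfop (yoneda V T)) b c) u)
        (act (fmap (vfop L) (fobj (vfop (yoneda V T)) a) (fobj (vfop (yoneda V T)) b) \<cdot> fmap (vfop (yoneda V T)) a b) v)"
      by (simp add: vfop_def yoneda_cmp vfunctor_cmp[OF L vcategory_Alg B])
  qed (simp_all add: vfop_def hom_def)
  note [simp] = vfunctorD[OF E, simplified]
  \<comment> \<open>Recognizes the action of L on Yoneda arrows, as it occurs in
    \<open>left_adjoint_points\<close>, as the action of E.\<close>
  have actE: "act (fmap L (?Y k) (?Y j)) (act (fmap (yoneda V T) k j) t) = act (fmap E j k) t"
    if "j \<in> J" "k \<in> J" "t \<in> El (vhom T j k)" for j k t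
    using that by (simp add: Em Eo)
  obtain \<psi> where psi_hom: "\<And>b j. b \<in> vobj (vop V C) \<Longrightarrow> j \<in> J \<Longrightarrow> \<psi> b j \<in> hom V (vhom (vop V C) (?L (?Y j)) b) (fobj (?S b) j)"
    and psi_iso: "\<And>b j. b \<in> vobj (vop V C) \<Longrightarrow> j \<in> J \<Longrightarrow> iso V (\<psi> b j)"
    and psi_T: "\<And>b j k t f. b \<in> vobj (vop V C) \<Longrightarrow> j \<in> J \<Longrightarrow> k \<in> J \<Longrightarrow> t \<in> El (vhom T j k) \<Longrightarrow>
      f \<in> El (vhom (vop V C) (?L (?Y j)) b) \<Longrightarrow> disj t f \<Longrightarrow> disj f t \<Longrightarrow>
      act (\<psi> b k) (cmp (vop V C) (?L (?Y k)) (?L (?Y j)) b f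
        (act (fmap L (?Y k) (?Y j)) (act (fmap (yoneda V T) k j) t))) =
      ap (fobj (?S b) j) (fobj (?S b) k) (act (fmap (?S b) j k) t) (act (\<psi> b j) f)"
    and psi_C: "\<And>a b j g f. a \<in> vobj (vop V C) \<Longrightarrow> b \<in> vobj (vop V C) \<Longrightarrow> j \<in> J \<Longrightarrow> g \<in> El (vhom (vop V C) a b) \<Longrightarrow>
      f \<in> El (vhom (vop V C) (?L (?Y j)) a) \<Longrightarrow> disj g f \<Longrightarrow> disj f g \<Longrightarrow>
      act (\<psi> b j) (cmp (vop V C) (?L (?Y j)) a b g f) =
      ap (fobj (?S a) j) (fobj (?S b) j) (act (proj (?S a) (?S b) j) (act (fmap S a b) g)) (act (\<psi> a j) f)"
    using left_adjoint_points[OF B adj] by blast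
  have psi_ar [simp]: "\<psi> b j \<in> Ar V" "Dom V (\<psi> b j) = vhom C b (fobj E j)" "Cod V (\<psi> b j) = fobj (?S b) j"
    "iso V (\<psi> b j)" if "b \<in> vobj C" "j \<in> J" for b j
    using psi_hom[of b j] psi_iso[of b j] that by (simp_all add: hom_def Eo)
  have psi_T': "act (\<psi> b k) (cmp C b (fobj E j) (fobj E k) (act (fmap E j k) t) f) =
      ap (fobj (?S b) j) (fobj (?S b) k) (act (fmap (?S b) j k) t) (act (\<psi> b j) f)"
    if "b \<in> vobj C" "j \<in> J" "k \<in> J" "t \<in> El (vhom T j k)" "f \<in> El (vhom C b (fobj E j))" "disj t f" "disj f t" for b j k t f
    using psi_T[of b j k t f] that by (simp add: actE Eo)
  have psi_C': "act (\<psi> b j) (cmp C b a (fobj E j) f g) =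
      ap (fobj (?S a) j) (fobj (?S b) j) (act (proj (?S a) (?S b) j) (act (fmap S a b) g)) (act (\<psi> a j) f)"
    if "a \<in> vobj C" "b \<in> vobj C" "j \<in> J" "g \<in> El (vhom C b a)" "f \<in> El (vhom C a (fobj E j))" "disj g f" "disj f g" for a b j f g
    using psi_C[of a b j g f] that by (simp add: Eo)
  show E_alg: "is_algebra V J T C E"
  proof (rule algebraI[OF E])
    fix x c p \<kappa> assume J [simp]: "x \<in> J" "c \<in> J" "p \<in> J" and pow: "is_power V T x c p \<kappa>" and k: "\<kappa> \<in> hom V x (vhom T p c)"
    have [simp]: "\<kappa> \<in> Ar V" "Dom V \<kappa> = x" "Cod V \<kappa> = vhom T p c" "x \<in> Ob V"
      using k hom_Ob[OF k] by (auto simp: hom_def)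
    have EJ: "fobj E c \<in> vobj C" "fobj E p \<in> vobj C" by simp_all
    let ?k = "fmap E p c \<cdot> \<kappa>"
    have k': "?k \<in> hom V x (vhom C (fobj E p) (fobj E c))" by (simp add: hom_def)
    \<comment> \<open>The comparison arrow at b factors as C(b, E p) \<rightarrow> (S b) p
      \<rightarrow> [x, (S b) c] \<rightarrow> [x, C(b, E c)]. The outer arrows come from \<psi>,
      and the middle one is invertible because the algebra S b preserves the power.\<close>
    have "iso V (power_ar C x (fobj E c) (fobj E p) ?k b)" if [simp]: "b \<in> vobj C" for b
    proof -
      let ?A = "?S b" and ?\<psi> = "inv (\<psi> b c)"
      have "iso V ?\<psi>" by simp
      then obtain q where q: "iso V q" "q \<in> hom V (ihom V x (Dom V ?\<psi>)) (ihom V x (Cod V ?\<psi>))"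
        "\<And>f y. f \<in> El (ihom V x (Dom V ?\<psi>)) \<Longrightarrow> y \<in> El x \<Longrightarrow> disj f y \<Longrightarrow>
          ap x (Cod V ?\<psi>) (act q f) y = act ?\<psi> (ap x (Dom V ?\<psi>) f y)"
        using iso_postcompose[OF _ \<open>x \<in> Ob V\<close>] by blast
      have [simp]: "q \<in> Ar V" "Dom V q = ihom V x (fobj ?A c)" "Cod V q = ihom V x (vhom C b (fobj E c))" "iso V q"
        using q(1,2) by (simp_all add: hom_def)
      let ?k' = "fmap ?A p c \<cdot> \<kappa>"
      have k'': "?k' \<in> hom V x (ihom V (fobj ?A p) (fobj ?A c))" by (simp add: hom_def)
      let ?P = "point_power_ar x (fobj ?A c) (fobj ?A p) ?k'"
      have "alg ?A" by simp
      then have "is_power V (vself V) x (fobj ?A c) (fobj ?A p) ?k'"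
        using pow J(1) unfolding is_algebra_def preserves_powers_def by blast
      then have i: "iso V ?P" by (rule is_power_vselfD)
      have [simp]: "?P \<in> Ar V" "Dom V ?P = fobj ?A p" "Cod V ?P = ihom V x (fobj ?A c)"
        using k'' by simp_all
      have "power_ar C x (fobj E c) (fobj E p) ?k b = q \<cdot> (?P \<cdot> \<psi> b p)"
      proof (rule arrow_ext_ap[of _ "vhom C b (fobj E p)" x "vhom C b (fobj E c)"])
        fix f y assume [simp]: "f \<in> El (vhom C b (fobj E p))" "y \<in> El x" "disj f y" "disj y f"
        have "ap x (vhom C b (fobj E c)) (act (q \<cdot> (?P \<cdot> \<psi> b p)) f) y =
            act ?\<psi> (ap x (fobj ?A c) (act ?P (act (\<psi> b p) f)) y)"
          using q(3)[of "act ?P (act (\<psi> b p) f)" y] by simp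
        also have "ap x (fobj ?A c) (act ?P (act (\<psi> b p) f)) y = ap (fobj ?A p) (fobj ?A c) (act ?k' y) (act (\<psi> b p) f)"
          by (rule ap_point_power_ar[OF _ k'']) simp_all
        also have "\<dots> = act (\<psi> b c) (cmp C b (fobj E p) (fobj E c) (act (fmap E p c) (act \<kappa> y)) f)"
          by (subst psi_T') simp_all
        finally show "ap x (vhom C b (fobj E c)) (act (power_ar C x (fobj E c) (fobj E p) ?k b) f) y =
            ap x (vhom C b (fobj E c)) (act (q \<cdot> (?P \<cdot> \<psi> b p)) f) y"
          using k' ap_power_ar[OF C EJ _ k', of b f y] by simp
      qed (use k' in \<open>simp_all add: hom_def\<close>)
      then show ?thesis using i by simp
    qed
    then show "is_power V C x (fobj E c) (fobj E p) ?k"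
      using k' by (simp add: is_power_iff)
  qed
  note [simp] = E_alg
  \<comment> \<open>The inverses of \<psi>, assembled over j through the end, lead from S to
    \<open>bracket\<close>; \<open>\<beta>\<close> assembles \<psi> itself and is the
    inverse.\<close>
  define \<alpha> where "\<alpha> b = end_lift V T (?S b) (?H b) U (\<lambda>j. name (fobj (?S b) j) (vhom C b (fobj E j)) (inv (\<psi> b j)))" for b
  define \<beta> where "\<beta> b = end_lift V T (?H b) (?S b) U (\<lambda>j. name (vhom C b (fobj E j)) (fobj (?S b) j) (\<psi> b j))" for b
  \<comment> \<open>Naturality of the inverses in j: apply \<open>psi_T'\<close> to the preimage of
    w and cancel \<psi>.\<close>
  have nat\<alpha>: "cmp C b (fobj E k) (fobj E l) (act (fmap E k l) t) (act (inv (\<psi> b k)) w) =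
        act (inv (\<psi> b l)) (ap (fobj (?S b) k) (fobj (?S b) l) (act (fmap (?S b) k l) t) w)"
    if [simp]: "b \<in> vobj C" "k \<in> J" "l \<in> J" "t \<in> El (vhom T k l)" "w \<in> El (fobj (?S b) k)" "disj t w" "disj w t" for b k l t w
  proof -
    have "act (inv (\<psi> b l)) (act (\<psi> b l) (cmp C b (fobj E k) (fobj E l) (act (fmap E k l) t) (act (inv (\<psi> b k)) w))) =
      act (inv (\<psi> b l)) (ap (fobj (?S b) k) (fobj (?S b) l) (act (fmap (?S b) k l) t) (act (\<psi> b k) (act (inv (\<psi> b k)) w)))"
      by (subst psi_T') simp_all
    then show ?thesis by simp
  qed
  have \<alpha>: "\<alpha> b \<in> Ar V" "Dom V (\<alpha> b) = U" "Cod V (\<alpha> b) = nat_ob V T (?S b) (?H b)"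
    "\<And>j. j \<in> J \<Longrightarrow> act (proj (?S b) (?H b) j) (act (\<alpha> b) star) = act (name (fobj (?S b) j) (vhom C b (fobj E j)) (inv (\<psi> b j))) star"
    if [simp]: "b \<in> vobj C" for b
  proof -
    note A = Alg_lift_unit[of "?S b" "?H b" "\<lambda>j. name (fobj (?S b) j) (vhom C b (fobj E j)) (inv (\<psi> b j))", folded \<alpha>_def]
    show "\<alpha> b \<in> Ar V" by (rule A(1)) (simp_all add: hom_def nat\<alpha>)
    show "Dom V (\<alpha> b) = U" by (rule A(2)) (simp_all add: hom_def nat\<alpha>)
    show "Cod V (\<alpha> b) = nat_ob V T (?S b) (?H b)" by (rule A(3)) (simp_all add: hom_def nat\<alpha>)
    show "act (proj (?S b) (?H b) j) (act (\<alpha> b) star) = act (name (fobj (?S b) j) (vhom C b (fobj E j)) (inv (\<psi> b j))) star"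
      if "j \<in> J" for j by (rule A(4)) (use that in \<open>simp_all add: hom_def nat\<alpha>\<close>)
  qed
  have \<beta>: "\<beta> b \<in> Ar V" "Dom V (\<beta> b) = U" "Cod V (\<beta> b) = nat_ob V T (?H b) (?S b)"
    "\<And>j. j \<in> J \<Longrightarrow> act (proj (?H b) (?S b) j) (act (\<beta> b) star) = act (name (vhom C b (fobj E j)) (fobj (?S b) j) (\<psi> b j)) star"
    if [simp]: "b \<in> vobj C" for b
  proof -
    note A = Alg_lift_unit[of "?H b" "?S b" "\<lambda>j. name (vhom C b (fobj E j)) (fobj (?S b) j) (\<psi> b j)", folded \<beta>_def]
    note n = psi_T'[symmetric]
    show "\<beta> b \<in> Ar V" by (rule A(1)) (simp_all add: hom_def n)
    show "Dom V (\<beta> b) = U" by (rule A(2)) (simp_all add: hom_def n)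
    show "Cod V (\<beta> b) = nat_ob V T (?H b) (?S b)" by (rule A(3)) (simp_all add: hom_def n)
    show "act (proj (?H b) (?S b) j) (act (\<beta> b) star) = act (name (vhom C b (fobj E j)) (fobj (?S b) j) (\<psi> b j)) star"
      if "j \<in> J" for j by (rule A(4)) (use that in \<open>simp_all add: hom_def n\<close>)
  qed
  note [simp] = \<alpha> \<beta>
  have inv1: "cmp Alg (?S b) (?H b) (?S b) (act (\<beta> b) star) (act (\<alpha> b) star) = idt Alg (?S b)"
    if [simp]: "b \<in> vobj C" for b
    by (rule Alg_ext[of "?S b" "?S b"]) simp_all
  have inv2: "cmp Alg (?H b) (?S b) (?H b) (act (\<alpha> b) star) (act (\<beta> b) star) = idt Alg (?H b)"
    if [simp]: "b \<in> vobj C" for b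
    by (rule Alg_ext[of "?H b" "?H b"]) simp_all
  note [simp] = bracket_ar[OF C E_alg]
  have nat: "cmp Alg (?S a) (?S b) (?H b) (act (\<alpha> b) star) (act (fmap S a b) t) =
      cmp Alg (?S a) (?H a) (?H b) (act (fmap (?B) a b) t) (act (\<alpha> a) star)"
    if [simp]: "a \<in> vobj C" "b \<in> vobj C" "t \<in> El (vhom C b a)" for a b t
  proof (rule Alg_ext[of "?S a" "?H b"])
    fix j w assume [simp]: "j \<in> J" "w \<in> El (fobj (?S a) j)"
      and "disj (cmp Alg (?S a) (?S b) (?H b) (act (\<alpha> b) star) (act (fmap S a b) t)) w"
        "disj w (cmp Alg (?S a) (?S b) (?H b) (act (\<alpha> b) star) (act (fmap S a b) t))"
    then have [simp]: "disj t w" "disj w t" by simp_all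
    \<comment> \<open>Naturality in b by the same cancellation, now from
      \<open>psi_C'\<close>.\<close>
    have "act (inv (\<psi> b j)) (act (\<psi> b j) (cmp C b a (fobj E j) (act (inv (\<psi> a j)) w) t)) =
      act (inv (\<psi> b j)) (ap (fobj (?S a) j) (fobj (?S b) j) (act (proj (?S a) (?S b) j) (act (fmap S a b) t))
       (act (\<psi> a j) (act (inv (\<psi> a j)) w)))"
      by (subst psi_C') simp_all
    then show "ap (fobj (?S a) j) (fobj (?H b) j) (act (proj (?S a) (?H b) j)
         (cmp Alg (?S a) (?S b) (?H b) (act (\<alpha> b) star) (act (fmap S a b) t))) w =
       ap (fobj (?S a) j) (fobj (?H b) j) (act (proj (?S a) (?H b) j)
         (cmp Alg (?S a) (?H a) (?H b) (act (fmap (?B) a b) t) (act (\<alpha> a) star))) w"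
      by simp
  qed simp_all
  have "vnat V (vop V C) Alg S (?B) \<alpha>"
    by (subst vnat_iff) (simp_all add: hom_def nat)
  moreover have "\<exists>\<gamma>\<in>hom V U (vhom Alg (fobj (?B) b) (?S b)).
      cmp Alg (?S b) (fobj (?B) b) (?S b) (act \<gamma> star) (act (\<alpha> b) star) = idt Alg (?S b) \<and>
      cmp Alg (fobj (?B) b) (?S b) (fobj (?B) b) (act (\<alpha> b) star) (act \<gamma> star) =
        idt Alg (fobj (?B) b)" if "b \<in> vobj C" for b
    by (rule bexI[of _ "\<beta> b"]) (use that inv1 inv2 in \<open>simp_all add: hom_def\<close>)
  ultimately have "vnat_iso V (vop V C) Alg S (?B) \<alpha>"
    by (subst vnat_iso_iff) simp_all
  then show "viso V (vop V C) Alg S (?B)" by (auto simp: viso_def)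
qed

subsection \<open>The left adjoint of a representable functor\<close>

text \<open>The presheaf that {A, E} represents is T-Alg(A, -) after \<open>bracket\<close>, on
  objects and on arrows. This links weighted limits in C to hom-objects of algebras.\<close>

lemma weighted_presheaf_simps:
  assumes C [simp]: "vcategory V C" and E [simp]: "is_algebra V J T C E" and A [simp]: "alg A"
  shows "b \<in> vobj C \<Longrightarrow> fobj (weighted_presheaf V T C A E) b = nat_ob V T A (hom_pt C E b)"
    "\<And>t w. b \<in> vobj C \<Longrightarrow> b' \<in> vobj C \<Longrightarrow> t \<in> El (vhom C b' b) \<Longrightarrow> w \<in> El (nat_ob V T A (hom_pt C E b)) \<Longrightarrow> disj t w \<Longrightarrow>
      ap (nat_ob V T A (hom_pt C E b)) (nat_ob V T A (hom_pt C E b')) (act (fmap (weighted_presheaf V T C A E) b b') t) w =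
      cmp Alg A (hom_pt C E b) (hom_pt C E b') (act (fmap (bracket V T C E) b b') t) w"
    "vfunctor V (vop V C) (vself V) (weighted_presheaf V T C A E)"
proof -
  let ?B = "bracket V T C E" and ?H = "hom_pt C E" and ?W = "weighted_presheaf V T C A E"
  note [simp] = bracket_ar[OF C E] vfunctorD[OF algebra_vfunctor[OF E], simplified]
  show o: "fobj (?W) b = nat_ob V T A (?H b)" if "b \<in> vobj C" for b
    using that by (simp add: weighted_presheaf_def Let_def)
  \<comment> \<open>Composition with the image under \<open>bracket\<close>, as an arrow of
    \<open>V\<close>. Its components are those prescribed in \<open>weighted_presheaf\<close>, so it
    is the factorization chosen there.\<close>
  define M where "M b b' = vcomp Alg A (?H b) (?H b') \<cdot>
    (fmap (?B) b b' \<boxtimes> Id V (nat_ob V T A (?H b)))" for b b'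
  have M [simp]: "M b b' \<in> Ar V" "Dom V (M b b') = vhom C b' b \<otimes> nat_ob V T A (?H b)"
    "Cod V (M b b') = nat_ob V T A (?H b')"
    if "b \<in> vobj C" "b' \<in> vobj C" for b b'
    using that by (simp_all add: M_def)
  have aM [simp]: "act (M b b') (pr t w) = cmp Alg A (?H b) (?H b') (act (fmap (?B) b b') t) w"
    if "b \<in> vobj C" "b' \<in> vobj C" "t \<in> El (vhom C b' b)" "w \<in> El (nat_ob V T A (?H b))" "disj t w" for b b' t w
    using that by (simp add: M_def)
  have lift: "end_lift V T A (?H b') (vhom C b' b \<otimes> nat_ob V T A (?H b))
      (\<lambda>k. vcomp (vself V) (fobj A k) (fobj (?H b) k) (fobj (?H b') k) \<cdot>
         (fmap (hom_fun V (vop V C) (fobj E k)) b b' \<boxtimes> proj A (?H b) k)) = M b b'"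
    if [simp]: "b \<in> vobj C" "b' \<in> vobj C" for b b'
  proof (rule end_lift_eqI)
    fix k assume "k \<in> vobj T"
    then have [simp]: "k \<in> J" by simp
    show "vcomp (vself V) (fobj A k) (fobj (?H b) k) (fobj (?H b') k) \<cdot>
         (fmap (hom_fun V (vop V C) (fobj E k)) b b' \<boxtimes> proj A (?H b) k) = proj A (?H b') k \<cdot> M b b'"
      by (rule arrow_ext2[of _ "vhom C b' b" "nat_ob V T A (?H b)" "ihom V (fobj A k) (vhom C b' (fobj E k))"])
        (simp_all add: hom_def)
  qed (simp_all add: hom_def)
  have m: "fmap (?W) b b' =
      curry_ar V (vhom C b' b) (nat_ob V T A (?H b)) (nat_ob V T A (?H b')) (M b b')"
    if "b \<in> vobj C" "b' \<in> vobj C" for b b'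
    using lift[OF that] that unfolding weighted_presheaf_def Let_def by simp
  show a: "ap (nat_ob V T A (?H b)) (nat_ob V T A (?H b')) (act (fmap (?W) b b') t) w =
      cmp Alg A (?H b) (?H b') (act (fmap (?B) b b') t) w"
    if "b \<in> vobj C" "b' \<in> vobj C" "t \<in> El (vhom C b' b)" "w \<in> El (nat_ob V T A (?H b))" "disj t w" for b b' t w
    using that by (simp add: m)
  \<comment> \<open>Brings the presheaf into the shape that \<open>vfunctor_mk\<close> expects while
    its action on homs stays opaque.\<close>
  have e: "?W = mk_vfun (vobj (vop V C)) (\<lambda>b. nat_ob V T A (?H b)) (fmap (?W))"
    by (auto simp: weighted_presheaf_def Let_def mk_vfun_def fun_eq_iff)
  show "vfunctor V (vop V C) (vself V) (?W)"
  proof (subst e, rule vfunctor_mk)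
    fix b assume "b \<in> vobj (vop V C)"
    then have [simp]: "b \<in> vobj C" by simp
    show "act (fmap (?W) b b) (idt (vop V C) b) = idt (vself V) (nat_ob V T A (?H b))"
    proof (rule ap_ext[of _ "nat_ob V T A (?H b)" "nat_ob V T A (?H b)"])
      fix w assume [simp]: "w \<in> El (nat_ob V T A (?H b))"
      have "cmp Alg A (?H b) (?H b) (act (fmap (?B) b b) (idt C b)) w = w"
        by (rule Alg_ext[of A "?H b"]) simp_all
      then show "ap (nat_ob V T A (?H b)) (nat_ob V T A (?H b)) (act (fmap (?W) b b) (idt (vop V C) b)) w =
        ap (nat_ob V T A (?H b)) (nat_ob V T A (?H b)) (idt (vself V) (nat_ob V T A (?H b))) w"
        by (simp add: a)
    qed (simp_all add: m)
  next
    fix b c d u v assume "b \<in> vobj (vop V C)" "c \<in> vobj (vop V C)" "d \<in> vobj (vop V C)"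
      "u \<in> El (vhom (vop V C) c d)" "v \<in> El (vhom (vop V C) b c)" and [simp]: "disj u v" "disj v u"
    then have [simp]: "b \<in> vobj C" "c \<in> vobj C" "d \<in> vobj C" "u \<in> El (vhom C d c)" "v \<in> El (vhom C c b)" by simp_all
    let ?N = "\<lambda>b. nat_ob V T A (?H b)"
    have [simp]: "fmap ?W p q \<in> Ar V" "Dom V (fmap ?W p q) = vhom C q p" "Cod V (fmap ?W p q) = ihom V (?N p) (?N q)"
      if "p \<in> vobj C" "q \<in> vobj C" for p q using that by (simp_all add: m)
    show "act (fmap ?W b d) (cmp (vop V C) b c d u v) = cmp (vself V) (?N b) (?N c) (?N d) (act (fmap ?W c d) u) (act (fmap ?W b c) v)"
    proof (rule ap_ext[of _ "?N b" "?N d"])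
      fix w assume [simp]: "w \<in> El (?N b)" and "disj (act (fmap ?W b d) (cmp (vop V C) b c d u v)) w" "disj w (act (fmap ?W b d) (cmp (vop V C) b c d u v))"
      then have [simp]: "disj u w" "disj w u" "disj v w" "disj w v" by simp_all
      have "cmp Alg A (?H b) (?H d) (act (fmap (?B) b d) (cmp C d c b v u)) w =
          cmp Alg A (?H c) (?H d) (act (fmap (?B) c d) u)
           (cmp Alg A (?H b) (?H c) (act (fmap (?B) b c) v) w)"
        by (rule Alg_ext[of A "?H d"]) simp_all
      then show "ap (?N b) (?N d) (act (fmap ?W b d) (cmp (vop V C) b c d u v)) w =
        ap (?N b) (?N d) (cmp (vself V) (?N b) (?N c) (?N d) (act (fmap ?W c d) u) (act (fmap ?W b c) v)) w"
        by (simp add: a)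
    qed simp_all
  qed (simp_all add: hom_def m)
qed

theorem representable_left_adjoint:
  assumes C [simp]: "vcategory V C" and lim: "admits_algebra_limits V J T C"
    and S: "vfunctor V (vop V C) Alg S" and rep: "representable V J T C S"
  shows "\<exists>L. left_adjoint V Alg (vop V C) L S"
proof -
  obtain E \<alpha> where E [simp]: "is_algebra V J T C E" and iso\<alpha>: "vnat_iso V (vop V C) Alg S (bracket V T C E) \<alpha>"
    using rep by (auto simp: representable_def viso_def)
  let ?S = "fobj S" and ?B = "bracket V T C E" and ?H = "hom_pt C E"
  note [simp] = bracket_ar(1-3)[OF C E] vfunctorD[OF S, simplified]
  have n: "vnat V (vop V C) Alg S (?B) \<alpha>" using iso\<alpha> by (simp add: vnat_iso_def)
  note n' = n[unfolded vnat_def]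
  have \<alpha> [simp]: "\<alpha> b \<in> Ar V" "Dom V (\<alpha> b) = U" "Cod V (\<alpha> b) = nat_ob V T (?S b) (?H b)" if "b \<in> vobj C" for b
    using n' that by (simp_all add: hom_def)
  have nat: "cmp Alg (?S a) (?S b) (?H b) (act (\<alpha> b) star) (act (fmap S a b) t) =
      cmp Alg (?S a) (?H a) (?H b) (act (fmap (?B) a b) t) (act (\<alpha> a) star)"
    if "a \<in> vobj C" "b \<in> vobj C" "t \<in> El (vhom C b a)" for a b t
    using n that by (subst (asm) vnat_iff) (simp_all add: hom_def)
  have "\<forall>b\<in>vobj C. \<exists>\<gamma>\<in>hom V U (vhom Alg (?H b) (?S b)).
      cmp Alg (?S b) (?H b) (?S b) (act \<gamma> star) (act (\<alpha> b) star) = idt Alg (?S b) \<and>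
      cmp Alg (?H b) (?S b) (?H b) (act (\<alpha> b) star) (act \<gamma> star) = idt Alg (?H b)"
    using iso\<alpha> by (subst (asm) vnat_iso_iff) simp_all
  then obtain \<beta> where \<beta>: "\<And>b. b \<in> vobj C \<Longrightarrow> \<beta> b \<in> hom V U (nat_ob V T (?H b) (?S b))"
    and inv1: "\<And>b. b \<in> vobj C \<Longrightarrow> cmp Alg (?S b) (?H b) (?S b) (act (\<beta> b) star) (act (\<alpha> b) star) = idt Alg (?S b)"
    and inv2: "\<And>b. b \<in> vobj C \<Longrightarrow> cmp Alg (?H b) (?S b) (?H b) (act (\<alpha> b) star) (act (\<beta> b) star) = idt Alg (?H b)"
    unfolding Alg_simps by metis
  have [simp]: "\<beta> b \<in> Ar V" "Dom V (\<beta> b) = U" "Cod V (\<beta> b) = nat_ob V T (?H b) (?S b)" if "b \<in> vobj C" for b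
    using \<beta>[OF that] by (simp_all add: hom_def)
  \<comment> \<open>The inverse laws with a further arrow out of X attached, as rewriting on
    right-nested composites requires.\<close>
  have inv1' [simp]: "cmp Alg X (?H b) (?S b) (act (\<beta> b) star) (cmp Alg X (?S b) (?H b) (act (\<alpha> b) star) w) = w"
    if [simp]: "b \<in> vobj C" "alg X" "w \<in> El (nat_ob V T X (?S b))" for X b w
  proof -
    have "cmp Alg X (?H b) (?S b) (act (\<beta> b) star) (cmp Alg X (?S b) (?H b) (act (\<alpha> b) star) w) =
        cmp Alg X (?S b) (?S b) (cmp Alg (?S b) (?H b) (?S b) (act (\<beta> b) star) (act (\<alpha> b) star)) w"
      by (rule vcategory_assoc[symmetric]) simp_all
    also have "\<dots> = w" by (subst inv1) simp_all
    finally show ?thesis .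
  qed
  have inv2' [simp]: "cmp Alg X (?S b) (?H b) (act (\<alpha> b) star) (cmp Alg X (?H b) (?S b) (act (\<beta> b) star) w) = w"
    if [simp]: "b \<in> vobj C" "alg X" "w \<in> El (nat_ob V T X (?H b))" for X b w
  proof -
    have "cmp Alg X (?S b) (?H b) (act (\<alpha> b) star) (cmp Alg X (?H b) (?S b) (act (\<beta> b) star) w) =
        cmp Alg X (?H b) (?H b) (cmp Alg (?H b) (?S b) (?H b) (act (\<alpha> b) star) (act (\<beta> b) star)) w"
      by (rule vcategory_assoc[symmetric]) simp_all
    also have "\<dots> = w" by (subst inv2) simp_all
    finally show ?thesis .
  qed
  \<comment> \<open>Naturality of the inverse: insert \<beta> \<circ> \<alpha> in front, move
    \<alpha> past S t, and cancel \<alpha> \<circ> \<beta>.\<close>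
  have nat\<beta>: "cmp Alg X (?S a) (?S b) (act (fmap S a b) t) (cmp Alg X (?H a) (?S a) (act (\<beta> a) star) w) =
      cmp Alg X (?H b) (?S b) (act (\<beta> b) star) (cmp Alg X (?H a) (?H b) (act (fmap (?B) a b) t) w)"
    if [simp]: "a \<in> vobj C" "b \<in> vobj C" "t \<in> El (vhom C b a)" "alg X" "w \<in> El (nat_ob V T X (?H a))"
      "disj t w" for X a b t w
  proof -
    let ?w = "cmp Alg X (?H a) (?S a) (act (\<beta> a) star) w"
    have "cmp Alg X (?S a) (?S b) (act (fmap S a b) t) ?w =
        cmp Alg X (?H b) (?S b) (act (\<beta> b) star)
         (cmp Alg X (?S b) (?H b) (act (\<alpha> b) star) (cmp Alg X (?S a) (?S b) (act (fmap S a b) t) ?w))"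
      by (rule inv1'[symmetric]) simp_all
    also have "cmp Alg X (?S b) (?H b) (act (\<alpha> b) star) (cmp Alg X (?S a) (?S b) (act (fmap S a b) t) ?w) =
        cmp Alg X (?S a) (?H b) (cmp Alg (?S a) (?S b) (?H b) (act (\<alpha> b) star) (act (fmap S a b) t)) ?w"
      by (rule vcategory_assoc[symmetric]) simp_all
    also have "\<dots> = cmp Alg X (?S a) (?H b)
        (cmp Alg (?S a) (?H a) (?H b) (act (fmap (?B) a b) t) (act (\<alpha> a) star)) ?w"
      by (subst nat) simp_all
    also have "\<dots> = cmp Alg X (?H a) (?H b) (act (fmap (?B) a b) t) w"
      by simp
    finally show ?thesis .
  qed
  \<comment> \<open>One predicate for the whole universal arrow, so that l, \<eta> and \<Phi> can be
    chosen for all algebras together.\<close>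
  define P where "P A l \<eta> \<Phi> \<longleftrightarrow> l \<in> vobj C \<and> \<eta> \<in> hom V U (nat_ob V T A (?S l)) \<and>
      (\<forall>b\<in>vobj C. \<Phi> b \<in> hom V (vhom C b l) (nat_ob V T A (?S b)) \<and> iso V (\<Phi> b) \<and>
        (\<forall>u\<in>El (vhom C b l). act (\<Phi> b) u = cmp Alg A (?S l) (?S b) (act (fmap S l b) u) (act \<eta> star)))"
    for A l \<eta> \<Phi>
  have "\<exists>l \<eta> \<Phi>. P A l \<eta> \<Phi>" if A [simp]: "alg A" for A
  proof -
    let ?W = "weighted_presheaf V T C A E"
    note [simp] = weighted_presheaf_simps(1,2)[OF C E A]
    obtain l \<phi> where [simp]: "l \<in> vobj C" and i: "vnat_iso V (vop V C) (vself V) (hom_fun V (vop V C) l) ?W \<phi>"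
      using lim A E unfolding admits_algebra_limits_def is_weighted_limit_def viso_def by blast
    define h where "h b = unname V (fobj (hom_fun V (vop V C) l) b) (fobj ?W b) (\<phi> b)" for b
    note h = viso_vselfE[OF vcategory_vop[OF C] vfunctor_hom_fun weighted_presheaf_simps(3)[OF C E A] i, folded h_def, simplified]
    have [simp]: "h b \<in> Ar V" "Dom V (h b) = vhom C b l" "Cod V (h b) = nat_ob V T A (?H b)" "iso V (h b)"
      if "b \<in> vobj C" for b
      using h(1,2)[of b] that by (simp_all add: hom_def)
    \<comment> \<open>Yoneda: the representation h is determined by its universal element, the image
      of the identity of l.\<close>
    have hl: "act (h b) t = cmp Alg A (?H l) (?H b) (act (fmap (?B) l b) t) (act (h l) (idt C l))"
      if "b \<in> vobj C" "t \<in> El (vhom C b l)" for b t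
      using h(4)[of l b t "idt C l"] that by simp
    \<comment> \<open>The limit represents arrows from A into C(-, E -); composing with \<beta>
      transports this to arrows into S. \<open>?\<Psi>\<close> goes back by \<alpha> and the inverse
      of h.\<close>
    let ?\<eta> = "vcomp Alg A (?H l) (?S l) \<cdot> (\<beta> l \<boxtimes> (h l \<cdot> vid C l)) \<cdot> inv (lunit V U)"
    let ?\<Phi> = "\<lambda>b. vcomp Alg A (?H b) (?S b) \<cdot> (\<beta> b \<boxtimes> h b) \<cdot> inv (lunit V (vhom C b l))"
    let ?\<Psi> = "\<lambda>b. inv (h b) \<cdot> (vcomp Alg A (?S b) (?H b) \<cdot> (\<alpha> b \<boxtimes> Id V (nat_ob V T A (?S b))) \<cdot>
      inv (lunit V (nat_ob V T A (?S b))))"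
    have f1: "iso V (?\<Phi> b)" if [simp]: "b \<in> vobj C" for b
      by (rule iso_elementsI(1)[of _ "vhom C b l" "nat_ob V T A (?S b)" "?\<Psi> b"]) (simp_all add: hom_def)
    have f2: "act (?\<Phi> b) u = cmp Alg A (?S l) (?S b) (act (fmap S l b) u) (act ?\<eta> star)"
      if [simp]: "b \<in> vobj C" "u \<in> El (vhom C b l)" for b u
      by (simp add: nat\<beta> hl[symmetric])
    have f3: "?\<Phi> b \<in> hom V (vhom C b l) (nat_ob V T A (?S b))" if "b \<in> vobj C" for b
      using that by (simp add: hom_def)
    have f4: "?\<eta> \<in> hom V U (nat_ob V T A (?S l))" by (simp add: hom_def)
    have "P A l ?\<eta> ?\<Phi>"
      unfolding P_def using f1 f2 f3 f4 \<open>l \<in> vobj C\<close> by blast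
    then show ?thesis by blast
  qed
  then obtain l \<eta> \<Phi> where "\<And>A. alg A \<Longrightarrow> P A (l A) (\<eta> A) (\<Phi> A)"
    by metis
  note P = this[unfolded P_def]
  show ?thesis
    \<comment> \<open>In the opposite of C the hom-object from l A to b is C(b, l A), so the limits
      are exactly universal arrows from A to S.\<close>
    by (rule left_adjoint_if_universal[of Alg "vop V C" S l \<eta> \<Phi>])
      (use S P in simp_all)
qed

end

theorem theorem3p4:
  fixes V :: "('o, 'm) smc"
    and J :: "'o set"
    and T :: "('o, 'm, 'o) vcat"
    and \<tau> :: "('m, 'o, 'o) vfun"
    and C :: "('o, 'm, 'c) vcat"
    and pow :: "'o \<Rightarrow> 'c \<Rightarrow> 'c"
    and counit :: "'o \<Rightarrow> 'c \<Rightarrow> 'm"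
    and S :: "('m, 'c, ('m, 'o, 'o) vfun) vfun"
  assumes "symmetric_monoidal_closed V"
    and "has_finite_limits V"
    and "system_of_arities V J"
    and "amenable V J"
    and "is_theory V J T \<tau>"
    and "vcategory V C"
    and "has_powers V J C pow counit"
    and "admits_algebra_limits V J T C"
    and "vfunctor V (vop V C) (alg_cat V J T) S"
  shows "(representable V J T C S \<longleftrightarrow>
            (\<exists>L. left_adjoint V (alg_cat V J T) (vop V C) L S)) \<and>
         (\<forall>L. left_adjoint V (alg_cat V J T) (vop V C) L S \<longrightarrow>
            (let E = vfcomp V T (vfop L) (vfop (yoneda V T))
             in is_algebra V J T C E \<and>
                viso V (vop V C) (alg_cat V J T) S (bracket V T C E)))"
proof -
  interpret arity_theory V J T \<tau>
    using assms(1,3-5) by (simp add: arity_theory_def arity_theory_axioms_def)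
  have alg: "is_algebra V J T C (vfcomp V T (vfop L) (vfop (yoneda V T)))"
    "viso V (vop V C) Alg S (bracket V T C (vfcomp V T (vfop L) (vfop (yoneda V T))))"
    if "left_adjoint V Alg (vop V C) L S" for L
    using left_adjoint_algebra[OF assms(6) that] by simp_all
  moreover have "representable V J T C S" if "left_adjoint V Alg (vop V C) L S" for L
    using alg[OF that] unfolding representable_def by blast
  moreover have "\<exists>L. left_adjoint V Alg (vop V C) L S" if "representable V J T C S"
    using representable_left_adjoint[OF assms(6,8,9) that] .
  ultimately show ?thesis by (auto simp: Let_def)
qed

end
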